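(* Let $H:[0,\infty)\to[\mu,\nu]\subset(0,1)$ be $\beta$-Hölder continuous with $\sup_{s\ge 0}H(s)<\beta$, and let $B=(B^{H(t)}(t),\,t\ge 0)$ be the multifractional Brownian motion with Hurst function $H$ given by the moving average representation $$B^{H(t)}(t)=\frac{1}{\Gamma(H(t)+1/2)}\left(\int_{-\infty}^{0}\big[(t-u)^{H(t)-1/2}-(-u)^{H(t)-1/2}\big]\,W(du)+\int_0^t (t-u)^{H(t)-1/2}\,W(du)\right).$$ Let $L(t,x)$ be its jointly continuous local time. Then for every $t\in\mathbb{R}^+$ and any $x\in\mathbb{R}$ there exist positive and finite constants $C_1$ and $C_2$ such that $$\limsup_{\delta\to 0}\frac{L(t+\delta,B^{H(t)}(t))-L(t,B^{H(t)}(t))}{\delta^{1-H(t)}(\log\log(\delta^{-1}))^{H(t)}}\le C_1\quad\text{a.s.},$$ $$\limsup_{\delta\to 0}\frac{L(t+\delta,x)-L(t,x)}{\delta^{1-H(t)}(\log\log(\delta^{-1}))^{H(t)}}\le C_2\quad\text{a.s.}$$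
   Context: $W$ is a standard Brownian motion on $(-\infty,+\infty)$; $\mathbb{R}^+=[0,\infty)$; $\delta\to0$ through positive values; $C_1,C_2$ are deterministic. Local time: for a real-valued separable process $X$ with Borel sample functions and a Borel set $A\subset\mathbb{R}^+$, the occupation measure is $\mu_A(D)=\lambda\{s\in A: X(s)\in D\}$, $D\in\mathcal{B}(\mathbb{R})$, with $\lambda$ Lebesgue measure. If $\mu_A$ is absolutely continuous with respect to Lebesgue measure, its density is the local time $L(A,\cdot)$, taken in a measurable modification satisfying the occupation density formula $\int_A f(X(t))\,dt=\int_{\mathbb{R}}f(x)L(A,x)\,dx$ for all Borel $A\subset\mathbb{R}^+$ and measurable $f\ge0$. Write $L(t,x)=L([0,t],x)$. Under the stated hypotheses on $H$ it is known that the multifractional Brownian motion has a jointly continuous local time, i.e. a version for which $(t,x)\mapsto L(t,x)$ is continuous; $L$ denotes this version. *)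

theory Defs
  imports "HOL-Probability.Probability"
begin

text \<open>Standard Brownian motion indexed by the whole real line.\<close>

definition brownian_motion :: "'a measure \<Rightarrow> (real \<Rightarrow> 'a \<Rightarrow> real) \<Rightarrow> bool" where
  "brownian_motion M W \<longleftrightarrow>
     prob_space M \<and>
     (\<forall>t. W t \<in> borel_measurable M) \<and>
     (AE \<omega> in M. W 0 \<omega> = 0) \<and>
     (\<forall>s t. s < t \<longrightarrow>
        distributed M lborel (\<lambda>\<omega>. W t \<omega> - W s \<omega>) (normal_density 0 (sqrt (t - s)))) \<and>
     (\<forall>(n::nat) \<tau> :: nat \<Rightarrow> real. strict_mono_on {..n} \<tau> \<longrightarrow>
        prob_space.indep_vars M (\<lambda>_. borel) (\<lambda>i \<omega>. W (\<tau> (Suc i)) \<omega> - W (\<tau> i) \<omega>) {..<n}) \<and>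
     (AE \<omega> in M. continuous_on UNIV (\<lambda>t. W t \<omega>))"

text \<open>
  A step function is coded by a list of triples \<open>(c, a, b)\<close>, each standing for the function
  \<open>c\<close> times the indicator of \<open>(a, b]\<close>.
\<close>

definition step_fun :: "(real \<times> real \<times> real) list \<Rightarrow> real \<Rightarrow> real" where
  "step_fun p u = (\<Sum>(c, a, b)\<leftarrow>p. c * indicator {a<..b} u)"

definition step_integral ::
    "(real \<Rightarrow> 'a \<Rightarrow> real) \<Rightarrow> (real \<times> real \<times> real) list \<Rightarrow> 'a \<Rightarrow> real" where
  "step_integral W p \<omega> = (\<Sum>(c, a, b)\<leftarrow>p. c * (W b \<omega> - W a \<omega>))"

text \<open>
  \<open>Y\<close> is (a version of) the Wiener integral of the deterministic function \<open>f\<close> over \<open>A\<close> against \<open>W\<close>: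
  the mean-square limit of the integrals of step functions converging to \<open>f\<close> times the indicator
  of \<open>A\<close> in the space of square-integrable functions on the line. By the Ito isometry such a \<open>Y\<close>
  exists exactly when \<open>f\<close> is square integrable on \<open>A\<close>, and it is unique almost surely.
\<close>

definition has_wiener_integral ::
    "'a measure \<Rightarrow> (real \<Rightarrow> 'a \<Rightarrow> real) \<Rightarrow> real set \<Rightarrow> (real \<Rightarrow> real) \<Rightarrow> ('a \<Rightarrow> real) \<Rightarrow> bool" where
  "has_wiener_integral M W A f Y \<longleftrightarrow>
     (\<lambda>u. indicator A u * f u) \<in> borel_measurable borel \<and>
     Y \<in> borel_measurable M \<and>
     (\<exists>p :: nat \<Rightarrow> (real \<times> real \<times> real) list.
        (\<forall>n. \<forall>(c, a, b) \<in> set (p n). a \<le> b) \<and>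
        (\<lambda>n. \<integral>\<^sup>+u. ennreal ((indicator A u * f u - step_fun (p n) u)\<^sup>2) \<partial>lborel) \<longlonglongrightarrow> 0 \<and>
        (\<lambda>n. \<integral>\<^sup>+\<omega>. ennreal ((Y \<omega> - step_integral W (p n) \<omega>)\<^sup>2) \<partial>M) \<longlonglongrightarrow> 0)"

definition multifractional_brownian_motion ::
    "'a measure \<Rightarrow> (real \<Rightarrow> 'a \<Rightarrow> real) \<Rightarrow> (real \<Rightarrow> real) \<Rightarrow> (real \<Rightarrow> 'a \<Rightarrow> real) \<Rightarrow> bool" where
  "multifractional_brownian_motion M W H B \<longleftrightarrow>
     (\<forall>t\<ge>0. B t \<in> borel_measurable M \<and>
        (\<exists>Y Z.
           has_wiener_integral M W {..<0}
             (\<lambda>u. (t - u) powr (H t - 1/2) - (- u) powr (H t - 1/2)) Y \<and>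
           has_wiener_integral M W {0<..<t} (\<lambda>u. (t - u) powr (H t - 1/2)) Z \<and>
           (AE \<omega> in M. B t \<omega> = 1 / Gamma (H t + 1/2) * (Y \<omega> + Z \<omega>))))"

text \<open>Separability in the sense of Doob, for processes indexed by the half-line.\<close>

definition separable_process :: "'a measure \<Rightarrow> (real \<Rightarrow> 'a \<Rightarrow> real) \<Rightarrow> bool" where
  "separable_process M X \<longleftrightarrow>
     (\<exists>S. countable S \<and> S \<subseteq> {0..} \<and>
        (AE \<omega> in M. \<forall>a b K. closed K \<longrightarrow>
           (\<forall>s\<in>S \<inter> {a<..<b}. X s \<omega> \<in> K) \<longrightarrow> (\<forall>s\<in>{0..} \<inter> {a<..<b}. X s \<omega> \<in> K)))"

definition borel_sample_functions :: "'a measure \<Rightarrow> (real \<Rightarrow> 'a \<Rightarrow> real) \<Rightarrow> bool" where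
  "borel_sample_functions M X \<longleftrightarrow>
     (\<forall>\<omega>\<in>space M. (\<lambda>s. X s \<omega>) \<in> borel_measurable (restrict_space borel {0..}))"

definition occupation_measure :: "(real \<Rightarrow> real) \<Rightarrow> real set \<Rightarrow> real measure" where
  "occupation_measure x A = distr (restrict_space lborel A) borel x"

text \<open>
  The local time \<open>L A x \<omega>\<close> takes values in the extended nonnegative reals, since it may be infinite
  for a set \<open>A\<close> of infinite Lebesgue measure. The occupation density formula is equivalent to the
  equality of measures below; see the lemma \<open>occupation_density_formula\<close>.
\<close>

definition is_local_time ::
    "'a measure \<Rightarrow> (real \<Rightarrow> 'a \<Rightarrow> real) \<Rightarrow> (real set \<Rightarrow> real \<Rightarrow> 'a \<Rightarrow> ennreal) \<Rightarrow> bool" where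
  "is_local_time M X L \<longleftrightarrow>
     (AE \<omega> in M. \<forall>A \<in> sets borel. A \<subseteq> {0..} \<longrightarrow>
        (\<lambda>x. L A x \<omega>) \<in> borel_measurable borel \<and>
        occupation_measure (\<lambda>s. X s \<omega>) A = density lborel (\<lambda>x. L A x \<omega>))"

definition local_time_upto ::
    "(real set \<Rightarrow> real \<Rightarrow> 'a \<Rightarrow> ennreal) \<Rightarrow> real \<Rightarrow> real \<Rightarrow> 'a \<Rightarrow> real" where
  "local_time_upto L t x \<omega> = enn2real (L {0..t} x \<omega>)"

definition jointly_continuous_local_time ::
    "'a measure \<Rightarrow> (real \<Rightarrow> 'a \<Rightarrow> real) \<Rightarrow> (real set \<Rightarrow> real \<Rightarrow> 'a \<Rightarrow> ennreal) \<Rightarrow> bool" where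
  "jointly_continuous_local_time M X L \<longleftrightarrow>
     is_local_time M X L \<and>
     (AE \<omega> in M. (\<forall>t\<ge>0. \<forall>x. L {0..t} x \<omega> < \<infinity>) \<and>
        continuous_on ({0..} \<times> UNIV) (\<lambda>(t, x). local_time_upto L t x \<omega>))"

lemma emeasure_occupation_measure:
  assumes "x \<in> borel_measurable (restrict_space borel {0..})"
    and "A \<in> sets borel" "A \<subseteq> {0..}" "D \<in> sets borel"
  shows "emeasure (occupation_measure x A) D = emeasure lborel {s \<in> A. x s \<in> D}"
proof -
  have x: "x \<in> borel_measurable (restrict_space lborel A)"
    using measurable_restrict_mono[OF assms(1,3)]
    by (simp cong: measurable_cong_sets add: sets_restrict_space)
  have eq: "x -` D \<inter> A = {s \<in> A. x s \<in> D}"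
    by auto
  show ?thesis
    unfolding occupation_measure_def
    using assms x
    by (subst emeasure_distr) (auto simp: eq space_restrict_space emeasure_restrict_space)
qed

lemma occupation_density_formula:
  assumes x: "x \<in> borel_measurable (restrict_space borel {0..})"
    and A: "A \<in> sets borel" "A \<subseteq> {0..}"
    and l: "l \<in> borel_measurable borel"
  shows "occupation_measure x A = density lborel l \<longleftrightarrow>
    (\<forall>f \<in> borel_measurable borel.
       (\<integral>\<^sup>+t. f (x t) * indicator A t \<partial>lborel) = (\<integral>\<^sup>+y. f y * l y \<partial>lborel))"
    (is "?L \<longleftrightarrow> ?R")
proof -
  have xA: "x \<in> borel_measurable (restrict_space lborel A)"
    using measurable_restrict_mono[OF x A(2)]
    by (simp cong: measurable_cong_sets add: sets_restrict_space)
  have occ: "(\<integral>\<^sup>+y. f y \<partial>occupation_measure x A) = (\<integral>\<^sup>+t. f (x t) * indicator A t \<partial>lborel)"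
    if "f \<in> borel_measurable borel" for f :: "real \<Rightarrow> ennreal"
    using that xA A unfolding occupation_measure_def
    by (subst nn_integral_distr) (auto simp: nn_integral_restrict_space)
  have dens: "(\<integral>\<^sup>+y. f y \<partial>density lborel l) = (\<integral>\<^sup>+y. f y * l y \<partial>lborel)"
    if "f \<in> borel_measurable borel" for f :: "real \<Rightarrow> ennreal"
    using that l by (subst nn_integral_density) (auto simp: mult.commute)
  show ?thesis
  proof
    assume ?L then show ?R using occ dens by metis
  next
    assume R: ?R
    show ?L
    proof (rule measure_eqI)
      show "sets (occupation_measure x A) = sets (density lborel l)"
        by (simp add: occupation_measure_def)
      fix D assume "D \<in> sets (occupation_measure x A)"
      then have D: "D \<in> sets borel" by (simp add: occupation_measure_def)
      then have i: "(indicator D :: real \<Rightarrow> ennreal) \<in> borel_measurable borel" by simp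
      have "(\<integral>\<^sup>+y. indicator D y \<partial>occupation_measure x A) = (\<integral>\<^sup>+y. indicator D y \<partial>density lborel l)"
        using occ[OF i] dens[OF i] R i by auto
      then show "emeasure (occupation_measure x A) D = emeasure (density lborel l) D"
        using D by (simp add: occupation_measure_def)
    qed
  qed
qed

end

theory Submission
  imports Defs
begin

text \<open>
Write \<open>B\<close> for the process and fix \<open>t \<ge> 0\<close>. The occupation formula and the continuity of the local time in
the level express the increment \<open>L (t + \<delta>) y - L t y\<close> as the limit, for \<open>\<epsilon>\<close> to \<open>0\<close>, of the occupation of the
window \<open>(y - \<epsilon>, y + \<epsilon>)\<close> during \<open>(t, t + \<delta>]\<close>, divided by \<open>2 \<epsilon>\<close>. It is therefore enough to bound the
moments of these window averages uniformly in \<open>\<epsilon>\<close>.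

The source of the moment bound is that the moving average keeps receiving fresh noise. For \<open>s < r\<close> the part of
\<open>B r\<close> that stems from the increments of \<open>W\<close> after time \<open>s\<close> is Gaussian with variance at least a constant times
\<open>(r - s) powr (2 * H r)\<close>, and it is independent of the past of \<open>s\<close>. So, whatever happened up to time \<open>s\<close>, the
conditional density of \<open>B r\<close> is at most a constant times \<open>(r - s) powr (- H r)\<close>: this is
\<open>wiener_integral_window\<close> and \<open>B_window\<close>. The bound does not see which level is observed, as long as the level
belongs to the past of \<open>t\<close>; a fixed level and the level \<open>B t\<close> are thus treated at the same time.

Expanding the \<open>n\<close>-th power of an occupation integral into an iterated integral over ordered times and applying
the density bound at the latest time first yields a moment bound by induction on \<open>n\<close>
(\<open>occupation_moment_bound\<close>). An exponential weight with rate \<open>n / \<delta>\<close> replaces the usual Dirichlet integral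
and gives \<open>n\<close>-th moments at most \<open>(C * n powr h * \<delta> powr (1 - h)) ^ n\<close>, where \<open>h\<close> is an upper bound of \<open>H\<close> on
\<open>[t, t + \<delta>]\<close> (\<open>window_occupation_moment\<close>). With \<open>n\<close> of the order \<open>ln (ln (1 / \<delta>))\<close>, Markov's inequality and the
Borel-Cantelli lemma along \<open>\<delta> = exp (- k)\<close> give the asserted upper bound along that sequence, because \<open>h\<close> may
be taken within \<open>K * \<delta> powr \<beta>\<close> of \<open>H t\<close>, which changes the bound by a constant factor only. Monotonicity of the
local time in \<open>t\<close> fills the gaps between consecutive scales.

The iterated integrals require Fubini's theorem, hence a version of \<open>B\<close> that is jointly measurable in time and
sample point. It comes from almost sure continuity: the mean square increments of the kernel satisfy a Hoelder
bound, high Gaussian moments permit dyadic chaining, and separability carries the continuity over from a countable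
set of times to the half-line (\<open>B_continuous\<close>).

Limits of random variables are handled by Fatou's lemma throughout. As only upper bounds are needed, the law of a
Wiener integral never has to be identified: the Gaussian computations concern step functions only.
\<close>

abbreviation sq_norm :: "'b measure \<Rightarrow> ('b \<Rightarrow> real) \<Rightarrow> ennreal" where
  "sq_norm N f \<equiv> \<integral>\<^sup>+x. ennreal ((f x)\<^sup>2) \<partial>N"

abbreviation window :: "real \<Rightarrow> real \<Rightarrow> real set" where
  "window y \<epsilon> \<equiv> {y - \<epsilon> <..< y + \<epsilon>}"

abbreviation time_integral :: "real \<Rightarrow> real \<Rightarrow> (real \<Rightarrow> ennreal) \<Rightarrow> ennreal" where
  "time_integral s b f \<equiv> \<integral>\<^sup>+r. (if s < r \<and> r \<le> b then f r else 0) \<partial>lborel"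

section \<open>Past and future increments of Brownian motion\<close>

lemma finite_set_as_grid:
  fixes K :: "real set"
  assumes "finite K" "K \<noteq> {}"
  obtains n \<tau> where "strict_mono_on {..n::nat} \<tau>" "\<tau> ` {..n} = K"
proof -
  define l where "l = sorted_list_of_set K"
  define n where "n = card K - 1"
  have len: "length l = Suc n"
    using assms by (simp add: l_def n_def card_gt_0_iff)
  have "strict_mono_on {..n} ((!) l)"
    using sorted_wrt_nth_less[OF strict_sorted_list_of_set[of K]] len
    by (auto simp: strict_mono_on_def l_def)
  moreover have "(!) l ` {..n} = K"
  proof -
    have "{..n} = {0..<length l}" using len by auto
    then have "(!) l ` {..n} = set l" by (simp add: list.set_map[symmetric] map_nth flip: set_upt del: set_upt)
    then show ?thesis using assms by (simp add: l_def)
  qed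
  ultimately show ?thesis using that by blast
qed

locale line_brownian_motion =
  fixes M :: "'a measure" and W :: "real \<Rightarrow> 'a \<Rightarrow> real"
  assumes bm: "brownian_motion M W"
begin

sublocale prob_space M using bm by (simp add: brownian_motion_def)

lemma W_measurable [measurable]: "W t \<in> borel_measurable M"
  using bm by (simp add: brownian_motion_def)

lemma increment_normal:
  "s < t \<Longrightarrow> distributed M lborel (\<lambda>\<omega>. W t \<omega> - W s \<omega>) (normal_density 0 (sqrt (t - s)))"
  using bm by (simp add: brownian_motion_def)

lemma grid_increments_indep:
  "strict_mono_on {..n::nat} \<tau> \<Longrightarrow>
   indep_vars (\<lambda>_. borel) (\<lambda>i \<omega>. W (\<tau> (Suc i)) \<omega> - W (\<tau> i) \<omega>) {..<n}"
  using bm by (simp add: brownian_motion_def)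

text \<open>
The past of a time \<open>s\<close> is \<open>increments {..s}\<close> and its future is \<open>increments {s..}\<close>. They are generated by
increments and not by values of \<open>W\<close>, because independence is a property of the increments; the value of \<open>W\<close> at \<open>0\<close>
is constant only up to a null set.
\<close>

definition increments :: "real set \<Rightarrow> 'a measure" where
  "increments J = sigma (space M)
     {(\<lambda>\<omega>. W v \<omega> - W w \<omega>) -` A \<inter> space M | v w A. v \<in> J \<and> w \<in> J \<and> A \<in> sets borel}"

lemma space_increments [simp]: "space (increments J) = space M"
  unfolding increments_def by (rule space_measure_of) auto

lemma sets_increments:
  "sets (increments J) = sigma_sets (space M)
     {(\<lambda>\<omega>. W v \<omega> - W w \<omega>) -` A \<inter> space M | v w A. v \<in> J \<and> w \<in> J \<and> A \<in> sets borel}"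
  unfolding increments_def by (subst sets_measure_of) auto

lemma increment_measurable:
  assumes "v \<in> J" "w \<in> J"
  shows "(\<lambda>\<omega>. W v \<omega> - W w \<omega>) \<in> borel_measurable (increments J)"
  using assms by (intro measurableI) (auto simp: sets_increments intro!: sigma_sets.Basic)

lemma sets_increments_least:
  assumes "sigma_algebra (space M) N"
    and "\<And>v w. v \<in> J \<Longrightarrow> w \<in> J \<Longrightarrow> (\<lambda>\<omega>. W v \<omega> - W w \<omega>) \<in> borel_measurable (sigma (space M) N)"
  shows "sets (increments J) \<subseteq> N"
proof -
  interpret sigma_algebra "space M" N by fact
  have *: "sets (sigma (space M) N) = N"
    using sets_measure_of_eq by (simp add: sets_measure_of_conv space_closed)
  show ?thesis unfolding sets_increments
  proof (rule sigma_sets_subset, clarify)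
    fix v w A assume "v \<in> J" "w \<in> J" "A \<in> sets (borel :: real measure)"
    from measurable_sets[OF assms(2)[OF this(1,2)] this(3)]
    show "(\<lambda>\<omega>. W v \<omega> - W w \<omega>) -` A \<inter> space M \<in> N" by (simp add: *)
  qed
qed

lemma sets_increments_mono: "J \<subseteq> J' \<Longrightarrow> sets (increments J) \<subseteq> sets (increments J')"
  unfolding sets_increments by (rule sigma_sets_mono') blast

lemma measurable_increments_mono:
  "f \<in> measurable (increments J) N \<Longrightarrow> J \<subseteq> J' \<Longrightarrow> f \<in> measurable (increments J') N"
  using sets_increments_mono[of J J'] by (auto simp: measurable_def)

lemma sets_increments_events: "sets (increments J) \<subseteq> events"
  unfolding sets_increments by (rule sets.sigma_sets_subset) auto

lemma measurable_increments_events: "f \<in> measurable (increments J) N \<Longrightarrow> f \<in> measurable M N"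
  using sets_increments_events[of J] by (auto simp: measurable_def)

lemma grid_generates_increments:
  fixes n :: nat
  assumes "strict_mono_on {..n} \<tau>" "lo \<le> hi" "hi \<le> n"
  shows "sets (increments (\<tau> ` {lo..hi})) \<subseteq> sigma_sets (space M)
    (\<Union>i\<in>{lo..<hi}. {(\<lambda>\<omega>. W (\<tau> (Suc i)) \<omega> - W (\<tau> i) \<omega>) -` A \<inter> space M |A. A \<in> sets borel})"
    (is "_ \<subseteq> sigma_sets _ ?G")
proof (rule sets_increments_least)
  have G: "?G \<subseteq> Pow (space M)" by auto
  then show "sigma_algebra (space M) (sigma_sets (space M) ?G)" by (rule sigma_algebra_sigma_sets)
  let ?N = "sigma (space M) (sigma_sets (space M) ?G)"
  have sets_N: "sets ?N = sigma_sets (space M) ?G"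
    by (subst sets_measure_of)
       (use sigma_sets_into_sp[OF G] sigma_sets_sigma_sets_eq[OF G] in auto)
  have space_N: "space ?N = space M"
    by (subst space_measure_of) (use sigma_sets_into_sp[OF G] in auto)
  have D: "(\<lambda>\<omega>. W (\<tau> (Suc i)) \<omega> - W (\<tau> i) \<omega>) \<in> borel_measurable ?N" if "i \<in> {lo..<hi}" for i
  proof (rule measurableI)
    fix A assume "A \<in> sets (borel :: real measure)"
    then show "(\<lambda>\<omega>. W (\<tau> (Suc i)) \<omega> - W (\<tau> i) \<omega>) -` A \<inter> space ?N \<in> sets ?N"
      unfolding sets_N space_N by (intro sigma_sets.Basic UN_I[OF that]) blast
  qed simp
  have rel: "(\<lambda>\<omega>. W (\<tau> i) \<omega> - W (\<tau> lo) \<omega>) \<in> borel_measurable ?N" if "i \<in> {lo..hi}" for i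
  proof -
    have "(\<lambda>\<omega>. \<Sum>l\<in>{lo..<i}. W (\<tau> (Suc l)) \<omega> - W (\<tau> l) \<omega>) \<in> borel_measurable ?N"
      using that by (intro borel_measurable_sum D) auto
    moreover have "(\<Sum>l\<in>{lo..<i}. W (\<tau> (Suc l)) \<omega> - W (\<tau> l) \<omega>) = W (\<tau> i) \<omega> - W (\<tau> lo) \<omega>" for \<omega>
      using that by (subst sum_Suc_diff') auto
    ultimately show ?thesis by simp
  qed
  fix v w assume "v \<in> \<tau> ` {lo..hi}" "w \<in> \<tau> ` {lo..hi}"
  then obtain i j where ij: "v = \<tau> i" "w = \<tau> j" "i \<in> {lo..hi}" "j \<in> {lo..hi}" by auto
  have "(\<lambda>\<omega>. (W (\<tau> i) \<omega> - W (\<tau> lo) \<omega>) - (W (\<tau> j) \<omega> - W (\<tau> lo) \<omega>)) \<in> borel_measurable ?N"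
    by (intro borel_measurable_diff rel ij)
  then show "(\<lambda>\<omega>. W v \<omega> - W w \<omega>) \<in> borel_measurable ?N" by (simp add: ij)
qed

text \<open>
Sorting all the points involved turns them into a grid. The increments between points before \<open>s\<close> and those
between points after \<open>s\<close> are then functions of two disjoint blocks of independent grid increments.
\<close>

lemma finite_past_indep_future:
  assumes J: "finite J" "J \<subseteq> {..s}" "s \<in> J" and J': "finite J'" "J' \<subseteq> {s..}" "s \<in> J'"
  shows "indep_set (sets (increments J)) (sets (increments J'))"
proof -
  obtain n \<tau> where \<tau>: "strict_mono_on {..n::nat} \<tau>" "\<tau> ` {..n} = J \<union> J'"
    using finite_set_as_grid[of "J \<union> J'"] J J' by blast
  then obtain m where m: "m \<le> n" "\<tau> m = s" using J by force
  have ord: "\<tau> i \<le> \<tau> j \<longleftrightarrow> i \<le> j" if "i \<le> n" "j \<le> n" for i j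
    using strict_mono_on_less_eq[OF \<tau>(1)] that by auto
  have Jm: "J \<subseteq> \<tau> ` {0..m}"
  proof
    fix v assume "v \<in> J"
    then obtain i where "v = \<tau> i" "i \<le> n" using \<tau>(2) by blast
    moreover have "v \<le> s" using \<open>v \<in> J\<close> J by auto
    ultimately show "v \<in> \<tau> ` {0..m}" using ord[of i m] m by auto
  qed
  have Jm': "J' \<subseteq> \<tau> ` {m..n}"
  proof
    fix v assume "v \<in> J'"
    then obtain i where "v = \<tau> i" "i \<le> n" using \<tau>(2) by blast
    moreover have "s \<le> v" using \<open>v \<in> J'\<close> J' by auto
    ultimately show "v \<in> \<tau> ` {m..n}" using ord[of m i] m by auto
  qed
  let ?E = "\<lambda>i. {(\<lambda>\<omega>. W (\<tau> (Suc i)) \<omega> - W (\<tau> i) \<omega>) -` A \<inter> space M |A. A \<in> sets borel}"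
  let ?I = "case_bool {0..<m} {m..<n}"
  have "indep_sets ?E {..<n}"
    using grid_increments_indep[OF \<tau>(1)] unfolding indep_vars_def2 by simp
  moreover have "(\<Union>j\<in>UNIV. ?I j) = {..<n}" using m by (auto simp: UNIV_bool)
  ultimately have "indep_sets (\<lambda>j. sigma_sets (space M) (\<Union>i\<in>?I j. ?E i)) UNIV"
  proof (intro indep_sets_collect_sigma)
    show "Int_stable (?E i)" for i
      unfolding Int_stable_def by (auto, rule_tac x="A \<inter> Aa" in exI, auto)
    show "disjoint_family ?I"
      by (auto simp: disjoint_family_on_def split: bool.splits)
  qed auto
  then show ?thesis unfolding indep_set_def
  proof (rule indep_sets_mono_sets)
    fix b :: bool
    show "case_bool (sets (increments J)) (sets (increments J')) b
        \<subseteq> sigma_sets (space M) (\<Union>i\<in>?I b. ?E i)"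
      using sets_increments_mono[OF Jm] sets_increments_mono[OF Jm']
        grid_generates_increments[OF \<tau>(1), of 0 m] grid_generates_increments[OF \<tau>(1), of m n] m
      by (cases b) auto
  qed
qed

lemma Int_stable_finite_increments:
  "Int_stable (\<Union>J\<in>{J. finite J \<and> J \<subseteq> I \<and> s \<in> J}. sets (increments J))" (is "Int_stable ?G")
proof (rule Int_stableI)
  fix a b assume "a \<in> ?G" "b \<in> ?G"
  then obtain J J' where J: "finite J" "J \<subseteq> I" "s \<in> J" "a \<in> sets (increments J)"
    and J': "finite J'" "J' \<subseteq> I" "s \<in> J'" "b \<in> sets (increments J')" by auto
  have "a \<inter> b \<in> sets (increments (J \<union> J'))"
    using J(4) J'(4) sets_increments_mono[of J "J \<union> J'"] sets_increments_mono[of J' "J \<union> J'"] by auto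
  with J J' show "a \<inter> b \<in> ?G" by (intro UN_I[of "J \<union> J'"]) auto
qed

lemma increments_from_finite:
  assumes "s \<in> I"
  shows "sets (increments I) \<subseteq>
    sigma_sets (space M) (\<Union>J\<in>{J. finite J \<and> J \<subseteq> I \<and> s \<in> J}. sets (increments J))"
  unfolding sets_increments[of I]
proof (rule sigma_sets_mono, clarify)
  fix v w A assume "v \<in> I" "w \<in> I" and A: "A \<in> sets (borel :: real measure)"
  have "(\<lambda>\<omega>. W v \<omega> - W w \<omega>) -` A \<inter> space M \<in> sets (increments {v, w, s})"
    using measurable_sets[OF increment_measurable[of v "{v, w, s}" w] A] by simp
  then show "(\<lambda>\<omega>. W v \<omega> - W w \<omega>) -` A \<inter> space M \<in>
      sigma_sets (space M) (\<Union>J\<in>{J. finite J \<and> J \<subseteq> I \<and> s \<in> J}. sets (increments J))"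
    using \<open>v \<in> I\<close> \<open>w \<in> I\<close> assms by (intro sigma_sets.Basic UN_I[of "{v, w, s}"]) auto
qed

text \<open>
The events that depend on finitely many times form an intersection-stable generator, since two finite sets of
times have a finite union.
\<close>

lemma past_indep_future: "indep_set (sets (increments {..s})) (sets (increments {s..}))"
proof -
  let ?G = "\<lambda>I. (\<Union>J\<in>{J. finite J \<and> J \<subseteq> I \<and> s \<in> J}. sets (increments J))"
  have "indep_set (?G {..s}) (?G {s..})"
  proof (rule indep_setI)
    show "?G {..s} \<subseteq> events" "?G {s..} \<subseteq> events" using sets_increments_events by blast+
    fix a b assume "a \<in> ?G {..s}" "b \<in> ?G {s..}"
    then obtain J J' where "a \<in> sets (increments J)" "b \<in> sets (increments J')"
      "finite J" "J \<subseteq> {..s}" "s \<in> J" "finite J'" "J' \<subseteq> {s..}" "s \<in> J'" by auto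
    then show "prob (a \<inter> b) = prob a * prob b"
      using finite_past_indep_future[of J s J'] by (auto simp: indep_setD)
  qed
  then have "indep_set (sigma_sets (space M) (?G {..s})) (sigma_sets (space M) (?G {s..}))"
    by (rule indep_set_sigma_sets) (rule Int_stable_finite_increments)+
  then show ?thesis unfolding indep_set_def
    by (rule indep_sets_mono_sets)
       (use increments_from_finite[of s "{..s}"] increments_from_finite[of s "{s..}"] in \<open>auto split: bool.split\<close>)
qed

end

section \<open>Stochastic integrals of step functions\<close>

definition ordered_steps :: "(real \<times> real \<times> real) list \<Rightarrow> bool" where
  "ordered_steps p \<longleftrightarrow> (\<forall>(c, a, b)\<in>set p. a \<le> b)"

definition endpoints :: "(real \<times> real \<times> real) list \<Rightarrow> real set" where
  "endpoints p = (\<Union>(c, a, b)\<in>set p. {a, b})"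

definition cut_above :: "real \<Rightarrow> (real \<times> real \<times> real) list \<Rightarrow> (real \<times> real \<times> real) list" where
  "cut_above s p = map (\<lambda>(c, a, b). (c, max a s, max b s)) p"

definition cut_below :: "real \<Rightarrow> (real \<times> real \<times> real) list \<Rightarrow> (real \<times> real \<times> real) list" where
  "cut_below s p = map (\<lambda>(c, a, b). (c, min a s, min b s)) p"

definition scale_steps :: "real \<Rightarrow> (real \<times> real \<times> real) list \<Rightarrow> (real \<times> real \<times> real) list" where
  "scale_steps r p = map (\<lambda>(c, a, b). (r * c, a, b)) p"

lemma ordered_steps_simps [simp]:
  "ordered_steps []" "ordered_steps ((c, a, b) # p) \<longleftrightarrow> a \<le> b \<and> ordered_steps p"
  "ordered_steps (p @ q) \<longleftrightarrow> ordered_steps p \<and> ordered_steps q"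
  by (auto simp: ordered_steps_def ball_Un)

lemma endpoints_simps [simp]:
  "endpoints [] = {}" "endpoints ((c, a, b) # p) = {a, b} \<union> endpoints p"
  by (auto simp: endpoints_def)

lemma step_fun_simps [simp]:
  "step_fun [] u = 0" "step_fun ((c, a, b) # p) u = c * indicator {a<..b} u + step_fun p u"
  "step_fun (p @ q) u = step_fun p u + step_fun q u"
  by (auto simp: step_fun_def)

lemma step_integral_simps [simp]:
  "step_integral W [] \<omega> = 0"
  "step_integral W ((c, a, b) # p) \<omega> = c * (W b \<omega> - W a \<omega>) + step_integral W p \<omega>"
  "step_integral W (p @ q) \<omega> = step_integral W p \<omega> + step_integral W q \<omega>"
  by (auto simp: step_integral_def)

lemma cut_scale_simps [simp]:
  "cut_above s [] = []" "cut_above s ((c, a, b) # p) = (c, max a s, max b s) # cut_above s p"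
  "cut_below s [] = []" "cut_below s ((c, a, b) # p) = (c, min a s, min b s) # cut_below s p"
  "scale_steps r [] = []" "scale_steps r ((c, a, b) # p) = (r * c, a, b) # scale_steps r p"
  by (auto simp: cut_above_def cut_below_def scale_steps_def)

lemma step_fun_scale: "step_fun (scale_steps r p) u = r * step_fun p u"
  by (induction p) (auto simp: algebra_simps)

lemma step_integral_scale: "step_integral W (scale_steps r p) \<omega> = r * step_integral W p \<omega>"
  by (induction p) (auto simp: algebra_simps)

lemma ordered_scale [simp]: "ordered_steps (scale_steps r p) = ordered_steps p"
  by (induction p) auto

lemma ordered_cut: "ordered_steps p \<Longrightarrow> ordered_steps (cut_above s p)"
  "ordered_steps p \<Longrightarrow> ordered_steps (cut_below s p)"
  by (induction p) (auto simp: max_def min_def)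

lemma step_fun_cut_above:
  "ordered_steps p \<Longrightarrow> step_fun (cut_above s p) u = indicator {s<..} u * step_fun p u"
  by (induction p) (auto simp: indicator_def algebra_simps max_def)

text \<open>
Cutting all the intervals at \<open>s\<close> splits an integral into a part that is known at time \<open>s\<close> and a part that is
independent of everything known at time \<open>s\<close>.
\<close>

lemma step_integral_cut:
  "step_integral W p \<omega> = step_integral W (cut_below s p) \<omega> + step_integral W (cut_above s p) \<omega>"
  by (induction p) (auto simp: algebra_simps max_def min_def)

lemma endpoints_cut: "endpoints (cut_above s p) \<subseteq> {s..}" "endpoints (cut_below s p) \<subseteq> {..s}"
  by (induction p) auto

lemma finite_endpoints: "finite (endpoints p)"
  by (induction p) auto

lemma step_fun_measurable [measurable]: "step_fun p \<in> borel_measurable borel"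
proof -
  have "(\<lambda>u. step_fun p u) \<in> borel_measurable borel"
    unfolding step_fun_def by (induction p) (auto split: prod.splits)
  then show ?thesis by simp
qed

text \<open>
An interval between two grid points is recovered by telescoping. Taking for \<open>F\<close> the path of \<open>W\<close>, or the indicators
of half-lines, makes this the grid expansion of both the integral and the step function.
\<close>

lemma grid_sum_indicator:
  fixes F \<tau> :: "nat \<Rightarrow> real"
  assumes \<tau>: "strict_mono_on {..n} \<tau>" and jk: "j \<le> k" "k \<le> n"
  shows "(\<Sum>i<n. indicator {\<tau> j<..\<tau> k} (\<tau> (Suc i)) * (F (Suc i) - F i)) = F k - F j"
proof -
  have "indicator {\<tau> j<..\<tau> k} (\<tau> (Suc i)) = (if i \<in> {j..<k} then 1 else 0 :: real)" if "i < n" for i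
    using strict_mono_on_less[of "{..n}" \<tau> j "Suc i", OF \<tau>] strict_mono_on_less_eq[OF \<tau>, of "Suc i" k] that jk
    by (auto simp: indicator_def)
  then have "(\<Sum>i<n. indicator {\<tau> j<..\<tau> k} (\<tau> (Suc i)) * (F (Suc i) - F i))
      = (\<Sum>i<n. if i \<in> {j..<k} then F (Suc i) - F i else 0)"
    by (intro sum.cong) auto
  also have "\<dots> = (\<Sum>i\<in>{j..<k}. F (Suc i) - F i)"
    using jk by (subst sum.inter_restrict[symmetric]) (auto intro!: sum.cong)
  also have "\<dots> = F k - F j" using jk by (subst sum_Suc_diff') auto
  finally show ?thesis .
qed

lemma grid_steps:
  assumes \<tau>: "strict_mono_on {..n} \<tau>" and p: "ordered_steps p" "endpoints p \<subseteq> \<tau> ` {..n}"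
  shows "step_fun p u = (\<Sum>i<n. step_fun p (\<tau> (Suc i)) * indicator {\<tau> i<..\<tau> (Suc i)} u)"
    and "step_integral W p \<omega> = (\<Sum>i<n. step_fun p (\<tau> (Suc i)) * (W (\<tau> (Suc i)) \<omega> - W (\<tau> i) \<omega>))"
proof -
  have *: "(\<forall>u. step_fun p u = (\<Sum>i<n. step_fun p (\<tau> (Suc i)) * indicator {\<tau> i<..\<tau> (Suc i)} u)) \<and>
    step_integral W p \<omega> = (\<Sum>i<n. step_fun p (\<tau> (Suc i)) * (W (\<tau> (Suc i)) \<omega> - W (\<tau> i) \<omega>))"
    using p
  proof (induction p)
    case (Cons x p)
    obtain c a b where x: "x = (c, a, b)" by (cases x)
    with Cons.prems obtain j k where jk: "a = \<tau> j" "b = \<tau> k" "j \<le> n" "k \<le> n" by auto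
    have "j \<le> k" using Cons.prems strict_mono_on_less_eq[OF \<tau>, of j k] jk by (auto simp: x)
    note S = grid_sum_indicator[OF \<tau> \<open>j \<le> k\<close> \<open>k \<le> n\<close>]
    have cell: "indicator {\<tau> i<..\<tau> l} u = indicator {..\<tau> l} u - (indicator {..\<tau> i} u :: real)"
      if "i \<le> l" "l \<le> n" for i l u
      using strict_mono_on_leD[OF \<tau>, of i l] that by (auto simp: indicator_def)
    have "indicator {a<..b} u = (\<Sum>i<n. indicator {a<..b} (\<tau> (Suc i)) * indicator {\<tau> i<..\<tau>
        (Suc i)} u :: real)" for u
      using S[of "\<lambda>i. indicator {..\<tau> i} u"] \<open>j \<le> k\<close> jk by (simp add: cell)
    note steps = this
    have incr: "W b \<omega> - W a \<omega> = (\<Sum>i<n. indicator {a<..b} (\<tau> (Suc i)) * (W (\<tau> (Suc i)) \<omega> - W (\<tau> i) \<omega>))"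
      using S[of "\<lambda>i. W (\<tau> i) \<omega>"] jk by simp
    have IH: "step_fun p u = (\<Sum>i<n. step_fun p (\<tau> (Suc i)) * indicator {\<tau> i<..\<tau> (Suc i)} u)"
      "step_integral W p \<omega> = (\<Sum>i<n. step_fun p (\<tau> (Suc i)) * (W (\<tau> (Suc i)) \<omega> - W (\<tau> i) \<omega>))" for u
    proof -
      have "ordered_steps p" "endpoints p \<subseteq> \<tau> ` {..n}" using Cons.prems by (auto simp: x)
      note IH = Cons.IH[OF this]
      show "step_fun p u = (\<Sum>i<n. step_fun p (\<tau> (Suc i)) * indicator {\<tau> i<..\<tau> (Suc i)} u)"
        by (rule IH[THEN conjunct1, rule_format])
      show "step_integral W p \<omega> = (\<Sum>i<n. step_fun p (\<tau> (Suc i)) * (W (\<tau> (Suc i)) \<omega> - W (\<tau> i) \<omega>))"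
        by (rule IH[THEN conjunct2])
    qed
    show ?case unfolding x
    proof (intro conjI allI)
      fix u
      have "step_fun ((c, a, b) # p) u = c * indicator {a<..b} u + step_fun p u" by simp
      also have "\<dots> = (\<Sum>i<n. (c * indicator {a<..b} (\<tau> (Suc i)) + step_fun p (\<tau> (Suc i)))
          * indicator {\<tau> i<..\<tau> (Suc i)} u)"
        by (subst steps, subst IH(1)) (simp only: sum_distrib_left sum.distrib distrib_right mult.assoc)
      finally show "step_fun ((c, a, b) # p) u
          = (\<Sum>i<n. step_fun ((c, a, b) # p) (\<tau> (Suc i)) * indicator {\<tau> i<..\<tau> (Suc i)} u)" by simp
    next
      have "step_integral W ((c, a, b) # p) \<omega> = c * (W b \<omega> - W a \<omega>) + step_integral W p \<omega>" by simp
      also have "\<dots> = (\<Sum>i<n. (c * indicator {a<..b} (\<tau> (Suc i)) + step_fun p (\<tau> (Suc i)))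
          * (W (\<tau> (Suc i)) \<omega> - W (\<tau> i) \<omega>))"
        unfolding incr IH(2) by (simp only: sum_distrib_left sum.distrib distrib_right mult.assoc)
      finally show "step_integral W ((c, a, b) # p) \<omega>
          = (\<Sum>i<n. step_fun ((c, a, b) # p) (\<tau> (Suc i)) * (W (\<tau> (Suc i)) \<omega> - W (\<tau> i) \<omega>))" by simp
    qed
  qed auto
  then show "step_fun p u = (\<Sum>i<n. step_fun p (\<tau> (Suc i)) * indicator {\<tau> i<..\<tau> (Suc i)} u)"
    and "step_integral W p \<omega> = (\<Sum>i<n. step_fun p (\<tau> (Suc i)) * (W (\<tau> (Suc i)) \<omega> - W (\<tau> i) \<omega>))"
    by blast+
qed

lemma grid_steps_norm:
  assumes \<tau>: "strict_mono_on {..n} \<tau>" and p: "ordered_steps p" "endpoints p \<subseteq> \<tau> ` {..n}"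
  shows "sq_norm lborel (step_fun p)
    = ennreal (\<Sum>i<n. (step_fun p (\<tau> (Suc i)))\<^sup>2 * (\<tau> (Suc i) - \<tau> i))"
proof -
  let ?d = "\<lambda>i. step_fun p (\<tau> (Suc i))" and ?c = "\<lambda>i. {\<tau> i<..\<tau> (Suc i)}"
  have le: "\<tau> i \<le> \<tau> (Suc i)" if "i < n" for i
    using strict_mono_on_leD[OF \<tau>, of i "Suc i"] that by auto
  have disj: "(indicator (?c i) u * indicator (?c j) u :: real) = (if i = j then indicator (?c i) u else 0)"
    if "i < n" "j < n" for i j u
    using that strict_mono_on_leD[OF \<tau>, of "Suc i" j] strict_mono_on_leD[OF \<tau>, of "Suc j" i]
    by (cases "i = j"; cases "i < j") (auto simp: indicator_def)
  have sq: "(step_fun p u)\<^sup>2 = (\<Sum>i<n. (?d i)\<^sup>2 * indicator (?c i) u)" for u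
  proof -
    have "(step_fun p u)\<^sup>2 = (\<Sum>i<n. \<Sum>j<n. (?d i * ?d j) * (indicator (?c i) u * indicator (?c j) u))"
      by (subst grid_steps(1)[OF \<tau> p]) (simp only: power2_eq_square sum_product mult_ac)
    also have "\<dots> = (\<Sum>i<n. \<Sum>j<n. if i = j then (?d i)\<^sup>2 * indicator (?c i) u else 0)"
      by (intro sum.cong refl) (auto simp: disj power2_eq_square)
    also have "\<dots> = (\<Sum>i<n. (?d i)\<^sup>2 * indicator (?c i) u)" by (intro sum.cong) auto
    finally show ?thesis .
  qed
  have "sq_norm lborel (step_fun p)
      = (\<integral>\<^sup>+u. (\<Sum>i<n. ennreal ((?d i)\<^sup>2) * indicator (?c i) u) \<partial>lborel)"
  proof (intro nn_integral_cong)
    fix u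
    show "ennreal ((step_fun p u)\<^sup>2) = (\<Sum>i<n. ennreal ((?d i)\<^sup>2) * indicator (?c i) u)"
      by (subst sq, subst sum_ennreal[symmetric]) (auto simp: ennreal_mult'' ennreal_indicator)
  qed
  also have "\<dots> = (\<Sum>i<n. ennreal ((?d i)\<^sup>2) * ennreal (\<tau> (Suc i) - \<tau> i))"
    by (subst nn_integral_sum) (auto simp: nn_integral_cmult le)
  also have "\<dots> = ennreal (\<Sum>i<n. (?d i)\<^sup>2 * (\<tau> (Suc i) - \<tau> i))"
    using le by (subst sum_ennreal[symmetric]) (auto simp: ennreal_mult)
  finally show ?thesis .
qed

context line_brownian_motion begin

lemma step_integral_increments:
  assumes "endpoints p \<subseteq> J"
  shows "step_integral W p \<in> borel_measurable (increments J)"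
proof -
  show "step_integral W p \<in> borel_measurable (increments J)"
    using assms
  proof (induction p)
    case Nil
    have "step_integral W [] = (\<lambda>\<omega>. 0)" by (auto simp: fun_eq_iff)
    then show ?case by simp
  next
    case (Cons x p)
    obtain c a b where x: "x = (c, a, b)" by (cases x)
    have "step_integral W (x # p) = (\<lambda>\<omega>. c * (W b \<omega> - W a \<omega>) + step_integral W p \<omega>)"
      by (auto simp: fun_eq_iff x)
    moreover have "(\<lambda>\<omega>. c * (W b \<omega> - W a \<omega>) + step_integral W p \<omega>) \<in> borel_measurable (increments J)"
      using Cons by (intro borel_measurable_add borel_measurable_times increment_measurable) (auto simp: x)
    ultimately show ?case by simp
  qed
qed

lemma step_integral_measurable [measurable]: "step_integral W p \<in> borel_measurable M"
  using measurable_increments_events step_integral_increments by blast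

text \<open>
On a common grid the integral is a sum of independent centred normal variables. Degenerate summands have to be
discarded first, since a normal density needs a positive standard deviation; if nothing remains the integral
vanishes identically.
\<close>

lemma step_integral_law:
  assumes p: "ordered_steps p"
  obtains v where "v \<ge> 0" "sq_norm lborel (step_fun p) = ennreal v"
    "v = 0 \<Longrightarrow> \<forall>\<omega>. step_integral W p \<omega> = 0"
    "v > 0 \<Longrightarrow> distributed M lborel (step_integral W p) (normal_density 0 (sqrt v))"
proof -
  obtain n \<tau> where \<tau>: "strict_mono_on {..n::nat} \<tau>" "\<tau> ` {..n} = insert 0 (endpoints p)"
    using finite_set_as_grid[of "insert 0 (endpoints p)"] finite_endpoints by blast
  then have ep: "endpoints p \<subseteq> \<tau> ` {..n}" by auto
  note G = grid_steps[OF \<tau>(1) p ep] grid_steps_norm[OF \<tau>(1) p ep]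
  let ?d = "\<lambda>i. step_fun p (\<tau> (Suc i))" and ?D = "\<lambda>i \<omega>. W (\<tau> (Suc i)) \<omega> - W (\<tau> i) \<omega>"
  define v where "v = (\<Sum>i<n. (?d i)\<^sup>2 * (\<tau> (Suc i) - \<tau> i))"
  have less: "\<tau> i < \<tau> (Suc i)" if "i < n" for i
    using strict_mono_onD[OF \<tau>(1), of i "Suc i"] that by auto
  have v0: "v \<ge> 0" unfolding v_def using less by (intro sum_nonneg mult_nonneg_nonneg) (auto simp: less_imp_le)
  define I where "I = {i. i < n \<and> ?d i \<noteq> 0}"
  have [simp]: "finite I" by (simp add: I_def)
  have sum_I: "step_integral W p \<omega> = (\<Sum>i\<in>I. ?d i * ?D i \<omega>)" for \<omega>
    unfolding G(2) by (rule sum.mono_neutral_right) (auto simp: I_def)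
  have v_I: "v = (\<Sum>i\<in>I. (\<bar>?d i\<bar> * sqrt (\<tau> (Suc i) - \<tau> i))\<^sup>2)"
  proof -
    have "v = (\<Sum>i\<in>I. (?d i)\<^sup>2 * (\<tau> (Suc i) - \<tau> i))"
      unfolding v_def by (rule sum.mono_neutral_right) (auto simp: I_def)
    also have "\<dots> = (\<Sum>i\<in>I. (\<bar>?d i\<bar> * sqrt (\<tau> (Suc i) - \<tau> i))\<^sup>2)"
      using less by (intro sum.cong) (auto simp: I_def power_mult_distrib less_imp_le)
    finally show ?thesis .
  qed
  show ?thesis
  proof (rule that[OF v0])
    show "sq_norm lborel (step_fun p) = ennreal v" unfolding v_def by (rule G(3))
    have pos: "0 < \<bar>?d i\<bar> * sqrt (\<tau> (Suc i) - \<tau> i)" if "i \<in> I" for i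
      using that less by (auto simp: I_def)
    { assume "v = 0"
      have "I = {}"
      proof (rule ccontr)
        assume "I \<noteq> {}"
        then have "0 < v" unfolding v_I 
            using \<open>I \<noteq> {}\<close> pos by (intro sum_pos zero_less_power) auto
        with \<open>v = 0\<close> show False by simp
      qed
      then show "\<forall>\<omega>. step_integral W p \<omega> = 0" by (simp add: sum_I) }
    { assume "v > 0"
      then have "I \<noteq> {}" unfolding v_I by auto
      have ind: "indep_vars (\<lambda>_. borel) (\<lambda>i \<omega>. ?d i * ?D i \<omega>) I"
        by (rule indep_vars_compose2[OF indep_vars_subset[OF grid_increments_indep[OF \<tau>(1)]]])
           (auto simp: I_def)
      have nrm: "distributed M lborel (\<lambda>\<omega>. ?d i * ?D i \<omega>) (normal_density 0 (\<bar>?d i\<bar> * sqrt (\<tau> (Suc i) - \<tau> i)))"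
        if "i \<in> I" for i
        using normal_density_affine[OF increment_normal[OF less, of i], of "?d i" 0] that less
        by (auto simp: I_def)
      have "distributed M lborel (\<lambda>\<omega>. \<Sum>i\<in>I. ?d i * ?D i \<omega>)
          (normal_density (\<Sum>i\<in>I. 0) (sqrt (\<Sum>i\<in>I. (\<bar>?d i\<bar> * sqrt (\<tau> (Suc i) - \<tau> i))\<^sup>2)))"
        by (intro sum_indep_normal ind nrm pos \<open>I \<noteq> {}\<close> \<open>finite I\<close>)
      moreover have "(\<lambda>\<omega>. \<Sum>i\<in>I. ?d i * ?D i \<omega>) = step_integral W p"
        by (rule ext) (rule sum_I[symmetric])
      ultimately show "distributed M lborel (step_integral W p) (normal_density 0 (sqrt v))"
        by (simp only: v_I[symmetric] sum.neutral_const) }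
  qed
qed

lemma step_integral_moment:
  assumes p: "ordered_steps p"
  shows "(\<integral>\<^sup>+\<omega>. ennreal (step_integral W p \<omega> ^ (2 * m)) \<partial>M)
    = ennreal (fact (2 * m) / (2 ^ m * fact m)) * sq_norm lborel (step_fun p) ^ m"
proof -
  obtain v where v: "v \<ge> 0" "sq_norm lborel (step_fun p) = ennreal v"
    "v = 0 \<Longrightarrow> \<forall>\<omega>. step_integral W p \<omega> = 0"
    "v > 0 \<Longrightarrow> distributed M lborel (step_integral W p) (normal_density 0 (sqrt v))"
    using step_integral_law[OF p] by blast
  show ?thesis
  proof (cases "v = 0")
    case True
    then show ?thesis using v by (cases "m = 0") (auto simp: emeasure_space_1 zero_power)
  next
    case False
    then have v0: "v > 0" using v by simp
    have "(\<integral>\<^sup>+\<omega>. ennreal (step_integral W p \<omega> ^ (2 * m)) \<partial>M)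
        = (\<integral>\<^sup>+x. ennreal (normal_density 0 (sqrt v) x) * ennreal (x ^ (2 * m)) \<partial>lborel)"
      by (rule distributed_nn_integral[OF v(4)[OF v0], symmetric]) auto
    also have "\<dots> = (\<integral>\<^sup>+x. ennreal (normal_density 0 (sqrt v) x * (x - 0) ^ (2 * m)) \<partial>lborel)"
      by (intro nn_integral_cong) (auto simp: ennreal_mult)
    also have "\<dots> = ennreal (fact (2 * m) / ((2 / (sqrt v)\<^sup>2) ^ m * fact m))"
    proof -
      have "has_bochner_integral lborel (\<lambda>x. normal_density 0 (sqrt v) x * (x - 0) ^ (2 * m))
         (fact (2 * m) / ((2 / (sqrt v)\<^sup>2) ^ m * fact m))"
        by (rule normal_moment_even) (use v0 in auto)
      then show ?thesis
        by (subst nn_integral_eq_integral) (auto simp: has_bochner_integral_iff)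
    qed
    also have "\<dots> = ennreal (fact (2 * m) / (2 ^ m * fact m)) * ennreal v ^ m"
      using v0 by (simp add: power_divide ennreal_power flip: ennreal_mult)
    finally show ?thesis by (simp add: v(2))
  qed
qed

end

section \<open>Wiener integrals of deterministic functions\<close>

lemma L2_limit_AE_subseq:
  fixes X :: "'a \<Rightarrow> real"
  assumes [measurable]: "X \<in> borel_measurable M" "\<And>n. Y n \<in> borel_measurable M"
    and lim: "(\<lambda>n. sq_norm M (\<lambda>\<omega>. X \<omega> - Y n \<omega>)) \<longlonglongrightarrow> 0"
  obtains r :: "nat \<Rightarrow> nat" where "filterlim r sequentially sequentially"
    "AE \<omega> in M. (\<lambda>n. Y (r n) \<omega>) \<longlonglongrightarrow> X \<omega>"
proof -
  let ?I = "\<lambda>n. sq_norm M (\<lambda>\<omega>. X \<omega> - Y n \<omega>)"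
  have "eventually (\<lambda>n. ?I n < 1) sequentially"
    using order_tendstoD(2)[OF lim, of 1] by simp
  then obtain N where N: "\<And>n. n \<ge> N \<Longrightarrow> ?I n < 1" by (auto simp: eventually_sequentially)
  let ?u = "\<lambda>n \<omega>. (X \<omega> - Y (n + N) \<omega>)\<^sup>2"
  have int: "integrable M (?u n)" for n
    using N[of "n + N"] by (intro integrableI_bounded) (auto intro: order.strict_trans)
  have eq: "(\<integral>\<omega>. norm (?u n \<omega>) \<partial>M) = enn2real (?I (n + N))" for n
    by (subst integral_eq_nn_integral) auto
  have "(\<lambda>n. enn2real (?I (n + N))) \<longlonglongrightarrow> 0"
    using tendsto_enn2real[OF LIMSEQ_ignore_initial_segment[OF lim, of N, folded ennreal_0]] by simp
  then have "(\<lambda>n. \<integral>\<omega>. norm (?u n \<omega>) \<partial>M) \<longlonglongrightarrow> 0" by (simp only: eq)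
  from tendsto_L1_AE_subseq[OF int this] obtain r :: "nat \<Rightarrow> nat" where r: "strict_mono r"
    and AE: "AE \<omega> in M. (\<lambda>n. ?u (r n) \<omega>) \<longlonglongrightarrow> 0" by blast
  have "AE \<omega> in M. (\<lambda>n. Y (r n + N) \<omega>) \<longlonglongrightarrow> X \<omega>"
    using AE
  proof eventually_elim
    case (elim \<omega>)
    from tendsto_real_sqrt[OF this] have "(\<lambda>n. \<bar>X \<omega> - Y (r n + N) \<omega>\<bar>) \<longlonglongrightarrow> 0" by simp
    then have "(\<lambda>n. X \<omega> - Y (r n + N) \<omega>) \<longlonglongrightarrow> 0" by (simp add: tendsto_rabs_zero_iff)
    from tendsto_diff[OF tendsto_const this, of "X \<omega>"] show ?case by simp
  qed
  moreover have "filterlim (\<lambda>n. r n + N) sequentially sequentially"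
    using r by (intro filterlim_compose[OF filterlim_add_const_nat_at_top filterlim_subseq])
  ultimately show ?thesis using that by blast
qed

lemma sum_squares_le: "(a + b)\<^sup>2 \<le> 2 * a\<^sup>2 + 2 * (b :: real)\<^sup>2"
  using zero_le_power2[of "a - b"] by (simp add: power2_eq_square algebra_simps)

text \<open>
The triangle inequality in mean square, with the factor \<open>2\<close> that spares taking square roots of extended reals.
\<close>

lemma L2_triangle:
  fixes f g h :: "'b \<Rightarrow> real"
  assumes [measurable]: "f \<in> borel_measurable N" "g \<in> borel_measurable N"
    and h: "\<And>x. h x = a * f x + b * g x"
  shows "sq_norm N h
    \<le> ennreal (2 * a\<^sup>2) * sq_norm N f + ennreal (2 * b\<^sup>2) * sq_norm N g"
proof -
  have "sq_norm N h
      \<le> (\<integral>\<^sup>+x. ennreal (2 * a\<^sup>2) * ennreal ((f x)\<^sup>2) + ennreal (2 * b\<^sup>2) * ennreal ((g x)\<^sup>2) \<partial>N)"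
  proof (rule nn_integral_mono)
    fix x
    have "(h x)\<^sup>2 \<le> 2 * a\<^sup>2 * (f x)\<^sup>2 + 2 * b\<^sup>2 * (g x)\<^sup>2"
      using sum_squares_le[of "a * f x" "b * g x"] by (simp add: h power_mult_distrib)
    then have "ennreal ((h x)\<^sup>2) \<le> ennreal (2 * a\<^sup>2 * (f x)\<^sup>2 + 2 * b\<^sup>2 * (g x)\<^sup>2)"
      by (rule ennreal_leI)
    also have "\<dots> = ennreal (2 * a\<^sup>2) * ennreal ((f x)\<^sup>2) + ennreal (2 * b\<^sup>2) * ennreal ((g x)\<^sup>2)"
      by (simp add: ennreal_mult)
    finally show "ennreal ((h x)\<^sup>2) \<le> ennreal (2 * a\<^sup>2) * ennreal ((f x)\<^sup>2)
        + ennreal (2 * b\<^sup>2) * ennreal ((g x)\<^sup>2)" .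
  qed
  also have "\<dots> = ennreal (2 * a\<^sup>2) * sq_norm N f + ennreal (2 * b\<^sup>2) * sq_norm N g"
    by (simp add: nn_integral_add nn_integral_cmult)
  finally show ?thesis .
qed

lemma L2_combination_tendsto_0:
  fixes f g h :: "nat \<Rightarrow> 'b \<Rightarrow> real"
  assumes [measurable]: "\<And>n. f n \<in> borel_measurable N" "\<And>n. g n \<in> borel_measurable N"
    and h: "\<And>n x. h n x = a * f n x + b * g n x"
    and f: "(\<lambda>n. sq_norm N (f n)) \<longlonglongrightarrow> 0"
    and g: "(\<lambda>n. sq_norm N (g n)) \<longlonglongrightarrow> 0"
  shows "(\<lambda>n. sq_norm N (h n)) \<longlonglongrightarrow> 0"
proof (rule tendsto_sandwich[OF always_eventually always_eventually tendsto_const])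
  show "\<forall>n. sq_norm N (h n) \<le> ennreal (2 * a\<^sup>2) * sq_norm N (f n)
      + ennreal (2 * b\<^sup>2) * sq_norm N (g n)"
    by (intro allI L2_triangle) (auto simp: h)
  have "(\<lambda>n. ennreal (2 * a\<^sup>2) * sq_norm N (f n)
      + ennreal (2 * b\<^sup>2) * sq_norm N (g n)) \<longlonglongrightarrow> ennreal (2 * a\<^sup>2) * 0 + ennreal (2 * b\<^sup>2) * 0"
    by (intro tendsto_add ennreal_tendsto_cmult f g) auto
  then show "(\<lambda>n. ennreal (2 * a\<^sup>2) * sq_norm N (f n)
      + ennreal (2 * b\<^sup>2) * sq_norm N (g n)) \<longlonglongrightarrow> 0" by simp
qed auto

context line_brownian_motion begin

lemma wiener_integralE:
  assumes "has_wiener_integral M W A f Y"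
  obtains p where "(\<lambda>u. indicator A u * f u) \<in> borel_measurable borel" "Y \<in> borel_measurable M"
    "\<And>n::nat. ordered_steps (p n)"
    "(\<lambda>n. sq_norm lborel (\<lambda>u. indicator A u * f u - step_fun (p n) u)) \<longlonglongrightarrow> 0"
    "(\<lambda>n. sq_norm M (\<lambda>\<omega>. Y \<omega> - step_integral W (p n) \<omega>)) \<longlonglongrightarrow> 0"
  using assms that unfolding has_wiener_integral_def ordered_steps_def by blast

lemma wiener_integral_combination:
  assumes X: "has_wiener_integral M W A f X" and Y: "has_wiener_integral M W B g Y"
  shows "has_wiener_integral M W UNIV (\<lambda>u. a * (indicator A u * f u) + b * (indicator B u * g u))
    (\<lambda>\<omega>. a * X \<omega> + b * Y \<omega>)"
proof -
  from X obtain p where p [measurable]: "(\<lambda>u. indicator A u * f u) \<in> borel_measurable borel" "X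
      \<in> borel_measurable M"
    and p': "\<And>n::nat. ordered_steps (p n)"
    "(\<lambda>n. sq_norm lborel (\<lambda>u. indicator A u * f u - step_fun (p n) u)) \<longlonglongrightarrow> 0"
    "(\<lambda>n. sq_norm M (\<lambda>\<omega>. X \<omega> - step_integral W (p n) \<omega>)) \<longlonglongrightarrow> 0"
    by (rule wiener_integralE) (rule that)
  from Y obtain q where q [measurable]: "(\<lambda>u. indicator B u * g u) \<in> borel_measurable borel" "Y
      \<in> borel_measurable M"
    and q': "\<And>n::nat. ordered_steps (q n)"
    "(\<lambda>n. sq_norm lborel (\<lambda>u. indicator B u * g u - step_fun (q n) u)) \<longlonglongrightarrow> 0"
    "(\<lambda>n. sq_norm M (\<lambda>\<omega>. Y \<omega> - step_integral W (q n) \<omega>)) \<longlonglongrightarrow> 0"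
    by (rule wiener_integralE) (rule that)
  let ?r = "\<lambda>n. scale_steps a (p n) @ scale_steps b (q n)"
  have m: "(\<lambda>u. indicator A u * f u - step_fun (p n) u) \<in> borel_measurable lborel"
    "(\<lambda>u. indicator B u * g u - step_fun (q n) u) \<in> borel_measurable lborel" for n
    by measurable
  show ?thesis unfolding has_wiener_integral_def
  proof (intro conjI exI[of _ ?r] allI)
    show "(\<lambda>u. indicator UNIV u * (a * (indicator A u * f u) + b * (indicator B u * g u)))
        \<in> borel_measurable borel"
      by measurable
    show "(\<lambda>\<omega>. a * X \<omega> + b * Y \<omega>) \<in> borel_measurable M" by measurable
    show "\<forall>(c, x, y)\<in>set (?r n). x \<le> y" for n
      using p'(1)[of n] q'(1)[of n] unfolding ordered_steps_def[symmetric] by simp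
    show "(\<lambda>n. sq_norm lborel (\<lambda>u. indicator UNIV u * (a * (indicator A u * f u)
        + b * (indicator B u * g u)) - step_fun (?r n) u)) \<longlonglongrightarrow> 0"
      by (rule L2_combination_tendsto_0[OF m _ p'(2) q'(2), where a = a and b = b])
         (auto simp: step_fun_scale algebra_simps)
    show "(\<lambda>n. sq_norm M (\<lambda>\<omega>. a * X \<omega> + b * Y \<omega> - step_integral W (?r n) \<omega>)) \<longlonglongrightarrow> 0"
      by (rule L2_combination_tendsto_0[OF _ _ _ p'(3) q'(3), where a = a and b = b])
         (auto simp: step_integral_scale algebra_simps)
  qed
qed

lemma wiener_integral_cong_AE:
  assumes "has_wiener_integral M W UNIV f X"
    and "AE u in lborel. f u = g u" "g \<in> borel_measurable borel"
    and "AE \<omega> in M. X \<omega> = Y \<omega>" "Y \<in> borel_measurable M"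
  shows "has_wiener_integral M W UNIV g Y"
proof -
  from assms(1) obtain p where p [measurable]: "(\<lambda>u. indicator UNIV u * f u) \<in> borel_measurable borel" "X
      \<in> borel_measurable M"
    and p': "\<And>n::nat. ordered_steps (p n)"
    "(\<lambda>n. sq_norm lborel (\<lambda>u. indicator UNIV u * f u - step_fun (p n) u)) \<longlonglongrightarrow> 0"
    "(\<lambda>n. sq_norm M (\<lambda>\<omega>. X \<omega> - step_integral W (p n) \<omega>)) \<longlonglongrightarrow> 0"
    by (rule wiener_integralE) (rule that)
  have "sq_norm lborel (\<lambda>u. indicator UNIV u * f u - step_fun (p n) u)
      = sq_norm lborel (\<lambda>u. indicator UNIV u * g u - step_fun (p n) u)" for n
    by (rule nn_integral_cong_AE) (use assms(2) in auto)
  moreover have "sq_norm M (\<lambda>\<omega>. X \<omega> - step_integral W (p n) \<omega>)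
      = sq_norm M (\<lambda>\<omega>. Y \<omega> - step_integral W (p n) \<omega>)" for n
    by (rule nn_integral_cong_AE) (use assms(4) in auto)
  ultimately show ?thesis using p' assms(3,5)
    unfolding has_wiener_integral_def ordered_steps_def by auto
qed

text \<open>
By Fatou's lemma moments of the limit are bounded by those of the approximating normal variables. Their variances
are eventually at most \<open>4 * K\<close>, so the constant is not the sharp one.
\<close>

lemma wiener_integral_moment:
  assumes X: "has_wiener_integral M W UNIV k X" and K: "K > 0"
    and k: "sq_norm lborel k \<le> ennreal K"
  shows "(\<integral>\<^sup>+\<omega>. ennreal (X \<omega> ^ (2 * m)) \<partial>M) \<le> ennreal (fact (2 * m) / (2 ^ m * fact m) * (4 * K) ^ m)"
proof -
  from X obtain p where p [measurable]: "(\<lambda>u. indicator UNIV u * k u) \<in> borel_measurable borel" "X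
      \<in> borel_measurable M"
    and p': "\<And>n::nat. ordered_steps (p n)"
    "(\<lambda>n. sq_norm lborel (\<lambda>u. indicator UNIV u * k u - step_fun (p n) u)) \<longlonglongrightarrow> 0"
    "(\<lambda>n. sq_norm M (\<lambda>\<omega>. X \<omega> - step_integral W (p n) \<omega>)) \<longlonglongrightarrow> 0"
    by (rule wiener_integralE) (rule that)
  from p(1) have [measurable]: "k \<in> borel_measurable borel" by simp
  obtain r where r: "filterlim r sequentially sequentially"
    and AE: "AE \<omega> in M. (\<lambda>n. step_integral W (p (r n)) \<omega>) \<longlonglongrightarrow> X \<omega>"
    by (rule L2_limit_AE_subseq[OF p(2) step_integral_measurable p'(3)]) (rule that)
  let ?c = "fact (2 * m) / (2 ^ m * fact m) :: real"
  have "(\<integral>\<^sup>+\<omega>. ennreal (X \<omega> ^ (2 * m)) \<partial>M)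
      \<le> (\<integral>\<^sup>+\<omega>. liminf (\<lambda>n. ennreal (step_integral W (p (r n)) \<omega> ^ (2 * m))) \<partial>M)"
  proof (rule nn_integral_mono_AE, use AE in eventually_elim)
    case (elim \<omega>)
    have "(\<lambda>n. ennreal (step_integral W (p (r n)) \<omega> ^ (2 * m))) \<longlonglongrightarrow> ennreal (X \<omega> ^ (2 * m))"
      by (intro tendsto_ennrealI tendsto_power elim)
    then show ?case by (subst lim_imp_Liminf) auto
  qed
  also have "\<dots> \<le> liminf (\<lambda>n. \<integral>\<^sup>+\<omega>. ennreal (step_integral W (p (r n)) \<omega> ^ (2 * m)) \<partial>M)"
    by (rule nn_integral_liminf) auto
  also have "\<dots> \<le> ennreal (?c * (4 * K) ^ m)"
  proof (rule Liminf_le)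
    have "eventually (\<lambda>n. sq_norm lborel (\<lambda>u. k u - step_fun (p n) u) < ennreal K) sequentially"
      using order_tendstoD(2)[OF p'(2), of "ennreal K"] K by simp
    then have "eventually (\<lambda>n. sq_norm lborel (\<lambda>u. k u - step_fun (p (r n)) u) < ennreal K) sequentially"
      using r by (auto simp: filterlim_iff)
    then show "eventually (\<lambda>n. (\<integral>\<^sup>+\<omega>. ennreal (step_integral W (p (r n)) \<omega> ^ (2 * m)) \<partial>M)
        \<le> ennreal (?c * (4 * K) ^ m)) sequentially"
    proof eventually_elim
      case (elim n)
      have "sq_norm lborel (step_fun (p (r n)))
          \<le> ennreal (2 * 1\<^sup>2) * sq_norm lborel k
            + ennreal (2 * (- 1)\<^sup>2) * sq_norm lborel (\<lambda>u. k u - step_fun (p (r n)) u)"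
        by (rule L2_triangle) auto
      also have "\<dots> \<le> ennreal 2 * ennreal K + ennreal 2 * ennreal K"
        using k elim by (intro add_mono mult_mono) auto
      also have "\<dots> = ennreal (4 * K)" using K by (simp flip: ennreal_mult ennreal_plus ennreal_numeral)
      finally have "sq_norm lborel (step_fun (p (r n))) ^ m \<le> ennreal (4 * K) ^ m"
        by (rule power_mono) simp
      then have "(\<integral>\<^sup>+\<omega>. ennreal (step_integral W (p (r n)) \<omega> ^ (2 * m)) \<partial>M) \<le> ennreal ?c * ennreal (4 * K) ^ m"
        unfolding step_integral_moment[OF p'(1)] by (intro mult_left_mono) auto
      also have "\<dots> = ennreal (?c * (4 * K) ^ m)"
        using K by (simp add: ennreal_power flip: ennreal_mult)
      finally show ?case .
    qed
  qed auto
  finally show ?thesis .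
qed

text \<open>
If the integrand vanishes after \<open>r\<close>, the part after \<open>r\<close> of the approximating step functions tends to \<open>0\<close> and may
be cut off. The remaining integrals belong to the past of \<open>r\<close>, and so does their limit along an almost surely
convergent subsequence.
\<close>

lemma wiener_integral_adapted:
  assumes X: "has_wiener_integral M W UNIV k X" and k0: "\<And>u. u > r \<Longrightarrow> k u = 0"
  obtains X' where "X' \<in> borel_measurable (increments {..r})" "AE \<omega> in M. X \<omega> = X' \<omega>"
proof -
  from X obtain p where p [measurable]: "(\<lambda>u. indicator UNIV u * k u) \<in> borel_measurable borel" "X
      \<in> borel_measurable M"
    and p': "\<And>n::nat. ordered_steps (p n)"
    "(\<lambda>n. sq_norm lborel (\<lambda>u. indicator UNIV u * k u - step_fun (p n) u)) \<longlonglongrightarrow> 0"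
    "(\<lambda>n. sq_norm M (\<lambda>\<omega>. X \<omega> - step_integral W (p n) \<omega>)) \<longlonglongrightarrow> 0"
    by (rule wiener_integralE) (rule that)
  let ?Y = "\<lambda>n. step_integral W (cut_below r (p n))"
  have "(\<lambda>n. sq_norm M (\<lambda>\<omega>. step_integral W (cut_above r (p n)) \<omega>)) \<longlonglongrightarrow> 0"
  proof (rule tendsto_sandwich[OF always_eventually always_eventually tendsto_const p'(2)]; intro allI)
    fix n
    have "sq_norm M (\<lambda>\<omega>. step_integral W (cut_above r (p n)) \<omega>)
        = sq_norm lborel (step_fun (cut_above r (p n)))"
      using step_integral_moment[OF ordered_cut(1)[OF p'(1)], of r n 1] by (simp add: fact_numeral)
    also have "\<dots> \<le> sq_norm lborel (\<lambda>u. indicator UNIV u * k u - step_fun (p n) u)"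
      by (intro nn_integral_mono) (auto simp: step_fun_cut_above[OF p'(1)] indicator_def k0)
    finally show "sq_norm M (\<lambda>\<omega>. step_integral W (cut_above r (p n)) \<omega>)
        \<le> sq_norm lborel (\<lambda>u. indicator UNIV u * k u - step_fun (p n) u)" .
  qed auto
  then have lim: "(\<lambda>n. sq_norm M (\<lambda>\<omega>. X \<omega> - ?Y n \<omega>)) \<longlonglongrightarrow> 0"
    by (rule L2_combination_tendsto_0[OF _ _ _ p'(3), where a = 1 and b = 1, rotated 3])
       (auto simp: step_integral_cut[of W "p n" \<omega> r for n \<omega>])
  obtain q where AE: "AE \<omega> in M. (\<lambda>n. ?Y (q n) \<omega>) \<longlonglongrightarrow> X \<omega>"
    by (rule L2_limit_AE_subseq[OF p(2) step_integral_measurable lim]) (rule that)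
  show ?thesis
  proof (rule that[of "\<lambda>\<omega>. lim (\<lambda>n. ?Y (q n) \<omega>)"])
    show "(\<lambda>\<omega>. lim (\<lambda>n. ?Y (q n) \<omega>)) \<in> borel_measurable (increments {..r})"
      by (intro borel_measurable_lim_metric step_integral_increments endpoints_cut)
    show "AE \<omega> in M. X \<omega> = lim (\<lambda>n. ?Y (q n) \<omega>)"
      using AE by eventually_elim (simp add: limI)
  qed
qed

text \<open>
Given the past, the window is a fixed interval of length \<open>2 * \<epsilon>\<close>, and the density of \<open>V\<close> is at most
\<open>1 / (2 * \<sigma>)\<close>.
\<close>

lemma past_future_window:
  assumes V: "V \<in> borel_measurable (increments {s..})" and \<sigma>: "0 < \<sigma>" "0 < \<epsilon>"
    and N: "distributed M lborel V (normal_density 0 \<sigma>)"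
    and Z: "Z \<in> borel_measurable (increments {..s})"
    and \<xi>: "\<xi> \<in> borel_measurable (increments {..s})"
  shows "(\<integral>\<^sup>+\<omega>. Z \<omega> * indicator (window (\<xi> \<omega>) \<epsilon>) (V \<omega>) \<partial>M) \<le> ennreal (\<epsilon> / \<sigma>) * (\<integral>\<^sup>+\<omega>. Z \<omega> \<partial>M)"
proof -
  \<comment> \<open>Two variables can be stated independent by \<open>indep_var\<close> only if they have the same range type,
    so \<open>V\<close> is paired with a dummy component.\<close>
  let ?B = "borel \<Otimes>\<^sub>M borel :: (ennreal \<times> real) measure"
  let ?P = "\<lambda>\<omega>. (Z \<omega>, \<xi> \<omega>)" and ?V = "\<lambda>\<omega>. (0 :: ennreal, V \<omega>)"
  have P: "?P \<in> measurable (increments {..s}) (borel \<Otimes>\<^sub>M borel)"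
    using Z \<xi> by (rule measurable_Pair)
  have V': "?V \<in> measurable (increments {s..}) ?B"
    using V by (intro measurable_Pair) auto
  have [measurable]: "Z \<in> borel_measurable M" "\<xi> \<in> borel_measurable M" "V \<in> borel_measurable M"
    using Z \<xi> V by (blast intro: measurable_increments_events)+
  have "indep_var ?B ?P ?B ?V"
    unfolding indep_var_eq
  proof (intro conjI)
    show "indep_set (sigma_sets (space M) {?P -` A \<inter> space M |A. A \<in> sets ?B})
        (sigma_sets (space M) {?V -` A \<inter> space M |A. A \<in> sets ?B})"
      using past_indep_future[of s] unfolding indep_set_def
    proof (rule indep_sets_mono_sets)
      have "{?P -` A \<inter> space M |A. A \<in> sets ?B} \<subseteq> sets (increments {..s})"
        using measurable_sets[OF P] unfolding space_increments by blast
      then have "sigma_sets (space M) {?P -` A \<inter> space M |A. A \<in> sets ?B} \<subseteq> sets (increments {..s})"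
        using sets.sigma_sets_subset[of _ "increments {..s}"] unfolding space_increments by blast
      moreover have "{?V -` A \<inter> space M |A. A \<in> sets ?B} \<subseteq> sets (increments {s..})"
        using measurable_sets[OF V'] unfolding space_increments by blast
      then have "sigma_sets (space M) {?V -` A \<inter> space M |A. A \<in> sets ?B} \<subseteq> sets (increments {s..})"
        using sets.sigma_sets_subset[of _ "increments {s..}"] unfolding space_increments by blast
      ultimately show "case_bool (sigma_sets (space M) {?P -` A \<inter> space M |A. A \<in> sets ?B})
        (sigma_sets (space M) {?V -` A \<inter> space M |A. A \<in> sets ?B}) b
        \<subseteq> case_bool (sets (increments {..s})) (sets (increments {s..})) b" for b
        by (cases b) auto
    qed
  qed auto
  then have D: "distr M ?B ?P \<Otimes>\<^sub>M distr M ?B ?V = distr M (?B \<Otimes>\<^sub>M ?B) (\<lambda>\<omega>. (?P \<omega>, ?V \<omega>))"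
    by (simp add: indep_var_distribution_eq)
  interpret V: prob_space "distr M ?B ?V" by (rule prob_space_distr) simp
  let ?g = "\<lambda>x. fst (fst x) * indicator (window (snd (fst x)) \<epsilon>) (snd (snd x)) :: ennreal"
  have g [measurable]: "?g \<in> borel_measurable (?B \<Otimes>\<^sub>M ?B)"
  proof -
    have eq: "?g = (\<lambda>x. fst (fst x) * (if snd (fst x) - \<epsilon> < snd (snd x) \<and> snd (snd x)
        < snd (fst x) + \<epsilon> then 1 else 0))"
      by (auto simp: fun_eq_iff indicator_def)
    show ?thesis unfolding eq by measurable
  qed
  have inner: "(\<integral>\<^sup>+v. z * indicator (window y \<epsilon>) (snd v) \<partial>distr M ?B ?V) \<le> ennreal (\<epsilon> / \<sigma>) * z" for z y
  proof -
    have "emeasure (distr M borel V) (window y \<epsilon>)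
        = (\<integral>\<^sup>+x. ennreal (normal_density 0 \<sigma> x) * indicator (window y \<epsilon>) x \<partial>lborel)"
      using distributed_emeasure[OF N, of "window y \<epsilon>"] by (simp add: emeasure_distr)
    also have "\<dots> \<le> (\<integral>\<^sup>+x. ennreal (1 / (2 * \<sigma>)) * indicator (window y \<epsilon>) x \<partial>lborel)"
    proof (intro nn_integral_mono mult_right_mono ennreal_leI)
      fix x :: real
      have "2 \<le> sqrt (2 * pi)"
        using pi_gt3 by (intro real_le_rsqrt) auto
      then have "2 * \<sigma> \<le> sqrt (2 * pi) * \<sigma>" using \<sigma> by (intro mult_right_mono) auto
      then have s2: "2 * \<sigma> \<le> sqrt (2 * pi * \<sigma>\<^sup>2)" using \<sigma> by (simp add: real_sqrt_mult)
      have "normal_density 0 \<sigma> x \<le> 1 / sqrt (2 * pi * \<sigma>\<^sup>2) * 1"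
        unfolding normal_density_def by (intro mult_left_mono) auto
      also have "\<dots> \<le> 1 / (2 * \<sigma>)" using s2 \<sigma> by (simp add: frac_le)
      finally show "normal_density 0 \<sigma> x \<le> 1 / (2 * \<sigma>)" .
    qed auto
    also have "\<dots> = ennreal (\<epsilon> / \<sigma>)"
      using \<sigma> by (simp add: nn_integral_cmult flip: ennreal_mult)
    finally have "emeasure (distr M borel V) (window y \<epsilon>) \<le> ennreal (\<epsilon> / \<sigma>)" .
    moreover have "(\<integral>\<^sup>+v. z * indicator (window y \<epsilon>) (snd v) \<partial>distr M ?B ?V)
        = z * emeasure (distr M borel V) (window y \<epsilon>)"
    proof -
      have "(\<integral>\<^sup>+v. z * indicator (window y \<epsilon>) (snd v) \<partial>distr M ?B ?V)
          = (\<integral>\<^sup>+\<omega>. z * indicator (window y \<epsilon>) (V \<omega>) \<partial>M)"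
        by (subst nn_integral_distr) auto
      also have "\<dots> = (\<integral>\<^sup>+v. z * indicator (window y \<epsilon>) v \<partial>distr M borel V)"
        by (subst nn_integral_distr) auto
      also have "\<dots> = z * emeasure (distr M borel V) (window y \<epsilon>)"
        by (subst nn_integral_cmult) auto
      finally show ?thesis .
    qed
    ultimately show ?thesis by (simp add: mult.commute[of z] mult_right_mono)
  qed
  have "(\<integral>\<^sup>+\<omega>. Z \<omega> * indicator (window (\<xi> \<omega>) \<epsilon>) (V \<omega>) \<partial>M) = (\<integral>\<^sup>+\<omega>. ?g (?P \<omega>, ?V \<omega>) \<partial>M)"
    by simp
  also have "\<dots> = (\<integral>\<^sup>+x. ?g x \<partial>distr M (?B \<Otimes>\<^sub>M ?B) (\<lambda>\<omega>. (?P \<omega>, ?V \<omega>)))"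
    by (rule nn_integral_distr[symmetric]) (auto intro: g)
  also have "\<dots> = (\<integral>\<^sup>+q. \<integral>\<^sup>+v. ?g (q, v) \<partial>distr M ?B ?V \<partial>distr M ?B ?P)"
    unfolding D[symmetric] by (rule V.nn_integral_fst[symmetric]) simp
  also have "\<dots> \<le> (\<integral>\<^sup>+q. ennreal (\<epsilon> / \<sigma>) * fst q \<partial>distr M ?B ?P)"
    by (intro nn_integral_mono) (simp add: inner)
  also have "\<dots> = ennreal (\<epsilon> / \<sigma>) * (\<integral>\<^sup>+\<omega>. Z \<omega> \<partial>M)"
    by (subst nn_integral_distr) (auto simp: nn_integral_cmult)
  finally show ?thesis .
qed

text \<open>
Whatever the past of \<open>s\<close>, the noise after \<open>s\<close> smooths a Wiener integral: its conditional density given the past is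
bounded by the inverse of the standard deviation \<open>\<sigma>\<close> of that noise. Fatou's lemma transfers this from step functions,
because the window is open. Passing to step functions loses a factor \<open>2\<close> in \<open>\<sigma>\<close>.
\<close>

lemma wiener_integral_window:
  assumes X: "has_wiener_integral M W UNIV k X" and \<sigma>: "0 < \<sigma>" "0 < \<epsilon>"
    and k: "ennreal (\<sigma>\<^sup>2) \<le> sq_norm lborel (\<lambda>u. indicator {s<..} u * k u)"
    and Z: "Z \<in> borel_measurable (increments {..s})"
    and \<xi>: "\<xi> \<in> borel_measurable (increments {..s})"
  shows "(\<integral>\<^sup>+\<omega>. Z \<omega> * indicator (window (\<xi> \<omega>) \<epsilon>) (X \<omega>) \<partial>M) \<le> ennreal (2 * \<epsilon> / \<sigma>) * (\<integral>\<^sup>+\<omega>. Z \<omega> \<partial>M)"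
proof -
  from X obtain p where p [measurable]: "(\<lambda>u. indicator UNIV u * k u) \<in> borel_measurable borel" "X
      \<in> borel_measurable M"
    and p': "\<And>n::nat. ordered_steps (p n)"
    "(\<lambda>n. sq_norm lborel (\<lambda>u. indicator UNIV u * k u - step_fun (p n) u)) \<longlonglongrightarrow> 0"
    "(\<lambda>n. sq_norm M (\<lambda>\<omega>. X \<omega> - step_integral W (p n) \<omega>)) \<longlonglongrightarrow> 0"
    by (rule wiener_integralE) (rule that)
  from p(1) have [measurable]: "k \<in> borel_measurable borel" by simp
  have [measurable]: "Z \<in> borel_measurable M" "\<xi> \<in> borel_measurable M"
    using Z \<xi> by (blast intro: measurable_increments_events)+
  obtain r where r: "filterlim r sequentially sequentially"
    and AE: "AE \<omega> in M. (\<lambda>n. step_integral W (p (r n)) \<omega>) \<longlonglongrightarrow> X \<omega>"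
    by (rule L2_limit_AE_subseq[OF p(2) step_integral_measurable p'(3)]) (rule that)
  let ?w = "\<lambda>\<omega>. window (\<xi> \<omega>) \<epsilon>"
  let ?S = "\<lambda>n. step_integral W (p (r n))"
  have ind: "indicator (?w \<omega>) x = (if \<xi> \<omega> - \<epsilon> < x \<and> x < \<xi> \<omega> + \<epsilon> then 1 else 0 :: ennreal)" for \<omega> x
    by (auto simp: indicator_def)
  have "(\<integral>\<^sup>+\<omega>. Z \<omega> * indicator (?w \<omega>) (X \<omega>) \<partial>M)
      \<le> (\<integral>\<^sup>+\<omega>. liminf (\<lambda>n. Z \<omega> * indicator (?w \<omega>) (?S n \<omega>)) \<partial>M)"
  proof (rule nn_integral_mono_AE, use AE in eventually_elim)
    case (elim \<omega>)
    show ?case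
    proof (cases "X \<omega> \<in> ?w \<omega>")
      case True
      then have "eventually (\<lambda>n. ?S n \<omega> \<in> ?w \<omega>) sequentially"
        by (intro topological_tendstoD[OF elim]) auto
      then have "eventually (\<lambda>n. Z \<omega> \<le> Z \<omega> * indicator (?w \<omega>) (?S n \<omega>)) sequentially"
        by eventually_elim simp
      then have "Z \<omega> \<le> liminf (\<lambda>n. Z \<omega> * indicator (?w \<omega>) (?S n \<omega>))"
        by (rule Liminf_bounded)
      then show ?thesis using True by simp
    qed simp
  qed
  also have "\<dots> \<le> liminf (\<lambda>n. \<integral>\<^sup>+\<omega>. Z \<omega> * indicator (?w \<omega>) (?S n \<omega>) \<partial>M)"
    unfolding ind by (rule nn_integral_liminf) measurable
  also have "\<dots> \<le> ennreal (2 * \<epsilon> / \<sigma>) * (\<integral>\<^sup>+\<omega>. Z \<omega> \<partial>M)"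
  proof (rule Liminf_le)
    have "eventually (\<lambda>n. sq_norm lborel (\<lambda>u. k u - step_fun (p n) u) < ennreal (\<sigma>\<^sup>2 / 4)) sequentially"
      using order_tendstoD(2)[OF p'(2), of "ennreal (\<sigma>\<^sup>2 / 4)"] \<sigma> by simp
    then have "eventually (\<lambda>n. sq_norm lborel (\<lambda>u. k u - step_fun (p (r n)) u)
        < ennreal (\<sigma>\<^sup>2 / 4)) sequentially"
      using r by (auto simp: filterlim_iff)
    then show "eventually (\<lambda>n. (\<integral>\<^sup>+\<omega>. Z \<omega> * indicator (?w \<omega>) (?S n \<omega>) \<partial>M)
        \<le> ennreal (2 * \<epsilon> / \<sigma>) * (\<integral>\<^sup>+\<omega>. Z \<omega> \<partial>M)) sequentially"
    proof eventually_elim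
      case (elim n)
      let ?a = "cut_above s (p (r n))" and ?b = "cut_below s (p (r n))"
      have a: "ordered_steps ?a" by (intro ordered_cut p')
      obtain v where v: "v \<ge> 0" "sq_norm lborel (step_fun ?a) = ennreal v"
        "v > 0 \<Longrightarrow> distributed M lborel (step_integral W ?a) (normal_density 0 (sqrt v))"
        by (rule step_integral_law[OF a]) (rule that)
      have "sq_norm lborel (\<lambda>u. indicator {s<..} u * k u)
          \<le> ennreal (2 * 1\<^sup>2) * sq_norm lborel (step_fun ?a)
           + ennreal (2 * 1\<^sup>2) * sq_norm lborel (\<lambda>u. indicator {s<..} u * (k u - step_fun (p (r n)) u))"
        by (rule L2_triangle) (auto simp: step_fun_cut_above[OF p'(1)] algebra_simps)
      also have "\<dots> \<le> ennreal 2 * ennreal v + ennreal 2 * ennreal (\<sigma>\<^sup>2 / 4)"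
      proof -
        have "sq_norm lborel (\<lambda>u. indicator {s<..} u * (k u - step_fun (p (r n)) u))
            \<le> sq_norm lborel (\<lambda>u. k u - step_fun (p (r n)) u)"
          by (intro nn_integral_mono) (auto simp: indicator_def)
        then show ?thesis using elim v(2) by (intro add_mono mult_mono) auto
      qed
      also have "\<dots> = ennreal (2 * v + \<sigma>\<^sup>2 / 2)" using v(1)
          by (simp flip: ennreal_mult ennreal_plus ennreal_numeral)
      finally have "ennreal (\<sigma>\<^sup>2) \<le> ennreal (2 * v + \<sigma>\<^sup>2 / 2)" using k by simp
      then have "\<sigma>\<^sup>2 \<le> 2 * v + \<sigma>\<^sup>2 / 2" using v(1) by (subst (asm) ennreal_le_iff) auto
      then have "(\<sigma> / 2)\<^sup>2 \<le> v" by (simp add: power_divide)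
      then have sv: "\<sigma> / 2 \<le> sqrt v" by (rule real_le_rsqrt)
      then have v0: "0 < sqrt v" using \<sigma> by linarith
      have eq: "indicator (?w \<omega>) (?S n \<omega>)
          = (indicator {(\<xi> \<omega> - step_integral W ?b \<omega>) - \<epsilon> <..< (\<xi> \<omega> - step_integral W ?b \<omega>)
              + \<epsilon>} (step_integral W ?a \<omega>) :: ennreal)" for \<omega>
        by (subst step_integral_cut[of W _ _ s]) (auto simp: indicator_def)
      have "(\<integral>\<^sup>+\<omega>. Z \<omega> * indicator (?w \<omega>) (?S n \<omega>) \<partial>M) \<le> ennreal (\<epsilon> / sqrt v) * (\<integral>\<^sup>+\<omega>. Z \<omega> \<partial>M)"
        unfolding eq
        by (rule past_future_window[OF step_integral_increments[OF endpoints_cut(1)] v0 \<sigma>(2) v(3) Z])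
           (use v0 in \<open>auto intro!: borel_measurable_diff \<xi> step_integral_increments endpoints_cut\<close>)
      also have "\<dots> \<le> ennreal (2 * \<epsilon> / \<sigma>) * (\<integral>\<^sup>+\<omega>. Z \<omega> \<partial>M)"
      proof (intro mult_right_mono ennreal_leI)
        have "\<epsilon> / sqrt v \<le> \<epsilon> / (\<sigma> / 2)" using sv \<sigma> v0 by (intro divide_left_mono mult_pos_pos) auto
        then show "\<epsilon> / sqrt v \<le> 2 * \<epsilon> / \<sigma>" by (simp add: mult.commute)
      qed auto
      finally show ?case .
    qed
  qed auto
  finally show ?thesis .
qed

end

section \<open>The moving average kernel in mean square\<close>

lemma nn_integral_powr_from_0:
  assumes "-1 < e" "0 \<le> c"
  shows "(\<integral>\<^sup>+x. ennreal (x powr e) * indicator {0..c} x \<partial>lborel) = ennreal (c powr (e + 1) / (e + 1))"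
  by (rule nn_integral_has_integral_lebesgue') (use has_integral_powr_from_0[OF assms] in auto)

lemma nn_integral_powr_to_inf:
  assumes "e < -1" "0 < c"
  shows "(\<integral>\<^sup>+x. ennreal (x powr e) * indicator {c..} x \<partial>lborel) = ennreal (- (c powr (e + 1)) / (e + 1))"
  by (rule nn_integral_has_integral_lebesgue') (use has_integral_powr_to_inf[OF assms] in auto)

lemma nn_integral_reflect:
  fixes t :: real
  assumes "f \<in> borel_measurable borel"
  shows "(\<integral>\<^sup>+u. f (t - u) \<partial>lborel) = (\<integral>\<^sup>+v. f v \<partial>lborel :: ennreal)"
  using nn_integral_real_affine[OF assms, of "-1" t] by simp

lemma nn_integral_translate:
  fixes t :: real
  assumes "f \<in> borel_measurable borel"
  shows "(\<integral>\<^sup>+u. f (t + u) \<partial>lborel) = (\<integral>\<^sup>+v. f v \<partial>lborel :: ennreal)"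
  using nn_integral_real_affine[OF assms, of 1 t] by simp

definition pos_powr :: "real \<Rightarrow> real \<Rightarrow> real" where
  "pos_powr a x = (if 0 < x then x powr a else 0)"

text \<open>
The Mandelbrot-Van Ness kernel with \<open>a = H - 1 / 2\<close>. Written with positive parts, it covers both integrals of
the moving average representation with a single formula.
\<close>

definition mvg_kernel :: "real \<Rightarrow> real \<Rightarrow> real \<Rightarrow> real" where
  "mvg_kernel a t u = pos_powr a (t - u) - pos_powr a (- u)"

lemma pos_powr_measurable [measurable]: "pos_powr a \<in> borel_measurable borel"
  unfolding pos_powr_def[abs_def] by measurable

lemma mvg_kernel_measurable [measurable]: "mvg_kernel a t \<in> borel_measurable borel"
  unfolding mvg_kernel_def[abs_def] by measurable

lemma mvg_kernel_future: "0 \<le> t \<Longrightarrow> t < u \<Longrightarrow> mvg_kernel a t u = 0"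
  by (simp add: mvg_kernel_def pos_powr_def)

lemma powr_sq: "(x powr a)\<^sup>2 = x powr (2 * a)" for x :: real
  by (simp add: power2_eq_square flip: powr_add)

text \<open>
After time \<open>s \<ge> 0\<close> the kernel is the pure power \<open>(t - u) powr a\<close>, whose square is integrated explicitly. This is
the variance of the noise that \<open>B t\<close> receives after time \<open>s\<close>.
\<close>

lemma mvg_kernel_innovation:
  assumes "0 \<le> s" "s < t" "- 1 / 2 < a"
  shows "ennreal ((t - s) powr (2 * a + 1) / (2 * a + 1))
    \<le> sq_norm lborel (\<lambda>u. indicator {s<..} u * mvg_kernel a t u)"
proof -
  have "ennreal ((t - s) powr (2 * a + 1) / (2 * a + 1))
      = (\<integral>\<^sup>+v. ennreal (v powr (2 * a)) * indicator {0..t - s} v \<partial>lborel)"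
    using assms by (subst nn_integral_powr_from_0) auto
  also have "\<dots> = (\<integral>\<^sup>+u. ennreal ((t - u) powr (2 * a)) * indicator {0..t - s} (t - u) \<partial>lborel)"
    by (rule nn_integral_reflect[symmetric]) measurable
  also have "\<dots> \<le> sq_norm lborel (\<lambda>u. indicator {s<..} u * mvg_kernel a t u)"
  proof (rule nn_integral_mono_AE, use AE_lborel_singleton[of s] in eventually_elim)
    case (elim u)
    then show ?case using assms
      by (auto simp: indicator_def mvg_kernel_def pos_powr_def powr_sq)
  qed
  finally show ?thesis .
qed

text \<open>
For \<open>v\<close> beyond \<open>d\<close> the mean value theorem gains a factor \<open>d / v\<close>; closer to the singularity the two powers are
bounded separately. Every term on the right integrates to a multiple of \<open>d powr (2 * a + 1)\<close>.
\<close>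

lemma pos_powr_increment_bound:
  assumes d: "0 < d" and a: "- 1 / 2 < a" "a < 1 / 2"
  shows "ennreal ((pos_powr a (d + v) - pos_powr a v)\<^sup>2)
    \<le> ennreal ((d + v) powr (2 * a)) * indicator {0..d} (d + v)
      + (ennreal 2 * (ennreal (v powr (2 * a)) * indicator {0..d} v)
        + ennreal (8 * d powr (2 * a)) * indicator {0..d} v
        + ennreal (d\<^sup>2) * (ennreal (v powr (2 * a - 2)) * indicator {d..} v))"
proof -
  consider "v \<le> - d" | "- d < v" "v \<le> 0" | "0 < v" "v < d" | "d \<le> v" by linarith
  then show ?thesis
  proof cases
    case 1
    then show ?thesis using d by (simp add: pos_powr_def)
  next
    case 2
    then show ?thesis using d by (simp add: pos_powr_def powr_sq)
  next
    case 3
    have "\<bar>(d + v) powr a - v powr a\<bar> \<le> v powr a + 2 * d powr a"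
    proof (cases "a \<ge> 0")
      case True
      have "(d + v) powr a \<le> (2 * d) powr a" using 3 True by (intro powr_mono2) auto
      also have "\<dots> = 2 powr a * d powr a" using d by (simp add: powr_mult)
      also have "\<dots> \<le> 2 powr 1 * d powr a" using a by (intro mult_right_mono powr_mono) auto
      finally have "(d + v) powr a \<le> 2 * d powr a" by simp
      moreover have "v powr a \<ge> 0" "(d + v) powr a \<ge> 0" "d powr a \<ge> 0" by simp_all
      ultimately show ?thesis by linarith
    next
      case False
      have "(d + v) powr a \<le> v powr a" using 3 False d by (intro powr_mono2') auto
      moreover have "(d + v) powr a \<ge> 0" "d powr a \<ge> 0" by simp_all
      ultimately show ?thesis by linarith
    qed
    then have "((d + v) powr a - v powr a)\<^sup>2 \<le> (v powr a + 2 * d powr a)\<^sup>2"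
      by (simp add: abs_le_square_iff[symmetric])
    also have "\<dots> \<le> 2 * (v powr a)\<^sup>2 + 2 * (2 * d powr a)\<^sup>2" by (rule sum_squares_le)
    also have "\<dots> = 2 * v powr (2 * a) + 8 * d powr (2 * a)"
      by (simp add: power_mult_distrib powr_sq)
    finally have "ennreal ((pos_powr a (d + v) - pos_powr a v)\<^sup>2)
        \<le> ennreal (2 * v powr (2 * a) + 8 * d powr (2 * a))"
      using 3 d by (intro ennreal_leI) (simp add: pos_powr_def)
    also have "\<dots> = ennreal 2 * ennreal (v powr (2 * a)) + ennreal (8 * d powr (2 * a))"
      by (subst ennreal_plus) (auto simp: ennreal_mult)
    finally show ?thesis using 3 by simp
  next
    case 4
    have v: "v > 0" using 4 d by simp
    have "\<exists>z>v. z < d + v \<and> (d + v) powr a - v powr a = (d + v - v) * (a * z powr (a - 1))"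
      by (rule MVT2) (use v d in \<open>auto intro!: derivative_eq_intros simp: powr_diff\<close>)
    then obtain z where z: "z > v" "(d + v) powr a - v powr a = d * (a * z powr (a - 1))" by auto
    have "\<bar>(d + v) powr a - v powr a\<bar> = d * (\<bar>a\<bar> * z powr (a - 1))" using d by (simp add: z(2) abs_mult)
    also have "\<dots> \<le> d * (1 * v powr (a - 1))"
      using d a v z by (intro mult_left_mono mult_mono powr_mono2') auto
    finally have "\<bar>(d + v) powr a - v powr a\<bar> \<le> \<bar>d * v powr (a - 1)\<bar>" using d by (simp add: abs_mult)
    then have "((d + v) powr a - v powr a)\<^sup>2 \<le> (d * v powr (a - 1))\<^sup>2" by (simp only: abs_le_square_iff)
    also have "\<dots> = d\<^sup>2 * v powr (2 * a - 2)" by (simp add: power_mult_distrib powr_sq algebra_simps)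
    finally have "ennreal ((pos_powr a (d + v) - pos_powr a v)\<^sup>2) \<le> ennreal (d\<^sup>2 * v powr (2 * a - 2))"
      using v d by (intro ennreal_leI) (simp add: pos_powr_def)
    also have "\<dots> = ennreal (d\<^sup>2) * (ennreal (v powr (2 * a - 2)) * indicator {d..} v)"
      using 4 by (simp add: ennreal_mult)
    finally show ?thesis by (rule order_trans) (simp add: add_increasing)
  qed
qed

lemma mvg_kernel_time_increment:
  assumes d: "0 < d" and a: "- 1 / 2 < a" "a < 1 / 2"
  shows "sq_norm lborel (\<lambda>u. mvg_kernel a (s + d) u - mvg_kernel a s u)
    \<le> ennreal ((3 / (2 * a + 1) + 8 + 1 / (1 - 2 * a)) * d powr (2 * a + 1))"
proof -
  let ?p = "d powr (2 * a + 1) / (2 * a + 1)" and ?q = "- (d powr (2 * a - 2 + 1)) / (2 * a - 2 + 1)"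
  have "sq_norm lborel (\<lambda>u. mvg_kernel a (s + d) u - mvg_kernel a s u)
      = sq_norm lborel (\<lambda>u. pos_powr a (d + (s - u)) - pos_powr a (s - u))"
    by (intro nn_integral_cong) (simp add: mvg_kernel_def algebra_simps)
  also have "\<dots> = sq_norm lborel (\<lambda>v. pos_powr a (d + v) - pos_powr a v)"
    by (rule nn_integral_reflect[of "\<lambda>v. ennreal ((pos_powr a (d + v) - pos_powr a v)\<^sup>2)"]) measurable
  also have "\<dots> \<le> (\<integral>\<^sup>+v. ennreal ((d + v) powr (2 * a)) * indicator {0..d} (d + v)
      + (ennreal 2 * (ennreal (v powr (2 * a)) * indicator {0..d} v)
        + ennreal (8 * d powr (2 * a)) * indicator {0..d} v
        + ennreal (d\<^sup>2) * (ennreal (v powr (2 * a - 2)) * indicator {d..} v)) \<partial>lborel)"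
    by (intro nn_integral_mono pos_powr_increment_bound d a)
  also have "\<dots> = (\<integral>\<^sup>+v. ennreal ((d + v) powr (2 * a)) * indicator {0..d} (d + v) \<partial>lborel)
      + (ennreal 2 * (\<integral>\<^sup>+v. ennreal (v powr (2 * a)) * indicator {0..d} v \<partial>lborel)
        + ennreal (8 * d powr (2 * a)) * (\<integral>\<^sup>+v. indicator {0..d} v \<partial>lborel)
        + ennreal (d\<^sup>2) * (\<integral>\<^sup>+v. ennreal (v powr (2 * a - 2)) * indicator {d..} v \<partial>lborel))"
    by (simp add: nn_integral_add nn_integral_cmult)
  also have "(\<integral>\<^sup>+v. ennreal ((d + v) powr (2 * a)) * indicator {0..d} (d + v) \<partial>lborel)
      = (\<integral>\<^sup>+v. ennreal (v powr (2 * a)) * indicator {0..d} v \<partial>lborel)"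
    by (rule nn_integral_translate) measurable
  also have "(\<integral>\<^sup>+v. ennreal (v powr (2 * a)) * indicator {0..d} v \<partial>lborel) = ennreal ?p"
    using a d by (intro nn_integral_powr_from_0) auto
  also have "(\<integral>\<^sup>+v. ennreal (v powr (2 * a - 2)) * indicator {d..} v \<partial>lborel)
      = ennreal ?q"
    using a d by (intro nn_integral_powr_to_inf) auto
  also have "(\<integral>\<^sup>+v. indicator {0..d} v \<partial>lborel) = ennreal d" using d by simp
  also have "ennreal ?p
      + (ennreal 2 * ennreal ?p + ennreal (8 * d powr (2 * a)) * ennreal d
         + ennreal (d\<^sup>2) * ennreal ?q)
    = ennreal (?p + (2 * ?p + 8 * d powr (2 * a) * d
         + d\<^sup>2 * ?q))"
  proof -
    have "0 \<le> ?q"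
      using a by (intro divide_nonpos_neg) auto
    moreover have "ennreal x + (ennreal 2 * ennreal x + ennreal y * ennreal d + ennreal (d\<^sup>2) * ennreal z)
        = ennreal (x + (2 * x + y * d + d\<^sup>2 * z))" if "0 \<le> x" "0 \<le> y" "0 \<le> z" for x y z
      using that d by (simp flip: ennreal_mult ennreal_plus ennreal_numeral)
    ultimately show ?thesis using a by simp
  qed
  also have "?p + (2 * ?p + 8 * d powr (2 * a) * d
         + d\<^sup>2 * ?q)
    = (3 / (2 * a + 1) + 8 + 1 / (1 - 2 * a)) * d powr (2 * a + 1)"
  proof -
    have 1: "d powr (2 * a) * d = d powr (2 * a + 1)" using d powr_add[of d "2 * a" 1] by simp
    have "d\<^sup>2 * d powr (2 * a - 2 + 1) = d powr 2 * d powr (2 * a - 2 + 1)" using d by simp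
    also have "\<dots> = d powr (2 * a + 1)" unfolding powr_add[symmetric] by (simp add: add.commute)
    finally have 2: "d\<^sup>2 * d powr (2 * a - 2 + 1) = d powr (2 * a + 1)" .
    have 3: "- x / (2 * a - 2 + 1) = x / (1 - 2 * a)" for x
    proof -
      have "2 * a - 2 + 1 = - (1 - 2 * a)" by simp
      then show ?thesis by (simp only: minus_divide_divide)
    qed
    have 4: "8 * d powr (2 * a) * d = 8 * d powr (2 * a + 1)" using 1 by (simp only: mult.assoc)
    have 5: "d\<^sup>2 * ?q = d powr (2 * a + 1) / (1 - 2 * a)"
      unfolding 3 by (simp only: times_divide_eq_right 2)
    show ?thesis unfolding 4 5 by (simp add: distrib_right)
  qed
  finally show ?thesis .
qed

text \<open>
Differentiating in the exponent produces a logarithm, which costs an arbitrarily small power \<open>\<epsilon>\<close> at the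
singularity.
\<close>

lemma powr_exponent_diff:
  fixes x a b \<alpha> \<epsilon> R :: real
  assumes x: "0 < x" "x \<le> R" and R: "1 \<le> R" and \<epsilon>: "0 < \<epsilon>" "\<epsilon> \<le> 1 / 2"
    and a: "\<alpha> \<le> a" "a \<le> \<alpha> + 1" and b: "\<alpha> \<le> b" "b \<le> \<alpha> + 1"
  shows "\<bar>x powr a - x powr b\<bar> \<le> \<bar>a - b\<bar> * (2 * R\<^sup>2 / \<epsilon> * x powr (\<alpha> - \<epsilon>))"
proof -
  have *: "\<bar>x powr a - x powr b\<bar> \<le> \<bar>a - b\<bar> * (2 * R\<^sup>2 / \<epsilon> * x powr (\<alpha> - \<epsilon>))"
    if ab: "a < b" "\<alpha> \<le> a" "b \<le> \<alpha> + 1" for a b :: real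
  proof -
    have "\<exists>z>a. z < b \<and> x powr b - x powr a = (b - a) * (x powr z * ln x)"
      by (rule MVT2[of a b "\<lambda>z. x powr z" "\<lambda>z. x powr z * ln x"])
         (use ab x in \<open>auto intro!: derivative_eq_intros\<close>)
    then obtain z where z: "a < z" "z < b" "x powr b - x powr a = (b - a) * (x powr z * ln x)" by auto
    have ln: "\<bar>ln x\<bar> \<le> (x powr \<epsilon> + x powr (- \<epsilon>)) / \<epsilon>"
    proof -
      have "\<epsilon> * ln x \<le> x powr \<epsilon>" using ln_le_minus_one[of "x powr \<epsilon>"] x by (simp add: ln_powr)
      moreover have "- \<epsilon> * ln x \<le> x powr (- \<epsilon>)" using ln_le_minus_one[of "x powr (- \<epsilon>)"] x
          by (simp add: ln_powr)
      moreover have "0 \<le> x powr \<epsilon>" "0 \<le> x powr (- \<epsilon>)" by simp_all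
      ultimately have "\<bar>\<epsilon> * ln x\<bar> \<le> x powr \<epsilon> + x powr (- \<epsilon>)" by (simp only: abs_le_iff) linarith
      then show ?thesis using \<epsilon> by (simp add: abs_mult field_simps)
    qed
    have up: "x powr (\<alpha> - \<epsilon> + p) \<le> x powr (\<alpha> - \<epsilon>) * R\<^sup>2" if "0 \<le> p" "p \<le> 2" for p
    proof -
      have "x powr p \<le> R powr p" using x that by (intro powr_mono2) auto
      also have "\<dots> \<le> R powr 2" using R that by (intro powr_mono) auto
      finally show ?thesis using R by (simp add: powr_add mult_left_mono)
    qed
    have "x powr z * \<bar>ln x\<bar> \<le> x powr z * ((x powr \<epsilon> + x powr (- \<epsilon>)) / \<epsilon>)"
      by (intro mult_left_mono ln) auto
    also have "\<dots> = (x powr (\<alpha> - \<epsilon> + (z - \<alpha> + 2 * \<epsilon>)) + x powr (\<alpha> - \<epsilon> + (z - \<alpha>))) / \<epsilon>"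
      by (simp add: distrib_left flip: powr_add) (simp add: algebra_simps)
    also have "\<dots> \<le> (x powr (\<alpha> - \<epsilon>) * R\<^sup>2 + x powr (\<alpha> - \<epsilon>) * R\<^sup>2) / \<epsilon>"
      using z ab \<epsilon> by (intro divide_right_mono add_mono up) auto
    also have "\<dots> = 2 * R\<^sup>2 / \<epsilon> * x powr (\<alpha> - \<epsilon>)" by simp
    finally have "(b - a) * (x powr z * \<bar>ln x\<bar>) \<le> (b - a) * (2 * R\<^sup>2 / \<epsilon> * x powr (\<alpha> - \<epsilon>))"
      using ab by (intro mult_left_mono) auto
    moreover have "\<bar>x powr a - x powr b\<bar> = (b - a) * (x powr z * \<bar>ln x\<bar>)"
      using ab by (subst abs_minus_commute) (simp add: z(3) abs_mult)
    ultimately show ?thesis using ab by simp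
  qed
  consider "a < b" | "a = b" | "b < a" by linarith
  then show ?thesis
    using *[of a b] *[of b a] a b by cases (auto simp: abs_minus_commute)
qed

text \<open>
Far from the singularity the mean value theorem is used twice, in the base and in the exponent. The first use
gains a power of \<open>v\<close>, which makes the tail square integrable; the logarithm from the second costs \<open>\<epsilon>\<close>.
\<close>

lemma powr_mixed_diff:
  fixes v t a b \<alpha> \<epsilon> :: real
  assumes v: "1 \<le> v" and t: "0 \<le> t" and \<epsilon>: "0 < \<epsilon>"
    and a: "\<bar>a\<bar> \<le> 1" "a \<le> \<alpha>" and b: "\<bar>b\<bar> \<le> 1" "b \<le> \<alpha>" and \<alpha>: "\<alpha> + \<epsilon> \<le> 1"
  shows "\<bar>((t + v) powr a - v powr a) - ((t + v) powr b - v powr b)\<bar>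
    \<le> \<bar>a - b\<bar> * (t * (1 + 1 / \<epsilon>) * v powr (\<alpha> - 1 + \<epsilon>))"
proof -
  have *: "\<bar>((t + v) powr a - v powr a) - ((t + v) powr b - v powr b)\<bar>
    \<le> \<bar>a - b\<bar> * (t * (1 + 1 / \<epsilon>) * v powr (\<alpha> - 1 + \<epsilon>))"
    if ab: "a < b" "\<bar>a\<bar> \<le> 1" "\<bar>b\<bar> \<le> 1" "b \<le> \<alpha>" and t: "0 < t" for a b :: real
  proof -
    let ?F = "\<lambda>w. w powr b - w powr a"
    have "\<exists>w>v. w < t + v \<and> ?F (t + v) - ?F v = (t + v - v) * (b * w powr (b - 1) - a * w powr (a - 1))"
      by (rule MVT2[of v "t + v" ?F "\<lambda>w. b * w powr (b - 1) - a * w powr (a - 1)"])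
         (use v t in \<open>auto intro!: derivative_eq_intros simp: powr_diff\<close>)
    then obtain w where w: "w > v" "?F (t + v) - ?F v = t * (b * w powr (b - 1) - a * w powr (a - 1))" by auto
    have w1: "1 < w" using w v by simp
    have "\<exists>z>a. z < b \<and> b * w powr (b - 1) - a * w powr (a - 1) = (b - a) * (w powr (z - 1) * (1 + z * ln w))"
      by (rule MVT2[of a b "\<lambda>z. z * w powr (z - 1)" "\<lambda>z. w powr (z - 1) * (1 + z * ln w)"])
         (use ab w1 in \<open>auto intro!: derivative_eq_intros simp: algebra_simps\<close>)
    then obtain z where z: "a < z" "z < b"
      "b * w powr (b - 1) - a * w powr (a - 1) = (b - a) * (w powr (z - 1) * (1 + z * ln w))" by auto
    have lnw: "0 \<le> ln w" using w1 by simp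
    have "\<bar>1 + z * ln w\<bar> \<le> 1 + \<bar>z\<bar> * ln w" using lnw abs_triangle_ineq[of 1 "z * ln w"] by (simp add: abs_mult)
    also have "\<dots> \<le> 1 + 1 * ln w" using lnw z ab by (intro add_left_mono mult_right_mono) auto
    also have "\<dots> \<le> w powr \<epsilon> + w powr \<epsilon> / \<epsilon>"
    proof (rule add_mono)
      show "1 \<le> w powr \<epsilon>" using w1 \<epsilon> by (intro ge_one_powr_ge_zero) auto
      have "\<epsilon> * ln w \<le> w powr \<epsilon>" using ln_le_minus_one[of "w powr \<epsilon>"] w1 by (simp add: ln_powr)
      then show "1 * ln w \<le> w powr \<epsilon> / \<epsilon>" using \<epsilon> by (simp add: field_simps)
    qed
    finally have ln: "\<bar>1 + z * ln w\<bar> \<le> (1 + 1 / \<epsilon>) * w powr \<epsilon>" by (simp add: algebra_simps)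
    have "w powr (z - 1) * \<bar>1 + z * ln w\<bar> \<le> w powr (\<alpha> - 1) * ((1 + 1 / \<epsilon>) * w powr \<epsilon>)"
      using z ab w1 by (intro mult_mono ln powr_mono) auto
    also have "\<dots> = (1 + 1 / \<epsilon>) * w powr (\<alpha> - 1 + \<epsilon>)" by (simp add: powr_add)
    also have "\<dots> \<le> (1 + 1 / \<epsilon>) * v powr (\<alpha> - 1 + \<epsilon>)"
      using w v \<epsilon> \<alpha> by (intro mult_left_mono powr_mono2') auto
    finally have le: "w powr (z - 1) * \<bar>1 + z * ln w\<bar> \<le> (1 + 1 / \<epsilon>) * v powr (\<alpha> - 1 + \<epsilon>)" .
    have "\<bar>((t + v) powr a - v powr a) - ((t + v) powr b - v powr b)\<bar> = \<bar>?F (t + v) - ?F v\<bar>"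
      by (simp add: abs_if algebra_simps)
    also have "\<dots> = t * ((b - a) * (w powr (z - 1) * \<bar>1 + z * ln w\<bar>))"
      unfolding w(2) z(3) using t ab by (simp add: abs_mult)
    also have "\<dots> \<le> t * ((b - a) * ((1 + 1 / \<epsilon>) * v powr (\<alpha> - 1 + \<epsilon>)))"
      using t ab by (intro mult_left_mono le) auto
    finally show ?thesis using ab by (simp add: mult_ac)
  qed
  consider "t = 0" | "a = b" | "0 < t" "a < b" | "0 < t" "b < a" using t by linarith
  then show ?thesis
  proof cases
    case 3 then show ?thesis using * a b by simp
  next
    case 4
    then show ?thesis using *[of b a] a b by (simp add: abs_minus_commute)
  qed auto
qed

text \<open>
The kernel is Lipschitz in its exponent in mean square, uniformly for bounded times. The half-line is split at
distance \<open>1\<close> from the singularity at \<open>0\<close> into a part for \<open>powr_exponent_diff\<close> and a tail for \<open>powr_mixed_diff\<close>.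
\<close>

lemma mvg_kernel_exponent_increment:
  assumes \<alpha>: "- 1 / 2 < \<alpha>0" "\<alpha>1 < 1 / 2" and T: "0 \<le> T"
  obtains C where "C \<ge> 0" "\<And>a b t. a \<in> {\<alpha>0..\<alpha>1} \<Longrightarrow> b \<in> {\<alpha>0..\<alpha>1} \<Longrightarrow> t \<in> {0..T} \<Longrightarrow>
    sq_norm lborel (\<lambda>u. mvg_kernel a t u - mvg_kernel b t u) \<le> ennreal (C * (a - b)\<^sup>2)"
proof -
  \<comment> \<open>Half of the room that is left before square integrability fails, at the singularity and at infinity.\<close>
  define \<epsilon>0 where "\<epsilon>0 = (\<alpha>0 + 1 / 2) / 2"
  define \<epsilon>1 where "\<epsilon>1 = (1 / 2 - \<alpha>1) / 2"
  define R where "R = T + 1"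
  define q where "q = \<alpha>0 - \<epsilon>0"
  define r where "r = \<alpha>1 - 1 + \<epsilon>1"
  define G where "G = 2 * R\<^sup>2 / \<epsilon>0"
  define D where "D = T * (1 + 1 / \<epsilon>1)"
  have q: "- 1 < 2 * q" and r: "2 * r < - 1" using \<alpha> by (auto simp: q_def r_def \<epsilon>0_def \<epsilon>1_def field_simps)
  define C where "C = 2 * G\<^sup>2 * (R powr (2 * q + 1) / (2 * q + 1)) + 2 * G\<^sup>2 * (R powr (2 * q + 1) / (2 * q
      + 1))
      + D\<^sup>2 * (- (1 powr (2 * r + 1)) / (2 * r + 1))"
  have nn: "0 \<le> R powr (2 * q + 1) / (2 * q + 1)" "0 \<le> - (1 powr (2 * r + 1)) / (2 * r + 1)"
    using q r by (auto intro!: divide_nonpos_neg)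
  show ?thesis
  proof (rule that)
    show C0: "C \<ge> 0" unfolding C_def using nn by (intro add_nonneg_nonneg mult_nonneg_nonneg) auto
    fix a b t assume ab: "a \<in> {\<alpha>0..\<alpha>1}" "b \<in> {\<alpha>0..\<alpha>1}" and t: "t \<in> {0..T}"
    let ?p = "R powr (2 * q + 1) / (2 * q + 1)" and ?s = "- (1 powr (2 * r + 1)) / (2 * r + 1)"
    let ?\<Delta> = "\<lambda>u. mvg_kernel a t u - mvg_kernel b t u"
    have single: "\<bar>pos_powr a x - pos_powr b x\<bar> \<le> \<bar>a - b\<bar> * (G * x powr q)" if "0 < x" "x \<le> R" for x
      using powr_exponent_diff[of x R \<epsilon>0 \<alpha>0 a b] that ab \<alpha> T
      by (simp add: pos_powr_def G_def q_def R_def \<epsilon>0_def)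
    \<comment> \<open>The integration variable \<open>v = - u\<close> puts the two singularities at \<open>- t\<close> and \<open>0\<close>.\<close>
    have split: "?\<Delta> (- v)
        = (pos_powr a (t + v) - pos_powr b (t + v)) - (pos_powr a v - pos_powr b v)" for v
      by (simp add: mvg_kernel_def)
    have bound: "ennreal ((?\<Delta> (- v))\<^sup>2)
      \<le> ennreal ((a - b)\<^sup>2) * (ennreal (2 * G\<^sup>2) * (ennreal ((t + v) powr (2 * q)) * indicator {0..R} (t + v))
        + ennreal (2 * G\<^sup>2) * (ennreal (v powr (2 * q)) * indicator {0..R} v)
        + ennreal (D\<^sup>2) * (ennreal (v powr (2 * r)) * indicator {1..} v))"
      (is "_ \<le> _ * (?A v + ?B v + ?C v)") for v
    proof -
      consider "v \<le> - t" | "- t < v" "v \<le> 0" | "0 < v" "v \<le> 1" | "1 < v" by linarith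
      then show ?thesis
      proof cases
        case 1
        then show ?thesis using t by (simp add: split pos_powr_def)
      next
        case 2
        then have tv: "0 < t + v" "t + v \<le> R" using t by (auto simp: R_def)
        have "\<bar>?\<Delta> (- v)\<bar> \<le> \<bar>a - b\<bar> * (G * (t + v) powr q)"
          using single[OF tv] 2 by (simp add: split pos_powr_def[of _ v])
        then have "(?\<Delta> (- v))\<^sup>2 \<le> (\<bar>a - b\<bar> * (G * (t + v) powr q))\<^sup>2"
          by (rule abs_le_square_iff[THEN iffD1, OF order_trans]) simp
        also have "\<dots> \<le> (a - b)\<^sup>2 * ((2 * G\<^sup>2) * (t + v) powr (2 * q))"
          unfolding power_mult_distrib powr_sq power2_abs by (intro mult_left_mono mult_right_mono) auto
        finally have "ennreal ((?\<Delta> (- v))\<^sup>2) \<le> ennreal ((a - b)\<^sup>2) * ?A v"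
          using tv by (simp add: ennreal_mult[symmetric] ennreal_leI)
        also have "\<dots> \<le> ennreal ((a - b)\<^sup>2) * (?A v + ?B v + ?C v)"
          by (intro mult_left_mono) (auto simp: add_increasing2)
        finally show ?thesis .
      next
        case 3
        then have tv: "0 < t + v" "t + v \<le> R" "v \<le> R" using t T by (auto simp: R_def)
        have "\<bar>?\<Delta> (- v)\<bar>
            \<le> \<bar>pos_powr a (t + v) - pos_powr b (t + v)\<bar> + \<bar>pos_powr a v - pos_powr b v\<bar>"
          unfolding split by (rule abs_triangle_ineq4)
        also have "\<dots> \<le> \<bar>a - b\<bar> * (G * (t + v) powr q) + \<bar>a - b\<bar> * (G * v powr q)"
          using single[OF tv(1,2)] single[OF 3(1) tv(3)] by (rule add_mono)
        finally have "(?\<Delta> (- v))\<^sup>2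
            \<le> (\<bar>a - b\<bar> * (G * (t + v) powr q) + \<bar>a - b\<bar> * (G * v powr q))\<^sup>2"
          by (rule abs_le_square_iff[THEN iffD1, OF order_trans]) simp
        also have "\<dots> \<le> 2 * (\<bar>a - b\<bar> * (G * (t + v) powr q))\<^sup>2 + 2 * (\<bar>a - b\<bar> * (G * v powr q))\<^sup>2"
          by (rule sum_squares_le)
        also have "\<dots> = (a - b)\<^sup>2 * ((2 * G\<^sup>2) * (t + v) powr (2 * q) + (2 * G\<^sup>2) * v powr (2 * q))"
          by (simp add: power_mult_distrib powr_sq algebra_simps)
        finally have "ennreal ((?\<Delta> (- v))\<^sup>2) \<le> ennreal ((a - b)\<^sup>2) * (?A v + ?B v)"
          using tv 3 by (simp add: ennreal_mult[symmetric] ennreal_plus[symmetric] ennreal_leI del: ennreal_plus)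
        also have "\<dots> \<le> ennreal ((a - b)\<^sup>2) * (?A v + ?B v + ?C v)"
          by (intro mult_left_mono) (auto simp: add_increasing2)
        finally show ?thesis .
      next
        case 4
        have "\<bar>?\<Delta> (- v)\<bar>
            = \<bar>((t + v) powr a - v powr a) - ((t + v) powr b - v powr b)\<bar>"
          using 4 t by (simp add: split pos_powr_def algebra_simps)
        also have "\<dots> \<le> \<bar>a - b\<bar> * (t * (1 + 1 / \<epsilon>1) * v powr (\<alpha>1 - 1 + \<epsilon>1))"
        proof (rule powr_mixed_diff)
          show "\<alpha>1 + \<epsilon>1 \<le> 1" "0 < \<epsilon>1" using \<alpha> by (simp_all add: \<epsilon>1_def field_simps)
        qed (use 4 t ab \<alpha> in auto)
        also have "\<dots> \<le> \<bar>a - b\<bar> * (D * v powr r)"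
          unfolding D_def r_def using t \<alpha> by (intro mult_left_mono mult_right_mono) (auto simp: \<epsilon>1_def)
        finally have "(?\<Delta> (- v))\<^sup>2 \<le> (\<bar>a - b\<bar> * (D * v powr r))\<^sup>2"
          by (rule abs_le_square_iff[THEN iffD1, OF order_trans]) simp
        also have "\<dots> = (a - b)\<^sup>2 * (D\<^sup>2 * v powr (2 * r))"
          by (simp add: power_mult_distrib powr_sq)
        finally have "ennreal ((?\<Delta> (- v))\<^sup>2) \<le> ennreal ((a - b)\<^sup>2) * ?C v"
          using 4 by (simp add: ennreal_mult[symmetric] ennreal_leI)
        also have "\<dots> \<le> ennreal ((a - b)\<^sup>2) * (?A v + ?B v + ?C v)"
          by (intro mult_left_mono) (auto simp: add_increasing)
        finally show ?thesis .
      qed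
    qed
    have "sq_norm lborel ?\<Delta>
        = sq_norm lborel (\<lambda>v. ?\<Delta> (0 - v))"
      by (rule nn_integral_reflect[symmetric]) measurable
    also have "\<dots> \<le> (\<integral>\<^sup>+v. ennreal ((a - b)\<^sup>2) * (ennreal (2 * G\<^sup>2) * (ennreal ((t
        + v) powr (2 * q)) * indicator {0..R} (t + v))
        + ennreal (2 * G\<^sup>2) * (ennreal (v powr (2 * q)) * indicator {0..R} v)
        + ennreal (D\<^sup>2) * (ennreal (v powr (2 * r)) * indicator {1..} v)) \<partial>lborel)"
      using bound by (intro nn_integral_mono) simp
    also have "\<dots> = ennreal ((a - b)\<^sup>2) * (ennreal (2 * G\<^sup>2) * (\<integral>\<^sup>+v. ennreal ((t
        + v) powr (2 * q)) * indicator {0..R} (t + v) \<partial>lborel)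
        + ennreal (2 * G\<^sup>2) * (\<integral>\<^sup>+v. ennreal (v powr (2 * q)) * indicator {0..R} v \<partial>lborel)
        + ennreal (D\<^sup>2) * (\<integral>\<^sup>+v. ennreal (v powr (2 * r)) * indicator {1..} v \<partial>lborel))"
      by (simp add: nn_integral_add nn_integral_cmult)
    also have "(\<integral>\<^sup>+v. ennreal ((t + v) powr (2 * q)) * indicator {0..R} (t + v) \<partial>lborel)
        = (\<integral>\<^sup>+v. ennreal (v powr (2 * q)) * indicator {0..R} v \<partial>lborel)"
      by (rule nn_integral_translate) measurable
    also have "(\<integral>\<^sup>+v. ennreal (v powr (2 * q)) * indicator {0..R} v \<partial>lborel) = ennreal (?p)"
      using q T by (intro nn_integral_powr_from_0) (auto simp: R_def)
    also have "(\<integral>\<^sup>+v. ennreal (v powr (2 * r)) * indicator {1..} v \<partial>lborel) = ennreal (?s)"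
      using r by (intro nn_integral_powr_to_inf) auto
    also have "ennreal ((a - b)\<^sup>2) * (ennreal (2 * G\<^sup>2) * ennreal (?p)
        + ennreal (2 * G\<^sup>2) * ennreal (?p)
        + ennreal (D\<^sup>2) * ennreal (?s)) = ennreal ((a - b)\<^sup>2) * ennreal C"
    proof -
      have "ennreal g * ennreal x + ennreal g * ennreal x + ennreal d * ennreal y
          = ennreal (g * x + g * x + d * y)"
        if "0 \<le> g" "0 \<le> x" "0 \<le> d" "0 \<le> y" for g x d y
        using that by (simp flip: ennreal_mult ennreal_plus)
      from this[OF _ nn(1) _ nn(2), of "2 * G\<^sup>2" "D\<^sup>2"] show ?thesis unfolding C_def by simp
    qed
    also have "\<dots> = ennreal (C * (a - b)\<^sup>2)" using C0 by (simp add: mult.commute flip: ennreal_mult)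
    finally show "sq_norm lborel ?\<Delta> \<le> ennreal (C * (a - b)\<^sup>2)" .
  qed
qed

section \<open>Continuity of paths from moments of increments\<close>

definition dyadic_floor :: "nat \<Rightarrow> real \<Rightarrow> real" where
  "dyadic_floor n s = of_int \<lfloor>2 ^ n * s\<rfloor> / 2 ^ n"

lemma dyadic_floor_bounds: "dyadic_floor n s \<le> s" "s - 1 / 2 ^ n < dyadic_floor n s"
proof -
  have "of_int \<lfloor>2 ^ n * s\<rfloor> \<le> 2 ^ n * s" "2 ^ n * s - 1 < of_int \<lfloor>2 ^ n * s\<rfloor>" by linarith+
  then have "of_int \<lfloor>2 ^ n * s\<rfloor> / 2 ^ n \<le> 2 ^ n * s / 2 ^ n"
    "(2 ^ n * s - 1) / 2 ^ n < of_int \<lfloor>2 ^ n * s\<rfloor> / 2 ^ n"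
    by (intro divide_right_mono divide_strict_right_mono; simp)+
  then show "dyadic_floor n s \<le> s" "s - 1 / 2 ^ n < dyadic_floor n s"
    unfolding dyadic_floor_def by (simp_all add: diff_divide_distrib)
qed

lemma dyadic_floor_nonneg: "0 \<le> s \<Longrightarrow> 0 \<le> dyadic_floor n s"
  by (simp add: dyadic_floor_def)

lemma dyadic_floor_tendsto: "(\<lambda>n. dyadic_floor n s) \<longlonglongrightarrow> s"
proof (rule tendsto_sandwich[of "\<lambda>n. s - 1 / 2 ^ n"])
  have "(\<lambda>n. s - (1 / 2) ^ n) \<longlonglongrightarrow> s - 0"
    by (intro tendsto_diff tendsto_const LIMSEQ_realpow_zero) auto
  then show "(\<lambda>n. s - 1 / 2 ^ n) \<longlonglongrightarrow> s" by (simp add: power_one_over)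
qed (auto intro!: always_eventually dyadic_floor_bounds(1) less_imp_le[OF dyadic_floor_bounds(2)])

lemma dyadic_floor_nat:
  assumes "0 \<le> s" "s < real N"
  obtains k where "dyadic_floor n s = real k / 2 ^ n" "k < N * 2 ^ n" "real k = of_int \<lfloor>2 ^ n * s\<rfloor>"
proof -
  have "2 ^ n * s < 2 ^ n * real N" using assms by (intro mult_strict_left_mono) auto
  moreover have "of_int \<lfloor>2 ^ n * s\<rfloor> \<le> 2 ^ n * s" by linarith
  moreover have "real (N * 2 ^ n) = 2 ^ n * real N" by simp
  ultimately have "of_int \<lfloor>2 ^ n * s\<rfloor> < real (N * 2 ^ n)" by linarith
  moreover have "0 \<le> \<lfloor>2 ^ n * s\<rfloor>" using assms by simp
  ultimately have k: "real (nat \<lfloor>2 ^ n * s\<rfloor>) = of_int \<lfloor>2 ^ n * s\<rfloor>"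
    and "real (nat \<lfloor>2 ^ n * s\<rfloor>) < real (N * 2 ^ n)" by simp_all
  then have "nat \<lfloor>2 ^ n * s\<rfloor> < N * 2 ^ n" by (simp only: of_nat_less_iff)
  then show ?thesis using that[of "nat \<lfloor>2 ^ n * s\<rfloor>"] k by (simp add: dyadic_floor_def)
qed

text \<open>
Refining a dyadic approximation by one level changes the point by nothing or by one dyadic step, so the values along
\<open>dyadic_floor n s\<close> converge geometrically and uniformly in \<open>s\<close>.
\<close>

lemma dyadic_chaining:
  fixes x :: "real \<Rightarrow> real" and N :: nat
  assumes \<theta>: "0 < \<theta>" "\<theta> < 1"
    and inc: "\<And>n k. n \<ge> n0 \<Longrightarrow> k < N * 2 ^ n \<Longrightarrow> \<bar>x (real (Suc k) / 2 ^ n) - x (real k / 2 ^ n)\<bar> \<le> \<theta> ^ n"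
  shows "\<exists>g. continuous_on {0..<real N} g \<and> (\<forall>s\<in>{0..<real N}. (\<lambda>n. x (dyadic_floor n s)) \<longlonglongrightarrow> g s)"
proof -
  define C where "C = \<theta> / (1 - \<theta>)"
  have C: "C > 0" "C * (1 - \<theta>) = \<theta>" using \<theta> by (auto simp: C_def)
  let ?y = "\<lambda>s n. x (dyadic_floor n s)"
  have refine: "\<bar>?y s (Suc n) - ?y s n\<bar> \<le> \<theta> ^ Suc n" if s: "s \<in> {0..<real N}" and n: "n \<ge> n0" for s n
  proof -
    obtain k where k: "dyadic_floor n s = real k / 2 ^ n" "k < N * 2 ^ n" "real k = of_int \<lfloor>2 ^ n * s\<rfloor>"
      using dyadic_floor_nat[of s N n] s by auto
    obtain j where j: "dyadic_floor (Suc n) s = real j / 2 ^ Suc n" "j < N * 2 ^ Suc n" "real j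
        = of_int \<lfloor>2 ^ Suc n * s\<rfloor>"
      using dyadic_floor_nat[of s N "Suc n"] s by auto
    have "real k \<le> 2 ^ n * s" "2 ^ n * s < real k + 1" unfolding k(3) by linarith+
    moreover have "real j \<le> 2 * (2 ^ n * s)" "2 * (2 ^ n * s) < real j + 1"
      unfolding j(3) power_Suc mult.assoc by linarith+
    ultimately have "real j < real (2 * k + 2)" "real (2 * k) < real j + 1" by auto
    then have "j = 2 * k \<or> j = Suc (2 * k)" by linarith
    then show ?thesis
    proof
      assume "j = 2 * k"
      then have "dyadic_floor (Suc n) s = dyadic_floor n s" by (simp add: j(1) k(1))
      then show ?thesis using \<theta> by simp
    next
      assume jk: "j = Suc (2 * k)"
      have "dyadic_floor n s = real (2 * k) / 2 ^ Suc n" by (simp add: k(1))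
      then show ?thesis using inc[of "Suc n" "2 * k"] n j(2) unfolding j(1) jk by simp
    qed
  qed
  have tele: "\<bar>?y s (n + j) - ?y s n\<bar> \<le> C * (\<theta> ^ n - \<theta> ^ (n + j))" if s: "s \<in> {0..<real N}"
      and n: "n \<ge> n0" for s n j
  proof (induction j)
    case (Suc j)
    have "\<bar>?y s (n + Suc j) - ?y s n\<bar> \<le> \<bar>?y s (Suc (n + j)) - ?y s (n + j)\<bar> + \<bar>?y s (n + j) - ?y s n\<bar>" by simp
    also have "\<dots> \<le> C * (1 - \<theta>) * \<theta> ^ (n + j) + C * (\<theta> ^ n - \<theta> ^ (n + j))"
      using refine[OF s, of "n + j"] n Suc C(2) by (intro add_mono) auto
    also have "\<dots> = C * (\<theta> ^ n - \<theta> ^ (n + Suc j))" by (simp add: algebra_simps)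
    finally show ?case .
  qed simp
  have tele': "\<bar>?y s m - ?y s n\<bar> \<le> C * \<theta> ^ n" if s: "s \<in> {0..<real N}" and n: "n \<ge> n0" "m \<ge> n" for s n m
  proof -
    have "C * (\<theta> ^ n - \<theta> ^ (n + (m - n))) \<le> C * \<theta> ^ n" using C \<theta> by (intro mult_left_mono) auto
    then show ?thesis using tele[OF s n(1), of "m - n"] n by simp
  qed
  have small: "(\<lambda>n. K * \<theta> ^ n) \<longlonglongrightarrow> 0" for K
    using tendsto_mult_right_zero[OF LIMSEQ_realpow_zero[of \<theta>]] \<theta> by simp
  have conv: "convergent (?y s)" if s: "s \<in> {0..<real N}" for s
  proof (rule Cauchy_convergent, rule metric_CauchyI)
    fix e :: real assume e: "e > 0"
    have "eventually (\<lambda>n. 2 * C * \<theta> ^ n < e) sequentially"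
      using order_tendstoD(2)[OF small e] .
    then have "eventually (\<lambda>n. n \<ge> n0 \<and> 2 * C * \<theta> ^ n < e) sequentially"
      by (intro eventually_conj eventually_ge_at_top)
    then obtain n where n: "n \<ge> n0" "2 * C * \<theta> ^ n < e" by (auto simp: eventually_sequentially)
    show "\<exists>M. \<forall>m\<ge>M. \<forall>k\<ge>M. dist (?y s m) (?y s k) < e"
    proof (intro exI[of _ n] allI impI)
      fix m k assume "n \<le> m" "n \<le> k"
      then show "dist (?y s m) (?y s k) < e"
        using tele'[OF s n(1), of m] tele'[OF s n(1), of k] n(2) by (simp add: dist_real_def)
    qed
  qed
  define g where "g s = lim (?y s)" for s
  have g: "?y s \<longlonglongrightarrow> g s" if "s \<in> {0..<real N}" for s
    unfolding g_def using conv[OF that] by (simp add: convergent_LIMSEQ_iff)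
  have g_near: "\<bar>g s - ?y s n\<bar> \<le> C * \<theta> ^ n" if s: "s \<in> {0..<real N}" and n: "n \<ge> n0" for s n
  proof (rule LIMSEQ_le_const2)
    show "(\<lambda>m. \<bar>?y s m - ?y s n\<bar>) \<longlonglongrightarrow> \<bar>g s - ?y s n\<bar>" by (intro tendsto_intros g s)
    show "\<exists>k. \<forall>m\<ge>k. \<bar>?y s m - ?y s n\<bar> \<le> C * \<theta> ^ n" using tele'[OF s n] by blast
  qed
  have close: "\<bar>g s - g s'\<bar> \<le> (2 * C + 1) * \<theta> ^ n"
    if s: "s \<in> {0..<real N}" "s' \<in> {0..<real N}" "s \<le> s'" "s' - s < 1 / 2 ^ n" and n: "n \<ge> n0" for s s' n
  proof -
    obtain k where k: "dyadic_floor n s = real k / 2 ^ n" "k < N * 2 ^ n" "real k = of_int \<lfloor>2 ^ n * s\<rfloor>"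
      using dyadic_floor_nat[of s N n] s by auto
    obtain j where j: "dyadic_floor n s' = real j / 2 ^ n" "j < N * 2 ^ n" "real j = of_int \<lfloor>2 ^ n * s'\<rfloor>"
      using dyadic_floor_nat[of s' N n] s by auto
    have "2 ^ n * s' < 2 ^ n * s + 1" using s(4) by (simp add: field_simps)
    moreover have "2 ^ n * s \<le> 2 ^ n * s'" using s(3) by (intro mult_left_mono) auto
    moreover have "real k \<le> 2 ^ n * s" "2 ^ n * s < real k + 1" "real j \<le> 2 ^ n * s'" "2 ^ n * s' < real j + 1"
      unfolding k(3) j(3) by linarith+
    ultimately have "real j < real k + 2" "real k < real j + 1" by linarith+
    then have "j = k \<or> j = Suc k" by linarith
    then have "\<bar>?y s' n - ?y s n\<bar> \<le> \<theta> ^ n"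
      using inc[OF n k(2)] \<theta> by (auto simp: j(1) k(1))
    then show ?thesis
    proof -
      have "(2 * C + 1) * \<theta> ^ n = C * \<theta> ^ n + \<theta> ^ n + C * \<theta> ^ n" by (simp add: algebra_simps)
      with \<open>\<bar>?y s' n - ?y s n\<bar> \<le> \<theta> ^ n\<close> show ?thesis
        using g_near[OF s(1) n] g_near[OF s(2) n] by linarith
    qed
  qed
  have "continuous_on {0..<real N} g"
    unfolding continuous_on_iff
  proof (intro ballI allI impI)
    fix s e :: real assume s: "s \<in> {0..<real N}" and e: "0 < e"
    have "eventually (\<lambda>n. n \<ge> n0 \<and> (2 * C + 1) * \<theta> ^ n < e) sequentially"
      by (intro eventually_conj eventually_ge_at_top order_tendstoD(2)[OF small e])
    then obtain n where n: "n \<ge> n0" "(2 * C + 1) * \<theta> ^ n < e" by (auto simp: eventually_sequentially)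
    show "\<exists>d>0. \<forall>s'\<in>{0..<real N}. dist s' s < d \<longrightarrow> dist (g s') (g s) < e"
    proof (intro exI[of _ "1 / 2 ^ n"] conjI ballI impI)
      fix s' assume s': "s' \<in> {0..<real N}" "dist s' s < 1 / 2 ^ n"
      show "dist (g s') (g s) < e"
      proof (cases "s \<le> s'")
        case True
        then show ?thesis using close[OF s s'(1) True _ n(1)] s' n by (auto simp: dist_real_def)
      next
        case False
        then show ?thesis using close[OF s'(1) s _ _ n(1)] s' n by (auto simp: dist_real_def)
      qed
    qed simp
  qed
  with g show ?thesis by blast
qed

context prob_space begin

text \<open>
The base \<open>\<theta> = 2 powr (- 1 / (2 * m))\<close> satisfies \<open>\<theta> ^ (2 * m) = 1 / 2\<close>, so that Markov's inequality at the level
\<open>\<theta> ^ n\<close> loses exactly the factor \<open>2 ^ n\<close>.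
\<close>

lemma even_moment_tail:
  assumes [measurable]: "Y \<in> borel_measurable M" and m: "m > 0" and c: "c \<ge> 0"
    and Y: "(\<integral>\<^sup>+\<omega>. ennreal (Y \<omega> ^ (2 * m)) \<partial>M) \<le> ennreal c"
  shows "emeasure M {\<omega>\<in>space M. (2 powr (- 1 / (2 * real m))) ^ n < \<bar>Y \<omega>\<bar>} \<le> ennreal (2 ^ n * c)"
proof -
  let ?\<theta> = "2 powr (- 1 / (2 * real m))"
  have \<theta>: "?\<theta> ^ (2 * m) = 1 / 2"
  proof -
    have "?\<theta> ^ (2 * m) = 2 powr (- 1 / (2 * real m) * real (2 * m))"
      by (subst powr_power) (simp_all add: mult.commute)
    also have "- 1 / (2 * real m) * real (2 * m) = - 1" using m by simp
    finally show ?thesis by (simp add: powr_minus_divide)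
  qed
  have "{\<omega>\<in>space M. ?\<theta> ^ n < \<bar>Y \<omega>\<bar>} \<subseteq> {\<omega>\<in>space M. 1 \<le> ennreal (2 ^ n) * ennreal (Y \<omega> ^ (2 * m))}"
  proof safe
    fix \<omega> assume "?\<theta> ^ n < \<bar>Y \<omega>\<bar>"
    then have "(?\<theta> ^ n) ^ (2 * m) \<le> \<bar>Y \<omega>\<bar> ^ (2 * m)" by (intro power_mono) auto
    also have "(?\<theta> ^ n) ^ (2 * m) = (1 / 2) ^ n"
      by (subst \<theta>[symmetric]) (simp only: power_mult[symmetric] mult.commute)
    also have "\<bar>Y \<omega>\<bar> ^ (2 * m) = Y \<omega> ^ (2 * m)" by (simp add: power_even_abs)
    finally have "1 \<le> 2 ^ n * Y \<omega> ^ (2 * m)" by (simp add: power_one_over field_simps)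
    then show "1 \<le> ennreal (2 ^ n) * ennreal (Y \<omega> ^ (2 * m))"
      by (simp flip: ennreal_mult ennreal_1)
  qed
  then have "emeasure M {\<omega>\<in>space M. ?\<theta> ^ n < \<bar>Y \<omega>\<bar>}
      \<le> emeasure M {\<omega>\<in>space M. 1 \<le> ennreal (2 ^ n) * ennreal (Y \<omega> ^ (2 * m))}"
    by (rule emeasure_mono) measurable
  also have "\<dots> \<le> ennreal (2 ^ n) * (\<integral>\<^sup>+\<omega>. ennreal (Y \<omega> ^ (2 * m)) \<partial>M)"
  proof -
    have "(\<integral>\<^sup>+\<omega>. ennreal (Y \<omega> ^ (2 * m)) * indicator (space M) \<omega> \<partial>M) = (\<integral>\<^sup>+\<omega>. ennreal (Y \<omega> ^ (2 * m)) \<partial>M)"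
      by (rule nn_integral_cong) simp
    then show ?thesis
      using nn_integral_Markov_inequality[of "\<lambda>\<omega>. ennreal (Y \<omega> ^ (2 * m))" "space M" M "ennreal (2 ^ n)"]
          by simp
  qed
  also have "\<dots> \<le> ennreal (2 ^ n) * ennreal c" by (intro mult_left_mono Y) auto
  also have "\<dots> = ennreal (2 ^ n * c)" using c by (simp add: ennreal_mult)
  finally show ?thesis .
qed

lemma dyadic_tails_AE:
  assumes A [measurable]: "\<And>n. A n \<in> sets M"
    and le: "\<And>n. emeasure M (A n) \<le> ennreal (c * (1 / 2) ^ n)" and c: "c \<ge> 0"
  shows "AE \<omega> in M. eventually (\<lambda>n. \<omega> \<in> space M - A n) sequentially"
proof (rule borel_cantelli_AE1)
  have le': "measure M (A n) \<le> c * (1 / 2) ^ n" for n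
    using le[of n] c by (simp add: emeasure_eq_measure)
  show "summable (\<lambda>n. measure M (A n))"
    by (rule summable_comparison_test'[of "\<lambda>n. c * (1 / 2) ^ n" 0]) (use le' in auto)
qed (auto simp: less_top[symmetric])

text \<open>
The Kolmogorov-Chentsov criterion. There are about \<open>2 ^ n\<close> dyadic increments at level \<open>n\<close> and Markov's inequality
loses another \<open>2 ^ n\<close>; the third power of the time increment leaves a summable remainder. The conclusion is confined
to a countable set \<open>S\<close> of times: beyond that, the paths of \<open>X\<close> are arbitrary.
\<close>

lemma continuous_version:
  fixes X :: "real \<Rightarrow> 'a \<Rightarrow> real" and N m :: nat
  assumes X: "\<And>t. t \<ge> 0 \<Longrightarrow> X t \<in> borel_measurable M" and m: "m > 0" and C: "C \<ge> 0"
    and mom: "\<And>s t. 0 \<le> s \<Longrightarrow> s \<le> t \<Longrightarrow> t \<le> real N \<Longrightarrow> t - s \<le> 1 \<Longrightarrow>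
      (\<integral>\<^sup>+\<omega>. ennreal ((X t \<omega> - X s \<omega>) ^ (2 * m)) \<partial>M) \<le> ennreal (C * (t - s) ^ 3)"
    and S: "countable S"
  shows "AE \<omega> in M. \<exists>g. continuous_on {0..<real N} g \<and> (\<forall>s\<in>S \<inter> {0..<real N}. X s \<omega> = g s)"
proof -
  let ?\<theta> = "2 powr (- 1 / (2 * real m))"
  have "2 powr (- 1 / (2 * real m)) < 2 powr 0" using m by (subst powr_less_cancel_iff) auto
  then have \<theta>: "0 < ?\<theta>" "?\<theta> < 1" by simp_all
  let ?D = "\<lambda>n k. {\<omega>\<in>space M. ?\<theta> ^ n < \<bar>X (real (Suc k) / 2 ^ n) \<omega> - X (real k / 2 ^ n) \<omega>\<bar>}"
  let ?E = "\<lambda>n. \<Union>k<N * 2 ^ n. ?D n k"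
  have Dm: "?D n k \<in> sets M" for n k
  proof -
    note [measurable] = X[of "real (Suc k) / 2 ^ n"] X[of "real k / 2 ^ n"]
    show ?thesis by measurable
  qed
  have DP: "emeasure M (?D n k) \<le> ennreal (2 ^ n * (C * (1 / 2 ^ n) ^ 3))" if "k < N * 2 ^ n" for n k
  proof (rule even_moment_tail[OF _ m])
    have eq: "real (Suc k) / 2 ^ n - real k / 2 ^ n = 1 / 2 ^ n" by (simp add: field_simps)
    have "real (Suc k) \<le> real (N * 2 ^ n)" using that by linarith
    then have "real (Suc k) / 2 ^ n \<le> real N" by (simp add: field_simps)
    then show "(\<integral>\<^sup>+\<omega>. ennreal ((X (real (Suc k) / 2 ^ n) \<omega> - X (real k / 2 ^ n) \<omega>) ^ (2 * m)) \<partial>M)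
        \<le> ennreal (C * (1 / 2 ^ n) ^ 3)"
      using mom[of "real k / 2 ^ n" "real (Suc k) / 2 ^ n"] unfolding eq by (simp add: divide_right_mono)
    show "(\<lambda>\<omega>. X (real (Suc k) / 2 ^ n) \<omega> - X (real k / 2 ^ n) \<omega>) \<in> borel_measurable M"
      by (intro borel_measurable_diff X) auto
  qed (use C in simp)
  have "AE \<omega> in M. eventually (\<lambda>n. \<omega> \<in> space M - ?E n) sequentially"
  proof (rule dyadic_tails_AE)
    fix n
    have "emeasure M (?E n) \<le> (\<Sum>k<N * 2 ^ n. emeasure M (?D n k))"
      by (intro emeasure_subadditive_finite finite_lessThan image_subsetI Dm)
    also have "\<dots> \<le> (\<Sum>k<N * 2 ^ n. ennreal (2 ^ n * (C * (1 / 2 ^ n) ^ 3)))"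
      by (intro sum_mono DP) auto
    also have "\<dots> = ennreal (real (N * 2 ^ n) * (2 ^ n * (C * (1 / 2 ^ n) ^ 3)))"
      by (subst sum_ennreal) (use C in simp_all)
    also have "real (N * 2 ^ n) * (2 ^ n * (C * (1 / 2 ^ n) ^ 3)) = (real N * C) * (1 / 2) ^ n"
      by (simp add: power3_eq_cube power_one_over)
    finally show "emeasure M (?E n) \<le> ennreal ((real N * C) * (1 / 2) ^ n)" .
  next
    show "?E n \<in> sets M" for n by (intro sets.finite_UN finite_lessThan Dm)
  qed (use C in simp)
  moreover have "AE \<omega> in M. \<forall>s\<in>S \<inter> {0..<real N}. (\<lambda>n. X (dyadic_floor n s) \<omega>) \<longlonglongrightarrow> X s \<omega>"
  proof (subst AE_ball_countable)
    show "countable (S \<inter> {0..<real N})" using S by (rule countable_Int1)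
    show "\<forall>s\<in>S \<inter> {0..<real N}. AE \<omega> in M. (\<lambda>n. X (dyadic_floor n s) \<omega>) \<longlonglongrightarrow> X s \<omega>"
    proof
      fix s assume s: "s \<in> S \<inter> {0..<real N}"
      let ?F = "\<lambda>n. {\<omega>\<in>space M. ?\<theta> ^ n < \<bar>X s \<omega> - X (dyadic_floor n s) \<omega>\<bar>}"
      note b = dyadic_floor_bounds[where s = s] dyadic_floor_nonneg[of s]
      have [measurable]: "X s \<in> borel_measurable M"
        by (rule X) (use s in simp)
      have [measurable]: "X (dyadic_floor n s) \<in> borel_measurable M" for n
        by (rule X, rule dyadic_floor_nonneg) (use s in simp)
      have "AE \<omega> in M. eventually (\<lambda>n. \<omega> \<in> space M - ?F n) sequentially"
      proof (rule dyadic_tails_AE)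
        show "?F n \<in> sets M" for n by measurable
        fix n
        have d: "0 \<le> s - dyadic_floor n s" "s - dyadic_floor n s \<le> 1 / 2 ^ n" "1 / 2 ^ n \<le> (1 :: real)"
          using b(1,2)[of n] by simp_all
        have "(\<integral>\<^sup>+\<omega>. ennreal ((X s \<omega> - X (dyadic_floor n s) \<omega>) ^ (2 * m)) \<partial>M)
            \<le> ennreal (C * (s - dyadic_floor n s) ^ 3)"
          by (rule mom) (use s b(3)[of n] d order_trans[OF d(2,3)] in simp_all)
        also have "\<dots> \<le> ennreal (C * (1 / 2 ^ n) ^ 3)"
          using C d by (intro ennreal_leI mult_left_mono power_mono) auto
        finally have "emeasure M (?F n) \<le> ennreal (2 ^ n * (C * (1 / 2 ^ n) ^ 3))"
          by (intro even_moment_tail[OF _ m] borel_measurable_diff) (use C in simp_all)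
        also have "\<dots> \<le> ennreal (C * (1 / 2) ^ n)"
        proof (rule ennreal_leI)
          have "2 ^ n * (C * (1 / 2 ^ n) ^ 3) = (C * (1 / 2) ^ n) * (1 / 2) ^ n"
            by (simp add: power3_eq_cube power_one_over)
          also have "\<dots> \<le> (C * (1 / 2) ^ n) * 1"
            using C by (intro mult_left_mono power_le_one) auto
          finally show "2 ^ n * (C * (1 / 2 ^ n) ^ 3) \<le> C * (1 / 2) ^ n" by simp
        qed
        finally show "emeasure M (?F n) \<le> ennreal (C * (1 / 2) ^ n)" .
      qed (rule C)
      then show "AE \<omega> in M. (\<lambda>n. X (dyadic_floor n s) \<omega>) \<longlonglongrightarrow> X s \<omega>"
      proof eventually_elim
        case (elim \<omega>)
        then have "eventually (\<lambda>n. norm (X (dyadic_floor n s) \<omega> - X s \<omega>) \<le> ?\<theta> ^ n) sequentially"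
          by eventually_elim (auto simp: abs_minus_commute)
        moreover have "(\<lambda>n. ?\<theta> ^ n) \<longlonglongrightarrow> 0" using \<theta> by (intro LIMSEQ_realpow_zero) auto
        ultimately have "(\<lambda>n. X (dyadic_floor n s) \<omega> - X s \<omega>) \<longlonglongrightarrow> 0"
          by (rule Lim_null_comparison)
        then show ?case by (simp add: LIM_zero_iff)
      qed
    qed
  qed
  ultimately show ?thesis
  proof eventually_elim
    case (elim \<omega>)
    then obtain n0 where n0: "\<And>n. n \<ge> n0 \<Longrightarrow> \<omega> \<in> space M - ?E n" by (auto simp: eventually_sequentially)
    have "\<exists>g. continuous_on {0..<real N} g \<and> (\<forall>s\<in>{0..<real N}. (\<lambda>n. X (dyadic_floor n s) \<omega>) \<longlonglongrightarrow> g s)"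
    proof (rule dyadic_chaining[OF \<theta>])
      fix n k :: nat assume "n \<ge> n0" "k < N * 2 ^ n"
      with n0[of n] have "\<omega> \<in> space M" "\<omega> \<notin> ?D n k" by blast+
      then show "\<bar>X (real (Suc k) / 2 ^ n) \<omega> - X (real k / 2 ^ n) \<omega>\<bar> \<le> ?\<theta> ^ n"
        by (simp only: mem_Collect_eq not_less simp_thms)
    qed
    then show ?case using elim(2) LIMSEQ_unique by blast
  qed
qed

end

text \<open>
Separability with the closed set \<open>cball (g s) e\<close>: near \<open>s\<close> the values on \<open>S\<close> lie in it by the continuity of \<open>g\<close>,
hence so does \<open>x s\<close>.
\<close>

lemma separable_path_eq:
  fixes x g :: "real \<Rightarrow> real"
  assumes sep: "\<And>a b K. closed K \<Longrightarrow> \<forall>s\<in>S \<inter> {a<..<b}. x s \<in> K \<Longrightarrow> \<forall>s\<in>{0..} \<inter> {a<..<b}. x s \<in> K"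
    and S: "S \<subseteq> {0..}" and g: "continuous_on {0..<R} g" and eq: "\<And>s. s \<in> S \<Longrightarrow> s < R \<Longrightarrow> x s = g s"
    and s: "0 \<le> s" "s < R"
  shows "x s = g s"
proof -
  have "dist (x s) (g s) \<le> e" if e: "e > 0" for e
  proof -
    obtain d where d: "d > 0" "\<And>r. r \<in> {0..<R} \<Longrightarrow> dist r s < d \<Longrightarrow> dist (g r) (g s) < e"
    proof -
      have "\<exists>d>0. \<forall>r\<in>{0..<R}. dist r s < d \<longrightarrow> dist (g r) (g s) < e"
        using g s e unfolding continuous_on_iff by simp
      then show ?thesis using that by blast
    qed
    have "x s \<in> cball (g s) e"
    proof (rule bspec[OF sep[of "cball (g s) e" "s - d" "min (s + d) R"]])
      show "\<forall>r\<in>S \<inter> {s - d<..<min (s + d) R}. x r \<in> cball (g s) e"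
        using d(2) S eq by (auto simp: dist_real_def subset_eq abs_less_iff less_imp_le)
      show "s \<in> {0..} \<inter> {s - d<..<min (s + d) R}" using s d(1) by auto
    qed simp
    then show ?thesis by (simp add: dist_commute)
  qed
  then have "dist (x s) (g s) \<le> 0" by (rule dense_ge)
  then show ?thesis by simp
qed

section \<open>Moments of occupation integrals\<close>

text \<open>
This is the formula for the derivative of \<open>\<Phi> ^ Suc n\<close>, where \<open>\<Phi> s\<close> is the integral over \<open>(s, b]\<close>, stated without
differentiation. In the induction step Fubini's theorem turns the integral \<open>I\<close> for \<open>Suc n\<close> into one with the
factor \<open>\<Phi> s - \<Phi> q\<close>; moving the subtracted part to the other side gives \<open>(n + 2) * I = \<Phi> s ^ (n + 2)\<close>.
\<close>

lemma occupation_integral_power: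
  fixes \<phi> :: "real \<Rightarrow> ennreal" and b :: real
  assumes [measurable]: "\<phi> \<in> borel_measurable borel"
  defines "\<Phi> \<equiv> \<lambda>s. time_integral s b \<phi>"
  shows "\<Phi> s ^ Suc n = of_nat (Suc n) * time_integral s b (\<lambda>r. \<phi> r * \<Phi> r ^ n)"
proof (induction n arbitrary: s)
  case 0
  show ?case by (simp cong: if_cong) (simp add: \<Phi>_def)
next
  case (Suc n)
  have \<Phi> [measurable]: "\<Phi> \<in> borel_measurable borel"
    unfolding \<Phi>_def by measurable
  let ?I = "\<lambda>n. time_integral s b (\<lambda>r. \<phi> r * \<Phi> r ^ n)"
  let ?c = "of_nat (Suc n) :: ennreal"
  let ?J = "\<lambda>q. time_integral s q \<phi>"
  let ?F = "\<lambda>r q. if s < r \<and> r < q \<and> q \<le> b then ?c * (\<phi> r * (\<phi> q * \<Phi> q ^ n)) else 0"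
  let ?G = "\<lambda>q. \<phi> q * \<Phi> q ^ n * ?J q"
  have "?I (Suc n) = (\<integral>\<^sup>+r. \<integral>\<^sup>+q. ?F r q \<partial>lborel \<partial>lborel)"
  proof (rule nn_integral_cong)
    fix r
    have "\<phi> r * \<Phi> r ^ Suc n = (\<integral>\<^sup>+q. ?c * \<phi> r * (if r < q \<and> q \<le> b then \<phi> q * \<Phi> q ^ n else 0) \<partial>lborel)"
      unfolding Suc by (subst nn_integral_cmult) (auto simp: mult_ac)
    moreover have "?F r q
        = (if s < r \<and> r \<le> b then ?c * \<phi> r * (if r < q \<and> q \<le> b then \<phi> q * \<Phi> q ^ n else 0) else 0)" for q
      by (simp add: mult.assoc)
    ultimately show "(if s < r \<and> r \<le> b then \<phi> r * \<Phi> r ^ Suc n else 0)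
        = (\<integral>\<^sup>+q. ?F r q \<partial>lborel)"
      by (cases "s < r \<and> r \<le> b") (simp_all only: simp_thms if_True if_False nn_integral_const mult_zero_left)
  qed
  also have "\<dots> = (\<integral>\<^sup>+q. \<integral>\<^sup>+r. ?F r q \<partial>lborel \<partial>lborel)"
    by (rule lborel_pair.Fubini') measurable
  also have "\<dots> = (\<integral>\<^sup>+q. ?c * (if s < q \<and> q \<le> b then ?G q else 0) \<partial>lborel)"
  proof (rule nn_integral_cong)
    fix q
    have "(\<integral>\<^sup>+r. ?F r q \<partial>lborel)
        = (\<integral>\<^sup>+r. (if q \<le> b then ?c * (\<phi> q * \<Phi> q ^ n) else 0) * (if s < r \<and> r \<le> q then \<phi> r else 0) \<partial>lborel)"
      by (rule nn_integral_cong_AE, use AE_lborel_singleton[of q] in eventually_elim) (auto simp: mult_ac)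
    also have "\<dots> = (if q \<le> b then ?c * (\<phi> q * \<Phi> q ^ n) else 0) * ?J q"
      by (rule nn_integral_cmult) measurable
    also have "\<dots> = ?c * (if s < q \<and> q \<le> b then ?G q else 0)"
    proof (cases "s < q")
      case False
      then have "?J q = 0" by (intro nn_integral_zero' AE_I2) auto
      then show ?thesis using False by simp
    qed (auto simp: mult_ac)
    finally show "(\<integral>\<^sup>+r. ?F r q \<partial>lborel)
        = ?c * (if s < q \<and> q \<le> b then ?G q else 0)" .
  qed
  also have "\<dots> = ?c * time_integral s b ?G"
    by (rule nn_integral_cmult) measurable
  finally have 1: "?I (Suc n) = ?c * time_integral s b ?G" .
  have split: "?J q + \<Phi> q = \<Phi> s" if "s < q" "q \<le> b" for q
    unfolding \<Phi>_def using that
    by (subst nn_integral_add[symmetric]) (auto intro!: nn_integral_cong)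
  have "of_nat (Suc (Suc n)) * ?I (Suc n) = ?I (Suc n) + ?c * ?I (Suc n)"
    by (simp add: algebra_simps)
  also have "\<dots> = ?c * (time_integral s b ?G + ?I (Suc n))"
    unfolding 1[symmetric] by (subst 1) (simp add: distrib_left)
  also have "time_integral s b ?G + ?I (Suc n)
      = (\<integral>\<^sup>+q. \<Phi> s * (if s < q \<and> q \<le> b then \<phi> q * \<Phi> q ^ n else 0) \<partial>lborel)"
    by (subst nn_integral_add[symmetric])
       (auto intro!: nn_integral_cong simp: split[symmetric] algebra_simps)
  also have "\<dots> = \<Phi> s * ?I n" by (rule nn_integral_cmult) measurable
  also have "?c * (\<Phi> s * ?I n) = \<Phi> s * \<Phi> s ^ Suc n" unfolding Suc[of s] by (simp only: mult_ac)
  finally show ?case by simp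
qed

lemma occupation_integral_measurable:
  fixes b :: real
  assumes [measurable]: "\<phi> \<in> borel_measurable (borel \<Otimes>\<^sub>M M)"
  shows "(\<lambda>x. time_integral (fst x) b (\<lambda>r. \<phi> (r, snd x)))
    \<in> borel_measurable (borel \<Otimes>\<^sub>M M)"
  by measurable

text \<open>
Moments of an occupation integral under a bound \<open>\<kappa> s r\<close> on the conditional intensity of \<open>\<phi>\<close> at time \<open>r\<close> given the
information \<open>F s\<close>, in the manner of Khasminskii's lemma. The weight \<open>Z\<close> carries the induction: after the
expansion by \<open>occupation_integral_power\<close>, the earliest factor \<open>\<phi> (r, \<omega>)\<close> joins the weight and the remaining power
starts afresh at time \<open>r\<close>. The rate \<open>\<theta>\<close> is free; the exponential weight makes the time integrals factorize, in
place of an integral over the simplex of ordered times.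
\<close>

lemma occupation_moment_bound:
  fixes \<phi> :: "real \<times> 'a \<Rightarrow> ennreal" and F :: "real \<Rightarrow> 'a measure" and \<kappa> :: "real \<Rightarrow> real \<Rightarrow> ennreal"
  assumes M: "sigma_finite_measure M" and \<theta>: "\<theta> \<ge> 0"
    and \<phi> [measurable]: "\<phi> \<in> borel_measurable (borel \<Otimes>\<^sub>M M)"
    and F_space: "\<And>r. space (F r) = space M" and F_sub: "\<And>r. sets (F r) \<subseteq> sets M"
    and F_mono: "\<And>s r. s \<le> r \<Longrightarrow> sets (F s) \<subseteq> sets (F r)"
    and adapted: "\<And>r. t < r \<Longrightarrow> r \<le> b \<Longrightarrow> \<exists>\<phi>'\<in>borel_measurable (F r). AE \<omega> in M. \<phi> (r, \<omega>) = \<phi>' \<omega>"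
    and cond: "\<And>s r Z. t \<le> s \<Longrightarrow> s < r \<Longrightarrow> r \<le> b \<Longrightarrow> Z \<in> borel_measurable (F s) \<Longrightarrow>
      (\<integral>\<^sup>+\<omega>. Z \<omega> * \<phi> (r, \<omega>) \<partial>M) \<le> \<kappa> s r * (\<integral>\<^sup>+\<omega>. Z \<omega> \<partial>M)"
    and \<kappa>: "\<And>s. \<kappa> s \<in> borel_measurable borel"
    and kernel: "\<And>s. t \<le> s \<Longrightarrow> s \<le> b \<Longrightarrow>
      time_integral s b (\<lambda>r. \<kappa> s r * ennreal (exp (- \<theta> * (r - s)))) \<le> K"
    and s: "t \<le> s" "s \<le> b" and Z: "Z \<in> borel_measurable (F s)"
  shows "(\<integral>\<^sup>+\<omega>. Z \<omega> * time_integral s b (\<lambda>r. \<phi> (r, \<omega>)) ^ n \<partial>M)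
    \<le> fact n * K ^ n * ennreal (exp (\<theta> * (b - s))) * (\<integral>\<^sup>+\<omega>. Z \<omega> \<partial>M)"
  using s Z
proof (induction n arbitrary: s Z)
  case 0
  have "1 * (\<integral>\<^sup>+\<omega>. Z \<omega> \<partial>M) \<le> ennreal (exp (\<theta> * (b - s))) * (\<integral>\<^sup>+\<omega>. Z \<omega> \<partial>M)"
    using \<theta> 0 by (intro mult_right_mono) (simp_all add: one_le_exp_iff)
  then show ?case by simp
next
  case (Suc n)
  interpret M: sigma_finite_measure M by fact
  interpret P: pair_sigma_finite lborel M by unfold_locales
  have F_M: "f \<in> borel_measurable M" if "f \<in> borel_measurable (F r)" for f :: "'a \<Rightarrow> ennreal" and r
    using that F_sub[of r] unfolding measurable_def F_space by blast
  have F_F: "f \<in> borel_measurable (F r)" if "f \<in> borel_measurable (F q)" "q \<le> r" for f :: "'a \<Rightarrow> ennreal" and q r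
    using that F_mono[of q r] unfolding measurable_def F_space by blast
  note [measurable] = F_M[OF Suc.prems(3)]
  have \<phi>1: "(\<lambda>r. \<phi> (r, \<omega>)) \<in> borel_measurable borel" if "\<omega> \<in> space M" for \<omega>
    using measurable_compose[OF measurable_Pair2'[OF that, of borel] \<phi>] by simp
  let ?A = "\<lambda>s \<omega>. time_integral s b (\<lambda>r. \<phi> (r, \<omega>))"
  note A [measurable] = occupation_integral_measurable[OF \<phi>, of b]
  note [measurable] = \<kappa>[of s]
  let ?e = "ennreal (exp (\<theta> * (b - s)))" and ?EZ = "\<integral>\<^sup>+\<omega>. Z \<omega> \<partial>M"
  let ?w = "\<lambda>r. \<kappa> s r * ennreal (exp (- \<theta> * (r - s)))"
  let ?X = "\<lambda>r \<omega>. Z \<omega> * (\<phi> (r, \<omega>) * ?A r \<omega> ^ n)" and ?C = "fact n * K ^ n * ?e * ?EZ"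
  let ?Y = "\<lambda>r \<omega>. if s < r \<and> r \<le> b then ?X r \<omega> else 0"
  have step: "(\<integral>\<^sup>+\<omega>. ?X r \<omega> \<partial>M) \<le> ?C * ?w r"
    if r: "s < r" "r \<le> b" for r
  proof -
    obtain \<phi>' where \<phi>': "\<phi>' \<in> borel_measurable (F r)" "AE \<omega> in M. \<phi> (r, \<omega>) = \<phi>' \<omega>"
      using adapted[OF le_less_trans[OF Suc.prems(1) r(1)] r(2)] by blast
    have "(\<integral>\<^sup>+\<omega>. ?X r \<omega> \<partial>M) = (\<integral>\<^sup>+\<omega>. (Z \<omega> * \<phi>' \<omega>) * ?A r \<omega> ^ n \<partial>M)"
      by (rule nn_integral_cong_AE, use \<phi>'(2) in eventually_elim) (simp add: mult.assoc)
    also have "\<dots> \<le> fact n * K ^ n * ennreal (exp (\<theta> * (b - r))) * (\<integral>\<^sup>+\<omega>. Z \<omega> * \<phi>' \<omega> \<partial>M)"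
      by (rule Suc.IH) (use r Suc.prems(1) in \<open>auto intro!: borel_measurable_times_ennreal F_F[OF Suc.prems(3)] \<phi>'(1)\<close>)
    also have "(\<integral>\<^sup>+\<omega>. Z \<omega> * \<phi>' \<omega> \<partial>M) = (\<integral>\<^sup>+\<omega>. Z \<omega> * \<phi> (r, \<omega>) \<partial>M)"
      by (rule nn_integral_cong_AE, use \<phi>'(2) in eventually_elim) simp
    also have "fact n * K ^ n * ennreal (exp (\<theta> * (b - r))) * (\<integral>\<^sup>+\<omega>. Z \<omega> * \<phi> (r, \<omega>) \<partial>M)
        \<le> fact n * K ^ n * ennreal (exp (\<theta> * (b - r))) * (\<kappa> s r * ?EZ)"
      using r Suc.prems by (intro mult_left_mono cond) auto
    also have "ennreal (exp (\<theta> * (b - r))) = ?e * ennreal (exp (- \<theta> * (r - s)))"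
      by (simp flip: ennreal_mult exp_add) (simp add: algebra_simps)
    finally show ?thesis by (simp only: mult_ac)
  qed
  have "(\<integral>\<^sup>+\<omega>. Z \<omega> * ?A s \<omega> ^ Suc n \<partial>M)
      = (\<integral>\<^sup>+\<omega>. \<integral>\<^sup>+r. of_nat (Suc n) * ?Y r \<omega> \<partial>lborel \<partial>M)"
  proof (rule nn_integral_cong)
    fix \<omega> assume \<omega>: "\<omega> \<in> space M"
    note [measurable] = \<phi>1[OF \<omega>]
    have "Z \<omega> * ?A s \<omega> ^ Suc n
        = (of_nat (Suc n) * Z \<omega>) * time_integral s b (\<lambda>r. \<phi> (r, \<omega>) * ?A r \<omega> ^ n)"
      by (subst occupation_integral_power[OF \<phi>1[OF \<omega>]]) (simp only: mult_ac)
    also have "\<dots> = (\<integral>\<^sup>+r. (of_nat (Suc n) * Z \<omega>) * (if s < r \<and> r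
        \<le> b then \<phi> (r, \<omega>) * ?A r \<omega> ^ n else 0) \<partial>lborel)"
      by (rule nn_integral_cmult[symmetric]) measurable
    also have "\<dots> = (\<integral>\<^sup>+r. of_nat (Suc n) * ?Y r \<omega> \<partial>lborel)"
      by (intro nn_integral_cong) (simp add: mult_ac)
    finally show "Z \<omega> * ?A s \<omega> ^ Suc n
        = (\<integral>\<^sup>+r. of_nat (Suc n) * ?Y r \<omega> \<partial>lborel)" .
  qed
  also have "\<dots> = (\<integral>\<^sup>+r. \<integral>\<^sup>+\<omega>. of_nat (Suc n) * ?Y r \<omega> \<partial>M \<partial>lborel)"
    by (rule P.Fubini') measurable
  also have "\<dots> \<le> (\<integral>\<^sup>+r. (of_nat (Suc n) * ?C) * (if s < r \<and> r \<le> b then ?w r else 0) \<partial>lborel)"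
  proof (rule nn_integral_mono)
    fix r
    have "(\<integral>\<^sup>+\<omega>. of_nat (Suc n) * ?X r \<omega> \<partial>M)
        = of_nat (Suc n) * (\<integral>\<^sup>+\<omega>. ?X r \<omega> \<partial>M)"
      by (rule nn_integral_cmult) measurable
    then show "(\<integral>\<^sup>+\<omega>. of_nat (Suc n) * ?Y r \<omega> \<partial>M)
        \<le> (of_nat (Suc n) * ?C) * (if s < r \<and> r \<le> b then ?w r else 0)"
      using step[of r] by (auto simp: mult.assoc intro!: mult_left_mono)
  qed
  also have "\<dots> = (of_nat (Suc n) * ?C) * time_integral s b ?w"
    by (rule nn_integral_cmult) measurable
  also have "\<dots> \<le> (of_nat (Suc n) * ?C) * K"
    using Suc.prems by (intro mult_left_mono kernel) auto
  also have "\<dots> = fact (Suc n) * K ^ Suc n * ?e * ?EZ"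
    unfolding fact_Suc power_Suc by (simp only: mult_ac)
  finally show ?case .
qed

text \<open>
The singularity is integrated up to \<open>1 / \<theta>\<close>; beyond that point the power is at most \<open>\<theta> powr h\<close> and the exponential
is integrated. This replaces the Gamma integral by an explicit constant.
\<close>

lemma exp_power_kernel_bound:
  fixes h \<theta> s b :: real
  assumes h: "0 \<le> h" "h < 1" and \<theta>: "0 < \<theta>"
  shows "time_integral s b (\<lambda>r. ennreal ((r - s) powr (- h)) * ennreal (exp (- \<theta> * (r - s))))
    \<le> ennreal ((1 / (1 - h) + 1) * \<theta> powr (h - 1))"
proof -
  let ?f = "\<lambda>v. ennreal (v powr (- h)) * indicator {0..1 / \<theta>} v
    + ennreal (\<theta> powr h) * (ennreal (exp (- \<theta> * v)) * indicator {0..} v)"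
  have "time_integral s b (\<lambda>r. ennreal ((r - s) powr (- h)) * ennreal (exp (- \<theta> * (r - s))))
      \<le> (\<integral>\<^sup>+r. ?f (- s + r) \<partial>lborel)"
  proof (rule nn_integral_mono)
    fix r
    have "ennreal (x powr (- h)) * ennreal (exp (- \<theta> * x)) \<le> ?f x" if x: "0 < x" for x
    proof (cases "x \<le> 1 / \<theta>")
      case True
      have "x powr (- h) * exp (- \<theta> * x) \<le> x powr (- h) * 1"
        using x \<theta> by (intro mult_left_mono) auto
      then have "ennreal (x powr (- h)) * ennreal (exp (- \<theta> * x)) \<le> ennreal (x powr (- h))"
        by (simp add: ennreal_leI flip: ennreal_mult)
      also have "\<dots> \<le> ?f x" using True x by simp
      finally show ?thesis .
    next
      case False
      have "x powr (- h) \<le> (1 / \<theta>) powr (- h)" using False x h \<theta> by (intro powr_mono2') auto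
      also have "\<dots> = \<theta> powr h" using \<theta> by (simp add: powr_minus powr_divide)
      finally have "ennreal (x powr (- h)) * ennreal (exp (- \<theta> * x))
          \<le> ennreal (\<theta> powr h) * ennreal (exp (- \<theta> * x))"
        by (intro mult_right_mono ennreal_leI) auto
      also have "\<dots> \<le> ?f x" using x by simp
      finally show ?thesis .
    qed
    from this[of "r - s"] show "(if s < r \<and> r
        \<le> b then ennreal ((r - s) powr (- h)) * ennreal (exp (- \<theta> * (r - s))) else 0) \<le> ?f (- s + r)"
      by simp
  qed
  also have "\<dots> = (\<integral>\<^sup>+v. ?f v \<partial>lborel)"
    by (rule nn_integral_translate) measurable
  also have "\<dots> = (\<integral>\<^sup>+v. ennreal (v powr (- h)) * indicator {0..1 / \<theta>} v \<partial>lborel)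
      + ennreal (\<theta> powr h) * (\<integral>\<^sup>+v. ennreal (exp (- \<theta> * v)) * indicator {0..} v \<partial>lborel)"
    by (simp add: nn_integral_add nn_integral_cmult)
  also have "(\<integral>\<^sup>+v. ennreal (v powr (- h)) * indicator {0..1 / \<theta>} v \<partial>lborel)
      = ennreal ((1 / \<theta>) powr (- h + 1) / (- h + 1))"
    using h \<theta> by (intro nn_integral_powr_from_0) auto
  also have "(\<integral>\<^sup>+v. ennreal (exp (- \<theta> * v)) * indicator {0..} v \<partial>lborel) = ennreal (exp (- \<theta> * 0) / \<theta>)"
    by (rule nn_integral_has_integral_lebesgue') (use has_integral_exp_minus_to_infinity[OF \<theta>, of 0] in auto)
  also have "ennreal ((1 / \<theta>) powr (- h + 1) / (- h + 1)) + ennreal (\<theta> powr h) * ennreal (exp (- \<theta> * 0) / \<theta>)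
      = ennreal ((1 / \<theta>) powr (- h + 1) / (- h + 1) + \<theta> powr h * (1 / \<theta>))"
    using h \<theta> by (subst ennreal_plus) (auto simp: ennreal_mult[symmetric])
  also have "(1 / \<theta>) powr (- h + 1) / (- h + 1) + \<theta> powr h * (1 / \<theta>) = (1 / (1 - h) + 1) * \<theta> powr (h - 1)"
  proof -
    have "(1 / \<theta>) powr (- h + 1) = \<theta> powr (h - 1)"
      using \<theta> by (simp add: powr_divide powr_minus_divide[symmetric])
    moreover have "\<theta> powr h * (1 / \<theta>) = \<theta> powr (h - 1)" using \<theta> by (simp add: powr_diff)
    ultimately show ?thesis by (simp add: distrib_right)
  qed
  finally show ?thesis .
qed

section \<open>Local times as limits of window averages\<close>

lemma average_tendsto:
  fixes g :: "real \<Rightarrow> real"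
  assumes g: "isCont g y" and pos: "\<And>z. 0 \<le> g z" and [measurable]: "g \<in> borel_measurable borel"
    and \<epsilon>: "\<And>j::nat. 0 < \<epsilon> j" "\<epsilon> \<longlonglongrightarrow> 0"
  shows "(\<lambda>j. ennreal (1 / (2 * \<epsilon> j)) * (\<integral>\<^sup>+z. ennreal (g z) * indicator (window y
      (\<epsilon> j)) z \<partial>lborel)) \<longlonglongrightarrow> ennreal (g y)"
proof -
  let ?I = "\<lambda>j. ennreal (1 / (2 * \<epsilon> j)) * (\<integral>\<^sup>+z. ennreal (g z) * indicator (window y (\<epsilon> j)) z \<partial>lborel)"
  have const: "ennreal (1 / (2 * \<epsilon> j)) * (\<integral>\<^sup>+z. ennreal c * indicator (window y (\<epsilon> j)) z \<partial>lborel) = ennreal c"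
    if "0 \<le> c" for c j
    using \<epsilon>(1)[of j] that by (simp add: nn_integral_cmult flip: ennreal_mult)
  have near: "eventually (\<lambda>j. ennreal (g y - e) \<le> ?I j \<and> ?I j \<le> ennreal (g y + e)) sequentially"
      if e: "0 < e" for e
  proof -
    obtain d where d: "d > 0" "\<And>z. \<bar>z - y\<bar> < d \<Longrightarrow> \<bar>g z - g y\<bar> < e"
      using g e unfolding continuous_at_eps_delta dist_real_def by metis
    have "eventually (\<lambda>j. \<epsilon> j < d) sequentially" using order_tendstoD(2)[OF \<epsilon>(2) d(1)] .
    then show ?thesis
    proof eventually_elim
      case (elim j)
      have z: "g y - e \<le> g z" "g z \<le> g y + e" if "z \<in> window y (\<epsilon> j)" for z
        using d(2)[of z] that elim by (auto simp: abs_less_iff)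
      have "ennreal (g y - e) = ennreal (max 0 (g y - e))" by (simp add: max_def ennreal_neg)
      also have "\<dots> = ennreal (1 / (2 * \<epsilon> j)) * (\<integral>\<^sup>+z. ennreal (max 0 (g y - e)) * indicator (window y
          (\<epsilon> j)) z \<partial>lborel)"
        by (subst const) auto
      also have "\<dots> \<le> ?I j"
        by (intro mult_left_mono nn_integral_mono) (auto simp: indicator_def pos intro!: ennreal_leI z)
      finally have 1: "ennreal (g y - e) \<le> ?I j" .
      have "?I j \<le> ennreal (1 / (2 * \<epsilon> j)) * (\<integral>\<^sup>+z. ennreal (g y + e) * indicator (window y (\<epsilon> j)) z \<partial>lborel)"
        by (intro mult_left_mono nn_integral_mono) (auto simp: indicator_def intro!: ennreal_leI z)
      also have "\<dots> = ennreal (g y + e)" using pos[of y] e by (intro const) simp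
      finally show ?case using 1 by simp
    qed
  qed
  show ?thesis
  proof (rule order_tendstoI)
    fix a assume a: "a < ennreal (g y)"
    then obtain r where r: "0 \<le> r" "a < ennreal r" "ennreal r < ennreal (g y)"
      using dense[OF a] by (metis ennreal_cases infinity_ennreal_def not_less_iff_gr_or_eq top_greatest top.not_eq_extremum)
    then have "r < g y" using r by (simp add: ennreal_less_iff)
    then show "eventually (\<lambda>j. a < ?I j) sequentially"
      using near[of "g y - r"] r(2) by (auto elim!: eventually_mono intro: less_le_trans)
  next
    fix a assume a: "ennreal (g y) < a"
    obtain r where r: "0 \<le> r" "ennreal r < a" "ennreal (g y) < ennreal r"
      using dense[OF a] by (metis ennreal_cases infinity_ennreal_def not_less_iff_gr_or_eq top_greatest top.not_eq_extremum)
    then have "g y < r" using pos[of y] by (simp add: ennreal_less_iff)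
    then show "eventually (\<lambda>j. ?I j < a) sequentially"
      using near[of "r - g y"] r(2) by (auto elim!: eventually_mono intro: le_less_trans)
  qed
qed

lemma occupation_of_window:
  fixes x :: "real \<Rightarrow> real"
  assumes x: "x \<in> borel_measurable (restrict_space borel {0..})"
    and D: "D \<in> sets borel" and t: "0 \<le> t" "t \<le> b"
  shows "emeasure lborel {r \<in> {0..b}. x r \<in> D}
    = emeasure lborel {r \<in> {0..t}. x r \<in> D} + time_integral t b (\<lambda>r. indicator D (x r))"
proof -
  have meas: "{r \<in> A. x r \<in> D} \<in> sets borel" if "A \<in> sets borel" "A \<subseteq> {0..}" for A
  proof -
    have "x -` D \<inter> {0..} \<in> sets (restrict_space borel {0..})"
      using measurable_sets[OF x D] by (simp add: space_restrict_space)
    then have "x -` D \<inter> {0..} \<in> sets borel" by (subst (asm) sets_restrict_space_iff) auto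
    then have "(x -` D \<inter> {0..}) \<inter> A \<in> sets borel" using that by blast
    moreover have "(x -` D \<inter> {0..}) \<inter> A = {r \<in> A. x r \<in> D}" using that by auto
    ultimately show ?thesis by simp
  qed
  have un: "{r \<in> {0..b}. x r \<in> D} = {r \<in> {0..t}. x r \<in> D} \<union> {r \<in> {t<..b}. x r \<in> D}" using t by auto
  have "emeasure lborel {r \<in> {0..b}. x r \<in> D}
      = emeasure lborel {r \<in> {0..t}. x r \<in> D} + emeasure lborel {r \<in> {t<..b}. x r \<in> D}"
    unfolding un
  proof (rule plus_emeasure[symmetric])
    show "{r \<in> {0..t}. x r \<in> D} \<in> sets lborel" using meas[of "{0..t}"] by simp
    show "{r \<in> {t<..b}. x r \<in> D} \<in> sets lborel" using meas[of "{t<..b}"] t by force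
  qed auto
  also have "emeasure lborel {r \<in> {t<..b}. x r \<in> D} = (\<integral>\<^sup>+r. indicator {r \<in> {t<..b}. x r \<in> D} r \<partial>lborel)"
    using meas[of "{t<..b}"] t by (subst nn_integral_indicator) force+
  also have "\<dots> = time_integral t b (\<lambda>r. indicator D (x r))"
    by (intro nn_integral_cong) (auto simp: indicator_def)
  finally show ?thesis .
qed

text \<open>
An occupation density that is continuous at the level \<open>y\<close> is recovered from averages over shrinking windows; the
difference of two such limits is the limit for the time interval \<open>(t, b]\<close>.
\<close>

lemma local_time_increment_tendsto:
  fixes x :: "real \<Rightarrow> real" and l :: "real \<Rightarrow> real \<Rightarrow> real"
  assumes x: "x \<in> borel_measurable (restrict_space borel {0..})"
    and l_meas: "\<And>t. 0 \<le> t \<Longrightarrow> l t \<in> borel_measurable borel" and l_pos: "\<And>t z. 0 \<le> l t z"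
    and l_cont: "\<And>t. 0 \<le> t \<Longrightarrow> isCont (l t) y"
    and occ: "\<And>t D. 0 \<le> t \<Longrightarrow> D \<in> sets borel \<Longrightarrow>
      emeasure lborel {r \<in> {0..t}. x r \<in> D} = (\<integral>\<^sup>+z. ennreal (l t z) * indicator D z \<partial>lborel)"
    and t: "0 \<le> t" "t \<le> b" and \<epsilon>: "\<And>j::nat. 0 < \<epsilon> j" "\<epsilon> \<longlonglongrightarrow> 0"
  shows "(\<lambda>j. time_integral t b (\<lambda>r. ennreal (1 / (2 * \<epsilon> j)) * indicator (window y (\<epsilon> j)) (x r)))
      \<longlonglongrightarrow> ennreal (l b y - l t y)"
    and "l t y \<le> l b y"
proof -
  let ?D = "\<lambda>j. window y (\<epsilon> j)" and ?c = "\<lambda>j. ennreal (1 / (2 * \<epsilon> j))"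
  let ?O = "\<lambda>t j. ?c j * emeasure lborel {r \<in> {0..t}. x r \<in> ?D j}"
  let ?A = "\<lambda>j. ?c j * time_integral t b (\<lambda>r. indicator (?D j) (x r))"
  have lim: "?O t \<longlonglongrightarrow> ennreal (l t y)" if "0 \<le> t" for t
  proof -
    have "?O t j = ?c j * (\<integral>\<^sup>+z. ennreal (l t z) * indicator (?D j) z \<partial>lborel)" for j
      by (subst occ[OF that]) simp_all
    then show ?thesis using average_tendsto[OF l_cont l_pos l_meas \<epsilon>, of t] that by (simp only:)
  qed
  have split: "?O b j = ?O t j + ?A j" for j
    using occupation_of_window[OF x _ t, of "?D j"] by (simp add: distrib_left)
  have le: "?O t j \<le> ?O b j" for j unfolding split by simp
  have "ennreal (l t y) \<le> ennreal (l b y)"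
    by (rule LIMSEQ_le[OF lim lim]) (use t le in auto)
  then show "l t y \<le> l b y" using l_pos by (simp add: ennreal_le_iff)
  have fin: "eventually (\<lambda>j. ?O t j < \<top>) sequentially"
    using order_tendstoD(2)[OF lim[OF t(1)], of \<top>] by simp
  have "(\<lambda>j. ?O b j - ?O t j) \<longlonglongrightarrow> ennreal (l b y) - ennreal (l t y)"
    by (intro tendsto_diff_ennreal lim) (use t in auto)
  then have "?A \<longlonglongrightarrow> ennreal (l b y) - ennreal (l t y)"
  proof (rule Lim_transform_eventually)
    show "eventually (\<lambda>j. ?O b j - ?O t j = ?A j) sequentially"
      using fin by eventually_elim (subst split, rule ennreal_add_diff_cancel_left, simp only: infinity_ennreal_def less_top)
  qed
  also have "ennreal (l b y) - ennreal (l t y) = ennreal (l b y - l t y)"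
    using l_pos by (simp add: ennreal_minus)
  also have "?A = (\<lambda>j. time_integral t b (\<lambda>r. ?c j * indicator (?D j) (x r)))"
  proof
    fix j
    have "(\<lambda>r. if t < r \<and> r \<le> b then indicator (?D j) (x r) else 0 :: ennreal) \<in> borel_measurable lborel"
    proof -
      have "(\<lambda>r. if t < r \<and> r \<le> b then indicator (?D j) (x r) else 0 :: ennreal)
          = (\<lambda>r. if r \<in> {t<..b} then indicator (?D j) (x r) else 0)" by auto
      moreover have "(\<lambda>r. indicator (?D j) (x r) :: ennreal) \<in> borel_measurable (restrict_space borel {t<..b})"
        by (rule measurable_compose[OF measurable_restrict_mono[OF x]]) (use t in auto)
      ultimately show ?thesis
        using measurable_restrict_space_iff[of "{t<..b}" borel 0 borel "\<lambda>r. indicator (?D j)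
            (x r) :: ennreal"] by simp
    qed
    then show "?A j = time_integral t b (\<lambda>r. ?c j * indicator (?D j) (x r))"
      by (subst nn_integral_cmult[symmetric]) (auto intro!: nn_integral_cong)
  qed
  finally show "(\<lambda>j. time_integral t b (\<lambda>r. ?c j * indicator (?D j) (x r)))
      \<longlonglongrightarrow> ennreal (l b y - l t y)" .
qed

text \<open>
Multiplication of extended reals is discontinuous at \<open>0\<close> and \<open>\<infinity>\<close>, so the limit is taken in the reals.
\<close>

lemma tendsto_ennreal_power:
  assumes f: "(f \<longlongrightarrow> ennreal a) F" and a: "0 \<le> a"
  shows "((\<lambda>x. f x ^ n) \<longlongrightarrow> ennreal (a ^ n)) F"
proof (rule Lim_transform_eventually)
  show "((\<lambda>x. ennreal (enn2real (f x) ^ n)) \<longlongrightarrow> ennreal (a ^ n)) F"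
    by (intro tendsto_ennrealI tendsto_power tendsto_enn2real f a)
  have "eventually (\<lambda>x. f x < \<top>) F"
    using order_tendstoD(2)[OF f, of \<top>] by simp
  then show "eventually (\<lambda>x. ennreal (enn2real (f x) ^ n) = f x ^ n) F"
    by eventually_elim (simp flip: ennreal_power)
qed

text \<open>
What a jointly continuous local time provides for a single path. From here on the local time enters only through
\<open>local_time_increment_tendsto\<close>, path by path.
\<close>

lemma continuous_local_time_facts:
  assumes bsf: "borel_sample_functions M X" and L: "jointly_continuous_local_time M X L"
  shows "AE \<omega> in M. (\<lambda>s. X s \<omega>) \<in> borel_measurable (restrict_space borel {0..}) \<and>
    (\<forall>t\<ge>0. (\<lambda>z. local_time_upto L t z \<omega>) \<in> borel_measurable borel) \<and>
    (\<forall>t\<ge>0. \<forall>y. isCont (\<lambda>z. local_time_upto L t z \<omega>) y) \<and>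
    (\<forall>t\<ge>0. \<forall>D\<in>sets borel. emeasure lborel {r \<in> {0..t}. X r \<omega> \<in> D}
      = (\<integral>\<^sup>+z. ennreal (local_time_upto L t z \<omega>) * indicator D z \<partial>lborel))"
proof -
  from L have 1: "AE \<omega> in M. \<forall>A \<in> sets borel. A \<subseteq> {0..} \<longrightarrow>
      (\<lambda>x. L A x \<omega>) \<in> borel_measurable borel \<and>
      occupation_measure (\<lambda>s. X s \<omega>) A = density lborel (\<lambda>x. L A x \<omega>)"
    and 2: "AE \<omega> in M. (\<forall>t\<ge>0. \<forall>x. L {0..t} x \<omega> < \<infinity>) \<and>
        continuous_on ({0..} \<times> UNIV) (\<lambda>(t, x). local_time_upto L t x \<omega>)"
    unfolding jointly_continuous_local_time_def is_local_time_def by blast+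
  show ?thesis
    using 1 2 AE_space
  proof eventually_elim
    case (elim \<omega>)
    have X: "(\<lambda>s. X s \<omega>) \<in> borel_measurable (restrict_space borel {0..})"
      using bsf elim(3) unfolding borel_sample_functions_def by blast
    have L_meas: "(\<lambda>x. L {0..t} x \<omega>) \<in> borel_measurable borel"
      and L_dens: "occupation_measure (\<lambda>s. X s \<omega>) {0..t} = density lborel (\<lambda>x. L {0..t} x \<omega>)" for t
      using elim(1) by (auto dest!: bspec[of _ _ "{0..t}"])
    have meas: "(\<lambda>z. local_time_upto L t z \<omega>) \<in> borel_measurable borel" for t
      unfolding local_time_upto_def using L_meas by measurable
    have cont: "isCont (\<lambda>z. local_time_upto L t z \<omega>) y" if "0 \<le> t" for t y
    proof -
      have "continuous_on UNIV (\<lambda>z. (\<lambda>(t, x). local_time_upto L t x \<omega>) (t, z))"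
        by (rule continuous_on_compose2[OF conjunct2[OF elim(2)]])
            (use that in \<open>auto intro!: continuous_intros\<close>)
      then show ?thesis by (simp add: continuous_on_eq_continuous_at)
    qed
    have occ: "emeasure lborel {r \<in> {0..t}. X r \<omega> \<in> D}
        = (\<integral>\<^sup>+z. ennreal (local_time_upto L t z \<omega>) * indicator D z \<partial>lborel)" if t: "0 \<le> t"
            and D: "D \<in> sets borel" for t D
    proof -
      have "emeasure lborel {r \<in> {0..t}. X r \<omega> \<in> D} = emeasure (occupation_measure (\<lambda>s. X s \<omega>) {0..t}) D"
        by (rule emeasure_occupation_measure[symmetric]) (use X D in auto)
      also have "\<dots> = (\<integral>\<^sup>+z. L {0..t} z \<omega> * indicator D z \<partial>lborel)"
        unfolding L_dens using D L_meas by (subst emeasure_density) auto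
      also have "\<dots> = (\<integral>\<^sup>+z. ennreal (local_time_upto L t z \<omega>) * indicator D z \<partial>lborel)"
        using elim(2) t by (intro nn_integral_cong) (simp add: local_time_upto_def)
      finally show ?thesis .
    qed
    show ?case using X meas cont occ by blast
  qed
qed

section \<open>The law of the iterated logarithm scale\<close>

text \<open>
The exponent \<open>h'\<close> stands for an upper bound of the Hurst function on an interval of length \<open>\<delta>\<close>. Replacing it by
\<open>h\<close> costs the factor \<open>(n / \<delta>) powr (h' - h)\<close>, which is at most \<open>exp (2 * k * K * exp (- \<beta> * k))\<close> and hence bounded.
\<close>

lemma logarithmic_moment_order:
  fixes h h' K \<beta> :: real and k :: nat
  defines "n \<equiv> nat \<lceil>ln (real k)\<rceil>" and "\<delta> \<equiv> exp (- real k)"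
  assumes k: "3 \<le> k" and h: "0 \<le> h" "h \<le> 1" and h': "h \<le> h'" "h' \<le> h + K * \<delta> powr \<beta>" and \<beta>: "0 < \<beta>"
      and K: "0 \<le> K"
  shows "1 \<le> n" "ln (real k) \<le> real n"
    "real n powr h' * \<delta> powr (1 - h') \<le> 2 * exp (2 * K / \<beta>) * (\<delta> powr (1 - h) * ln (real k) powr h)"
proof -
  have "exp 1 \<le> real k" using exp_le k by linarith
  then have ln1: "1 \<le> ln (real k)" using k by (simp add: ln_ge_iff)
  then show n1: "1 \<le> n" and "ln (real k) \<le> real n" unfolding n_def by linarith+
  have n2: "real n \<le> 2 * ln (real k)" "real n \<le> ln (real k) + 1" unfolding n_def using ln1 by linarith+
  have "ln (real k) \<le> real k - 1" using k by (intro ln_le_minus_one) auto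
  then have nk: "real n \<le> real k" using n2 by linarith
  also have "real k \<le> exp (real k)" using exp_ge_add_one_self[of "real k"] by linarith
  finally have "real n * exp (real k) \<le> exp (real k) * exp (real k)" by (rule mult_right_mono) simp
  then have n3: "real n / \<delta> \<le> exp (2 * real k)"
    by (simp add: \<delta>_def exp_minus divide_inverse flip: exp_add)
  let ?p = "h' - h"
  have \<delta>0: "0 < \<delta>" by (simp add: \<delta>_def)
  have "(real n / \<delta>) powr ?p \<le> exp (2 * real k) powr ?p"
    using n3 h' \<delta>0 by (intro powr_mono2) auto
  also have "\<dots> = exp (2 * real k * ?p)" by (simp add: powr_def mult.commute)
  also have "\<dots> \<le> exp (2 * K / \<beta>)"
  proof -
    have "\<beta> * real k \<le> exp (\<beta> * real k)" using exp_ge_add_one_self[of "\<beta> * real k"] by linarith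
    then have "real k * exp (- (\<beta> * real k)) \<le> 1 / \<beta>" using \<beta> by (simp add: exp_minus field_simps)
    then have "real k * \<delta> powr \<beta> \<le> 1 / \<beta>" by (simp add: \<delta>_def powr_def)
    then have "2 * K * (real k * \<delta> powr \<beta>) \<le> 2 * K * (1 / \<beta>)" using K by (intro mult_left_mono) auto
    moreover have "2 * real k * ?p \<le> 2 * real k * (K * \<delta> powr \<beta>)" using h' by (intro mult_left_mono) auto
    ultimately have "2 * real k * ?p \<le> 2 * K / \<beta>" by (simp add: mult_ac)
    then show ?thesis by simp
  qed
  finally have p: "(real n / \<delta>) powr ?p \<le> exp (2 * K / \<beta>)" .
  have "real n powr h \<le> (2 * ln (real k)) powr h" using n2 h by (intro powr_mono2) auto
  also have "\<dots> = 2 powr h * ln (real k) powr h" using ln1 by (simp add: powr_mult)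
  also have "\<dots> \<le> 2 powr 1 * ln (real k) powr h" using h by (intro mult_right_mono powr_mono) auto
  finally have q: "real n powr h \<le> 2 * ln (real k) powr h" by simp
  have quot: "(real n / \<delta>) powr x = real n powr x * \<delta> powr (- x)" for x
    using \<delta>0 by (simp add: powr_divide powr_minus_divide)
  have "real n powr h' * \<delta> powr (1 - h') = (real n powr h * real n powr ?p) * (\<delta> powr (1 - h) * \<delta> powr (- ?p))"
    by (simp flip: powr_add)
  also have "\<dots> = real n powr h * \<delta> powr (1 - h) * (real n / \<delta>) powr ?p"
    unfolding quot by (simp only: mult_ac)
  also have "\<dots> \<le> 2 * ln (real k) powr h * \<delta> powr (1 - h) * exp (2 * K / \<beta>)"
    using q p by (intro mult_mono) auto
  finally show "real n powr h' * \<delta> powr (1 - h') \<le> 2 * exp (2 * K / \<beta>) * (\<delta> powr (1 - h) * ln (real k) powr h)"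
    by (simp add: mult_ac)
qed

text \<open>
Between two consecutive scales \<open>exp (- k)\<close> the normalizing function changes by at most the factor \<open>exp 1\<close>, so a
monotone function may be compared with its value at the coarser scale.
\<close>

lemma geometric_scale_interpolation:
  fixes f :: "real \<Rightarrow> real"
  assumes mono: "\<And>\<delta> \<delta>'. 0 < \<delta> \<Longrightarrow> \<delta> \<le> \<delta>' \<Longrightarrow> f \<delta> \<le> f \<delta>'"
    and h: "0 \<le> h" "h \<le> 1" and D: "0 \<le> D"
    and ev: "eventually (\<lambda>k. f (exp (- real k))
        \<le> D * exp (- real k) powr (1 - h) * ln (real k) powr h) sequentially"
  shows "Limsup (at_right 0) (\<lambda>\<delta>. ereal (f \<delta> / (\<delta> powr (1 - h) * ln (ln (1 / \<delta>)) powr h))) \<le> ereal (D * exp 1)"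
proof (rule Limsup_bounded)
  from ev obtain k0 where k0: "\<And>k. k \<ge> k0 \<Longrightarrow> f (exp (- real k))
      \<le> D * exp (- real k) powr (1 - h) * ln (real k) powr h"
    by (auto simp: eventually_sequentially)
  have "eventually (\<lambda>\<delta>. \<delta> < exp (- real (k0 + 3))) (at_right (0::real))"
    by (rule order_tendstoD(2)[OF tendsto_ident_at]) simp
  then show "eventually (\<lambda>\<delta>. ereal (f \<delta> / (\<delta> powr (1 - h) * ln (ln (1 / \<delta>)) powr h))
      \<le> ereal (D * exp 1)) (at_right 0)"
    using eventually_at_right_less[of 0]
  proof eventually_elim
    case (elim \<delta>)
    let ?x = "ln (1 / \<delta>)"
    have lnx: "?x = - ln \<delta>" using elim by (simp add: ln_div)
    have "ln \<delta> < ln (exp (- real (k0 + 3)))" using elim by (subst ln_less_cancel_iff) auto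
    then have x: "real (k0 + 3) < ?x" "\<delta> = exp (- ?x)"
      using elim unfolding lnx by simp_all
    define k where "k = nat \<lfloor>?x\<rfloor>"
    have k: "real k \<le> ?x" "?x < real k + 1" "k \<ge> k0" "k \<ge> 3"
      using x(1) unfolding k_def by linarith+
    have lnk: "0 < ln (real k)" "ln (real k) \<le> ln ?x" using k by auto
    have "f \<delta> \<le> f (exp (- real k))" 
    proof (rule mono)
      show "\<delta> \<le> exp (- real k)" using k by (subst x(2)) simp
    qed (use elim in simp)
    also have "\<dots> \<le> D * exp (- real k) powr (1 - h) * ln (real k) powr h" by (rule k0) fact
    also have "\<dots> \<le> D * (exp 1 * \<delta> powr (1 - h)) * ln ?x powr h"
    proof (intro mult_mono powr_mono2)
      have "exp (- real k) \<le> exp 1 * \<delta>" using k by (subst x(2)) (simp flip: exp_add)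
      then have "exp (- real k) powr (1 - h) \<le> (exp 1 * \<delta>) powr (1 - h)" using h by (intro powr_mono2) auto
      also have "\<dots> = exp 1 powr (1 - h) * \<delta> powr (1 - h)" using elim by (simp add: powr_mult)
      also have "\<dots> \<le> exp 1 powr 1 * \<delta> powr (1 - h)" using h by (intro mult_right_mono powr_mono) auto
      finally show "exp (- real k) powr (1 - h) \<le> exp 1 * \<delta> powr (1 - h)" by simp
    qed (use h D lnk in auto)
    finally have "f \<delta> \<le> (D * exp 1) * (\<delta> powr (1 - h) * ln ?x powr h)" by (simp add: mult_ac)
    moreover have "0 < \<delta> powr (1 - h) * ln ?x powr h" using elim lnk by simp
    ultimately show ?case by (simp add: pos_divide_le_eq)
  qed
qed

section \<open>Multifractional Brownian motion\<close>

locale moving_average_mbm = line_brownian_motion M W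
  for M :: "'a measure" and W :: "real \<Rightarrow> 'a \<Rightarrow> real" +
  fixes H :: "real \<Rightarrow> real" and B :: "real \<Rightarrow> 'a \<Rightarrow> real" and \<mu> \<nu> \<beta> K :: real
  assumes H_pos: "0 < \<mu>" and H_less_1: "\<nu> < 1"
    and H_ge: "\<And>s. 0 \<le> s \<Longrightarrow> \<mu> \<le> H s" and H_le: "\<And>s. 0 \<le> s \<Longrightarrow> H s \<le> \<nu>"
    and \<beta>_pos: "0 < \<beta>" and K_nonneg: "0 \<le> K"
    and H_Hoelder: "\<And>s t. 0 \<le> s \<Longrightarrow> 0 \<le> t \<Longrightarrow> \<bar>H s - H t\<bar> \<le> K * \<bar>s - t\<bar> powr \<beta>"
    and mbm: "multifractional_brownian_motion M W H B"
begin

definition gam :: "real \<Rightarrow> real" where "gam t = Gamma (H t + 1 / 2)"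

lemma gam_pos: "0 \<le> t \<Longrightarrow> 0 < gam t"
  unfolding gam_def using H_ge[of t] H_pos by (intro Gamma_real_pos) linarith

lemma gam_bounded: "\<exists>g\<ge>1. \<forall>t\<ge>0. gam t \<le> g"
proof -
  have "continuous_on {\<mu> + 1 / 2..\<nu> + 1 / 2} (Gamma :: real \<Rightarrow> real)"
    using H_pos by (intro continuous_on_Gamma) (auto simp: nonpos_Ints_def)
  then have "compact (Gamma ` {\<mu> + 1 / 2..\<nu> + 1 / 2} :: real set)"
    by (rule compact_continuous_image) simp
  then obtain g where g: "\<And>x. x \<in> {\<mu> + 1 / 2..\<nu> + 1 / 2} \<Longrightarrow> norm (Gamma x :: real) \<le> g"
    by (meson bounded_iff compact_imp_bounded image_eqI)
  show ?thesis
  proof (intro exI[of _ "max 1 g"] conjI allI impI)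
    fix t :: real assume "0 \<le> t"
    then show "gam t \<le> max 1 g" using g[of "H t + 1 / 2"] H_ge[of t] H_le[of t] by (simp add: gam_def)
  qed simp
qed

lemma H_continuous: "continuous_on {0..} H"
  unfolding continuous_on_iff
proof (intro ballI allI impI)
  fix s e :: real assume "s \<in> {0..}" and e: "0 < e"
  then have s: "0 \<le> s" by simp
  let ?d = "(e / (K + 1)) powr (1 / \<beta>)"
  show "\<exists>d>0. \<forall>t\<in>{0..}. dist t s < d \<longrightarrow> dist (H t) (H s) < e"
  proof (intro exI[of _ ?d] conjI ballI impI)
    show "0 < ?d" using e K_nonneg by simp
    fix t assume "t \<in> {0..}" "dist t s < ?d"
    then have t: "0 \<le> t" "dist t s < ?d" by simp_all
    have "\<bar>H t - H s\<bar> \<le> K * \<bar>t - s\<bar> powr \<beta>" using t s by (intro H_Hoelder) auto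
    also have "\<dots> \<le> K * ?d powr \<beta>"
      using t \<beta>_pos K_nonneg by (intro mult_left_mono powr_mono2) (auto simp: dist_real_def)
    also have "?d powr \<beta> = e / (K + 1)" using \<beta>_pos e K_nonneg by (simp add: powr_powr)
    also have "K * (e / (K + 1)) < e" using e K_nonneg by (simp add: field_simps)
    finally show "dist (H t) (H s) < e" by (simp add: dist_real_def)
  qed
qed

lemma B_measurable: "0 \<le> t \<Longrightarrow> B t \<in> borel_measurable M"
  using mbm unfolding multifractional_brownian_motion_def by blast

lemma gam_B_wiener:
  assumes t: "0 \<le> t"
  shows "has_wiener_integral M W UNIV (mvg_kernel (H t - 1 / 2) t) (\<lambda>\<omega>. gam t * B t \<omega>)"
proof -
  let ?a = "H t - 1 / 2"
  obtain Y Z where Y: "has_wiener_integral M W {..<0} (\<lambda>u. (t - u) powr ?a - (- u) powr ?a) Y"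
    and Z: "has_wiener_integral M W {0<..<t} (\<lambda>u. (t - u) powr ?a) Z"
    and YZ: "AE \<omega> in M. B t \<omega> = 1 / Gamma (H t + 1 / 2) * (Y \<omega> + Z \<omega>)"
    using mbm t unfolding multifractional_brownian_motion_def by blast
  show ?thesis
  proof (rule wiener_integral_cong_AE[OF wiener_integral_combination[OF Y Z, of 1 1]])
    show "AE u in lborel. 1 * (indicator {..<0} u * ((t - u) powr ?a - (- u) powr ?a))
        + 1 * (indicator {0<..<t} u * (t - u) powr ?a) = mvg_kernel ?a t u"
      using AE_lborel_singleton[of 0] AE_lborel_singleton[of t]
      by eventually_elim (use t in \<open>auto simp: mvg_kernel_def pos_powr_def indicator_def\<close>)
    show "AE \<omega> in M. 1 * Y \<omega> + 1 * Z \<omega> = gam t * B t \<omega>"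
      using YZ by eventually_elim (use gam_pos[OF t] in \<open>simp add: gam_def\<close>)
    show "(\<lambda>\<omega>. gam t * B t \<omega>) \<in> borel_measurable M"
      using B_measurable[OF t] by measurable
  qed measurable
qed

lemma B_wiener:
  assumes t: "0 \<le> t"
  shows "has_wiener_integral M W UNIV (\<lambda>u. 1 / gam t * mvg_kernel (H t - 1 / 2) t u) (B t)"
proof (rule wiener_integral_cong_AE[OF wiener_integral_combination[OF gam_B_wiener[OF t] gam_B_wiener[OF t], of "1 / gam t" 0]])
  show "AE \<omega> in M. 1 / gam t * (gam t * B t \<omega>) + 0 * (gam t * B t \<omega>) = B t \<omega>"
    using gam_pos[OF t] by simp
qed (use B_measurable[OF t] in simp_all)

lemma B_adapted:
  assumes "0 \<le> r"
  obtains X where "X \<in> borel_measurable (increments {..r})" "AE \<omega> in M. B r \<omega> = X \<omega>"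
  by (rule wiener_integral_adapted[OF B_wiener[OF assms], of r])
     (use assms mvg_kernel_future in \<open>auto intro: that\<close>)

text \<open>
The local nondeterminism of the process: the variance of the noise after \<open>s\<close> is that of \<open>mvg_kernel_innovation\<close>.
\<close>

lemma B_window:
  assumes g: "\<forall>t\<ge>0. gam t \<le> g" and sr: "0 \<le> s" "s < r" and \<epsilon>: "0 < \<epsilon>"
    and Z: "Z \<in> borel_measurable (increments {..s})" and \<xi>: "\<xi> \<in> borel_measurable (increments {..s})"
  shows "(\<integral>\<^sup>+\<omega>. Z \<omega> * indicator (window (\<xi> \<omega>) \<epsilon>) (B r \<omega>) \<partial>M)
    \<le> ennreal (4 * g * \<epsilon> * (r - s) powr (- H r)) * (\<integral>\<^sup>+\<omega>. Z \<omega> \<partial>M)"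
proof -
  have r: "0 \<le> r" using sr by simp
  note Hr = H_ge[OF r] H_le[OF r] H_pos H_less_1
  have g0: "0 < gam r" "gam r \<le> g" using gam_pos[OF r] g r by auto
  \<comment> \<open>The noise after \<open>s\<close> has variance \<open>(r - s) powr (2 * H r) / (2 * H r * (gam r)\<^sup>2)\<close>, and \<open>2 * H r \<le> 4\<close>.\<close>
  let ?\<sigma> = "(r - s) powr H r / (2 * g)"
  have "?\<sigma>\<^sup>2 = (1 / (2 * g))\<^sup>2 * (r - s) powr (2 * H r)"
    by (simp add: power_divide powr_sq)
  also have "\<dots> \<le> (1 / gam r)\<^sup>2 * ((r - s) powr (2 * H r) / (2 * H r))"
  proof -
    have "1 / (2 * g) \<le> 1 / (2 * gam r)" using g0 by (simp add: frac_le)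
    then have "(1 / (2 * g))\<^sup>2 \<le> (1 / (2 * gam r))\<^sup>2" using g0 by (intro power_mono) auto
    also have "\<dots> = (1 / gam r)\<^sup>2 * (1 / 4)" by (simp add: power_divide power_mult_distrib)
    also have "\<dots> \<le> (1 / gam r)\<^sup>2 * (1 / (2 * H r))" using Hr by (intro mult_left_mono) (auto simp: field_simps)
    finally have "(1 / (2 * g))\<^sup>2 * (r - s) powr (2 * H r)
        \<le> (1 / gam r)\<^sup>2 * (1 / (2 * H r)) * (r - s) powr (2 * H r)"
      by (rule mult_right_mono) simp
    then show ?thesis by simp
  qed
  finally have "ennreal (?\<sigma>\<^sup>2) \<le> ennreal ((1 / gam r)\<^sup>2 * ((r - s) powr (2 * H r) / (2 * H r)))"
    by (rule ennreal_leI)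
  also have "\<dots> = ennreal ((1 / gam r)\<^sup>2) * ennreal ((r - s) powr (2 * H r) / (2 * H r))"
    using Hr by (intro ennreal_mult) auto
  also have "\<dots> \<le> ennreal ((1 / gam r)\<^sup>2)
      * sq_norm lborel (\<lambda>u. indicator {s<..} u * mvg_kernel (H r - 1 / 2) r u)"
    using mvg_kernel_innovation[OF sr, of "H r - 1 / 2"] Hr by (intro mult_left_mono) auto
  also have "ennreal ((1 / gam r)\<^sup>2) * sq_norm lborel (\<lambda>u. indicator {s<..} u * mvg_kernel (H r - 1 / 2) r u)
      = sq_norm lborel (\<lambda>u. indicator {s<..} u * (1 / gam r * mvg_kernel (H r - 1 / 2) r u))"
    by (subst nn_integral_cmult[symmetric])
       (auto intro!: nn_integral_cong simp: power_mult_distrib power_divide mult_ac simp flip: ennreal_mult)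
  finally have \<sigma>: "ennreal (?\<sigma>\<^sup>2)
      \<le> sq_norm lborel (\<lambda>u. indicator {s<..} u * (1 / gam r * mvg_kernel (H r - 1 / 2) r u))" .
  have \<sigma>0: "0 < ?\<sigma>" using sr g0 by simp
  have eq: "2 * \<epsilon> / ?\<sigma> = 4 * g * \<epsilon> * (r - s) powr (- H r)"
    by (simp add: powr_minus_divide)
  show ?thesis
    using wiener_integral_window[OF B_wiener[OF r] \<sigma>0 \<epsilon> \<sigma> Z \<xi>] unfolding eq .
qed

text \<open>
Moving from \<open>(s, H s)\<close> to \<open>(t, H t)\<close> by changing first the exponent and then the time. The Gamma factor is left out;
it is restored on the level of paths, where it is merely a continuous multiplier.
\<close>

lemma gam_B_increment_variance:
  assumes N: "0 \<le> N"
  obtains V where "0 < V" "\<And>s t. 0 \<le> s \<Longrightarrow> s < t \<Longrightarrow> t \<le> N \<Longrightarrow> t - s \<le> 1 \<Longrightarrow>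
    sq_norm lborel (\<lambda>u. mvg_kernel (H t - 1 / 2) t u - mvg_kernel (H s - 1 / 2) s u)
      \<le> ennreal (V * (t - s) powr (2 * min \<mu> \<beta>))"
proof -
  obtain C where C: "C \<ge> 0" "\<And>a b t. a \<in> {\<mu> - 1 / 2..\<nu> - 1 / 2} \<Longrightarrow> b \<in> {\<mu> - 1 / 2..\<nu> - 1 / 2} \<Longrightarrow> t \<in> {0..N} \<Longrightarrow>
    sq_norm lborel (\<lambda>u. mvg_kernel a t u - mvg_kernel b t u) \<le> ennreal (C * (a - b)\<^sup>2)"
    using mvg_kernel_exponent_increment[of "\<mu> - 1 / 2" "\<nu> - 1 / 2" N] H_pos H_less_1 N by auto
  define C1 where "C1 = 3 / (2 * \<mu>) + 8 + 1 / (2 - 2 * \<nu>)"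
  have C1: "0 < C1" unfolding C1_def using H_pos H_less_1 by (intro add_pos_pos) auto
  let ?e = "2 * min \<mu> \<beta>" and ?V = "2 * C1 + 2 * (C * K\<^sup>2)"
  show ?thesis
  proof (rule that[of ?V])
    show "0 < ?V" using C1 C(1) by (simp add: add_pos_nonneg)
    fix s t assume st: "0 \<le> s" "s < t" "t \<le> N" "t - s \<le> 1"
    let ?k = "\<lambda>t. mvg_kernel (H t - 1 / 2) t" and ?k' = "mvg_kernel (H t - 1 / 2) s" and ?d = "t - s"
    note Ht = H_ge[of t] H_le[of t] H_ge[of s] H_le[of s] H_pos H_less_1
    have "sq_norm lborel (\<lambda>u. ?k t u - ?k' u)
        \<le> ennreal ((3 / (2 * (H t - 1 / 2) + 1) + 8
            + 1 / (1 - 2 * (H t - 1 / 2))) * ?d powr (2 * (H t - 1 / 2) + 1))"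
      using mvg_kernel_time_increment[of ?d "H t - 1 / 2" s] st Ht by simp
    also have "\<dots> \<le> ennreal (C1 * ?d powr ?e)"
    proof (intro ennreal_leI mult_mono)
      show "3 / (2 * (H t - 1 / 2) + 1) + 8 + 1 / (1 - 2 * (H t - 1 / 2)) \<le> C1"
        unfolding C1_def using st Ht by (intro add_mono frac_le) auto
      show "?d powr (2 * (H t - 1 / 2) + 1) \<le> ?d powr ?e" using st Ht by (intro powr_mono') auto
    qed (use C1 in auto)
    finally have 1: "sq_norm lborel (\<lambda>u. ?k t u - ?k' u) \<le> ennreal (C1 * ?d powr ?e)" .
    have "sq_norm lborel (\<lambda>u. ?k' u - ?k s u) \<le> ennreal (C * ((H t - 1 / 2) - (H s - 1 / 2))\<^sup>2)"
      using st Ht by (intro C(2)) auto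
    also have "\<dots> \<le> ennreal (C * (K\<^sup>2 * ?d powr ?e))"
    proof (intro ennreal_leI mult_left_mono C)
      have "\<bar>H t - H s\<bar> \<le> \<bar>K * \<bar>t - s\<bar> powr \<beta>\<bar>" using H_Hoelder[of t s] st K_nonneg by (simp add: abs_mult)
      then have "(H t - H s)\<^sup>2 \<le> (K * \<bar>t - s\<bar> powr \<beta>)\<^sup>2" by (simp only: abs_le_square_iff)
      also have "\<dots> = K\<^sup>2 * ?d powr (2 * \<beta>)" using st by (simp add: power_mult_distrib powr_sq)
      also have "\<dots> \<le> K\<^sup>2 * ?d powr ?e" using st by (intro mult_left_mono powr_mono') auto
      finally show "((H t - 1 / 2) - (H s - 1 / 2))\<^sup>2 \<le> K\<^sup>2 * ?d powr ?e" by simp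
    qed
    finally have 2: "sq_norm lborel (\<lambda>u. ?k' u - ?k s u) \<le> ennreal (C * (K\<^sup>2 * ?d powr ?e))" .
    have "sq_norm lborel (\<lambda>u. ?k t u - ?k s u)
        \<le> ennreal (2 * 1\<^sup>2) * sq_norm lborel (\<lambda>u. ?k t u - ?k' u)
          + ennreal (2 * 1\<^sup>2) * sq_norm lborel (\<lambda>u. ?k' u - ?k s u)"
      by (rule L2_triangle) auto
    also have "\<dots> \<le> ennreal 2 * ennreal (C1 * ?d powr ?e) + ennreal 2 * ennreal (C * (K\<^sup>2 * ?d powr ?e))"
      using 1 2 by (intro add_mono mult_mono) auto
    also have "\<dots> = ennreal (2 * (C1 * ?d powr ?e) + 2 * (C * (K\<^sup>2 * ?d powr ?e)))"
      using C1 C(1) by (subst ennreal_plus) (auto simp: ennreal_mult)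
    also have "2 * (C1 * ?d powr ?e) + 2 * (C * (K\<^sup>2 * ?d powr ?e)) = ?V * ?d powr ?e"
      by (simp add: algebra_simps)
    finally show "sq_norm lborel (\<lambda>u. ?k t u - ?k s u) \<le> ennreal (?V * ?d powr ?e)" .
  qed
qed

lemma gam_B_continuous_version:
  assumes S: "countable S"
  shows "AE \<omega> in M. \<exists>g. continuous_on {0..<real N} g \<and> (\<forall>s\<in>S \<inter> {0..<real N}. gam s * B s \<omega> = g s)"
proof -
  obtain V where V: "0 < V" "\<And>s t. 0 \<le> s \<Longrightarrow> s < t \<Longrightarrow> t \<le> real N \<Longrightarrow> t - s \<le> 1 \<Longrightarrow>
    sq_norm lborel (\<lambda>u. mvg_kernel (H t - 1 / 2) t u - mvg_kernel (H s - 1 / 2) s u)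
      \<le> ennreal (V * (t - s) powr (2 * min \<mu> \<beta>))"
    using gam_B_increment_variance[of "real N"] by auto
  let ?e = "2 * min \<mu> \<beta>"
  have e: "0 < ?e" using H_pos \<beta>_pos by simp
  \<comment> \<open>The order of the moment is so high that the time increment enters with a power of at least \<open>3\<close>.\<close>
  define m where "m = Suc (nat \<lceil>3 / ?e\<rceil>)"
  have m: "m > 0" "3 \<le> real m * ?e"
  proof -
    have "3 / ?e \<le> real m" unfolding m_def by linarith
    then show "3 \<le> real m * ?e" using e by (simp add: pos_divide_le_eq)
  qed (simp add: m_def)
  let ?C = "fact (2 * m) / (2 ^ m * fact m) * (4 * V) ^ m :: real"
  show ?thesis
  proof (rule continuous_version[where m = m and C = ?C])
    fix s t assume st: "0 \<le> s" "s \<le> t" "t \<le> real N" "t - s \<le> 1"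
    show "(\<integral>\<^sup>+\<omega>. ennreal ((gam t * B t \<omega> - gam s * B s \<omega>) ^ (2 * m)) \<partial>M) \<le> ennreal (?C * (t - s) ^ 3)"
    proof (cases "s = t")
      case True
      then show ?thesis using m by (simp add: zero_power)
    next
      case False
      then have "s < t" using st by simp
      have t: "0 \<le> t" using st by simp
      have W: "has_wiener_integral M W UNIV (\<lambda>u. mvg_kernel (H t - 1 / 2) t u - mvg_kernel (H s - 1 / 2) s u)
          (\<lambda>\<omega>. gam t * B t \<omega> - gam s * B s \<omega>)"
        using wiener_integral_combination[OF gam_B_wiener[OF t] gam_B_wiener[OF st(1)], of 1 "- 1"] by simp
      have "(\<integral>\<^sup>+\<omega>. ennreal ((gam t * B t \<omega> - gam s * B s \<omega>) ^ (2 * m)) \<partial>M)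
          \<le> ennreal (fact (2 * m) / (2 ^ m * fact m) * (4 * (V * (t - s) powr ?e)) ^ m)"
        by (rule wiener_integral_moment[OF W]) (use V \<open>s < t\<close> st in auto)
      also have "\<dots> \<le> ennreal (?C * (t - s) ^ 3)"
      proof (rule ennreal_leI)
        have "((t - s) powr ?e) ^ m = (t - s) powr (real m * ?e)" using \<open>s < t\<close> by (subst powr_power) auto
        also have "\<dots> \<le> (t - s) powr 3" using \<open>s < t\<close> st m by (intro powr_mono') auto
        also have "\<dots> = (t - s) ^ 3" using \<open>s < t\<close> by simp
        finally have "?C * ((t - s) powr ?e) ^ m \<le> ?C * (t - s) ^ 3"
          using V(1) by (intro mult_left_mono) auto
        then show "fact (2 * m) / (2 ^ m * fact m) * (4 * (V * (t - s) powr ?e)) ^ m \<le> ?C * (t - s) ^ 3"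
          by (simp add: power_mult_distrib mult.assoc)
      qed
      finally show ?thesis .
    qed
  next
    show "(\<lambda>\<omega>. gam t * B t \<omega>) \<in> borel_measurable M" if "0 \<le> t" for t
      using B_measurable[OF that] by measurable
  qed (use m V(1) S in auto)
qed

text \<open>
Continuity is known on the countable set of times that separates the process; separability extends it to all times.
\<close>

lemma B_continuous:
  assumes sep: "separable_process M B"
  shows "AE \<omega> in M. continuous_on {0..} (\<lambda>s. B s \<omega>)"
proof -
  obtain S where S: "countable S" "S \<subseteq> {0..}"
    and AE: "AE \<omega> in M. \<forall>a b K. closed K \<longrightarrow>
      (\<forall>s\<in>S \<inter> {a<..<b}. B s \<omega> \<in> K) \<longrightarrow> (\<forall>s\<in>{0..} \<inter> {a<..<b}. B s \<omega> \<in> K)"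
    using sep unfolding separable_process_def by blast
  have "AE \<omega> in M. \<forall>N. \<exists>g. continuous_on {0..<real N} g \<and> (\<forall>s\<in>S \<inter> {0..<real N}. gam s * B s \<omega> = g s)"
    unfolding AE_all_countable using gam_B_continuous_version[OF S(1)] by blast
  with AE show ?thesis
  proof eventually_elim
    case (elim \<omega>)
    have gam_cont: "continuous_on {0..} gam"
      unfolding gam_def[abs_def]
    proof (rule continuous_on_compose2[of "{\<mu> + 1 / 2..}" Gamma])
      show "continuous_on {\<mu> + 1 / 2..} (Gamma :: real \<Rightarrow> real)"
        using H_pos by (intro continuous_on_Gamma) (auto simp: nonpos_Ints_def)
      show "continuous_on {0..} (\<lambda>t. H t + 1 / 2)" by (intro continuous_intros H_continuous)
    qed (use H_ge in auto)
    have cont: "continuous_on {0..<real N} (\<lambda>s. B s \<omega>)" for N :: nat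
    proof -
      obtain g where g: "continuous_on {0..<real N} g" "\<And>s. s \<in> S \<inter> {0..<real N} \<Longrightarrow> gam s * B s \<omega> = g s"
        using elim(2) by blast
      have cont: "continuous_on {0..<real N} (\<lambda>s. g s / gam s)"
        by (intro continuous_on_divide g continuous_on_subset[OF gam_cont]) (use gam_pos in force)+
      have "B s \<omega> = g s / gam s" if "s \<in> {0..<real N}" for s
      proof (rule separable_path_eq[OF _ S(2) cont])
        show "B s \<omega> = g s / gam s" if "s \<in> S" "s < real N" for s
          using g(2)[of s] that S(2) gam_pos[of s] by (force simp: field_simps)
        show "\<forall>s\<in>{0..} \<inter> {a<..<b}. B s \<omega> \<in> C" if "closed C" "\<forall>s\<in>S \<inter> {a<..<b}. B s \<omega> \<in> C" for a b C
          using elim(1) that by blast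
      qed (use that in auto)
      then show ?thesis by (intro continuous_on_eq[OF cont]) simp
    qed
    show "continuous_on {0..} (\<lambda>s. B s \<omega>)"
      unfolding continuous_on_eq_continuous_within
    proof
      fix s :: real assume s: "s \<in> {0..}"
      obtain N :: nat where N: "s < real N" using reals_Archimedean2 by blast
      have "continuous (at s within {0..<real N}) (\<lambda>s. B s \<omega>)"
        using cont[of N] s N by (auto simp: continuous_on_eq_continuous_within)
      moreover have "at s within {0..<real N} = at s within {0..}"
        by (rule at_within_nhd[of s "{..<real N}"]) (use N s in auto)
      ultimately show "continuous (at s within {0..}) (\<lambda>s. B s \<omega>)" by simp
    qed
  qed
qed

text \<open>
A jointly measurable substitute for \<open>B\<close>, which agrees with it wherever the path is continuous. The cut-off
\<open>max 0 r\<close> keeps to the times at which \<open>B\<close> is measurable.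
\<close>

definition B_path :: "real \<Rightarrow> 'a \<Rightarrow> real" where
  "B_path r \<omega> = lim (\<lambda>n. B (dyadic_floor n (max 0 r)) \<omega>)"

lemma B_path_eq:
  assumes c: "continuous_on {0..} (\<lambda>s. B s \<omega>)" and r: "0 \<le> r"
  shows "B_path r \<omega> = B r \<omega>"
proof -
  have "(\<lambda>n. B (dyadic_floor n r) \<omega>) \<longlonglongrightarrow> B r \<omega>"
    by (rule continuous_on_tendsto_compose[OF c dyadic_floor_tendsto])
       (use r in \<open>auto intro!: always_eventually dyadic_floor_nonneg\<close>)
  then show ?thesis using r by (simp add: B_path_def limI)
qed

lemma B_path_measurable: "(\<lambda>x. B_path (fst x) (snd x)) \<in> borel_measurable (borel \<Otimes>\<^sub>M M)"
  unfolding B_path_def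
proof (rule borel_measurable_lim_metric)
  fix n
  have "(\<lambda>x. B (real (nat \<lfloor>(2 :: real) ^ n * max 0 (fst x)\<rfloor>) / 2 ^ n) (snd x)) \<in> borel_measurable (borel \<Otimes>\<^sub>M M)"
  proof (rule measurable_compose_countable[where f = "\<lambda>k x. B (real k / 2 ^ n) (snd x)"])
    show "(\<lambda>x. B (real k / 2 ^ n) (snd x)) \<in> borel_measurable (borel \<Otimes>\<^sub>M M)" for k
      by (rule measurable_compose[OF measurable_snd B_measurable]) simp
    show "(\<lambda>x. nat \<lfloor>(2 :: real) ^ n * max 0 (fst x)\<rfloor>) \<in> measurable (borel \<Otimes>\<^sub>M M) (count_space UNIV)"
      by measurable
  qed
  moreover have "real (nat \<lfloor>2 ^ n * max 0 r\<rfloor>) / 2 ^ n = dyadic_floor n (max 0 r)" for r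
    by (simp add: dyadic_floor_def)
  ultimately show "(\<lambda>x. B (dyadic_floor n (max 0 (fst x))) (snd x)) \<in> borel_measurable (borel \<Otimes>\<^sub>M M)"
    by simp
qed

definition window_occupation :: "real \<Rightarrow> real \<Rightarrow> real \<Rightarrow> ('a \<Rightarrow> real) \<Rightarrow> 'a \<Rightarrow> ennreal" where
  "window_occupation t \<delta> \<epsilon> \<xi> \<omega> = time_integral t (t
      + \<delta>) (\<lambda>r. ennreal (1 / (2 * \<epsilon>)) * indicator (window (\<xi> \<omega>) \<epsilon>) (B_path r \<omega>))"

lemma window_measurable:
  assumes [measurable]: "\<xi> \<in> borel_measurable M"
  shows "(\<lambda>x. ennreal c * indicator (window (\<xi> (snd x)) \<epsilon>) (B_path (fst x) (snd x)))
    \<in> borel_measurable (borel \<Otimes>\<^sub>M M)"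
proof -
  note [measurable] = B_path_measurable
  have eq: "(\<lambda>x. ennreal c * indicator (window (\<xi> (snd x)) \<epsilon>) (B_path (fst x) (snd x)))
      = (\<lambda>x. if \<xi> (snd x) - \<epsilon> < B_path (fst x) (snd x) \<and> B_path (fst x) (snd x) < \<xi> (snd x) + \<epsilon>
           then ennreal c else 0)"
    by (auto simp: fun_eq_iff indicator_def)
  show ?thesis unfolding eq by measurable
qed

lemma window_occupation_measurable:
  assumes \<xi>: "\<xi> \<in> borel_measurable M"
  shows "window_occupation t \<delta> \<epsilon> \<xi> \<in> borel_measurable M"
proof -
  let ?\<phi> = "\<lambda>x. ennreal (1 / (2 * \<epsilon>)) * indicator (window (\<xi> (snd x)) \<epsilon>) (B_path (fst x) (snd x))"
  have "(\<lambda>\<omega>. (\<lambda>x. time_integral (fst x) (t + \<delta>) (\<lambda>r. ?\<phi> (r, snd x))) (t, \<omega>))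
      \<in> borel_measurable M"
    by (rule measurable_compose[OF measurable_Pair1' occupation_integral_measurable[OF window_measurable[OF \<xi>]]]) simp
  then show ?thesis unfolding fst_conv snd_conv window_occupation_def[abs_def] .
qed

text \<open>
\<open>occupation_moment_bound\<close> with the rate \<open>\<theta> = n / \<delta>\<close>. This choice keeps the factor \<open>exp (\<theta> * \<delta>)\<close> at
\<open>exp n\<close>, while the \<open>n\<close>-th power of \<open>\<theta> powr (h - 1)\<close> reduces \<open>fact n\<close> to the order \<open>n powr (n * h)\<close>.
\<close>

lemma window_occupation_moment:
  assumes cont: "AE \<omega> in M. continuous_on {0..} (\<lambda>s. B s \<omega>)"
    and g: "1 \<le> g" "\<forall>t\<ge>0. gam t \<le> g" and t: "0 \<le> t" and \<delta>: "0 < \<delta>" "\<delta> \<le> 1" and \<epsilon>: "0 < \<epsilon>"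
    and h: "0 \<le> h" "h \<le> \<nu>" "\<And>r. r \<in> {t..t + \<delta>} \<Longrightarrow> H r \<le> h" and n: "1 \<le> n"
    and \<xi>: "\<xi> \<in> borel_measurable (increments {..t})"
  shows "(\<integral>\<^sup>+\<omega>. window_occupation t \<delta> \<epsilon> \<xi> \<omega> ^ n \<partial>M)
    \<le> ennreal ((exp 1 * (2 * g * (1 / (1 - \<nu>) + 1)) * (real n powr h * \<delta> powr (1 - h))) ^ n)"
proof -
  have \<xi>M: "\<xi> \<in> borel_measurable M" using \<xi> by (rule measurable_increments_events)
  let ?\<phi> = "\<lambda>x. ennreal (1 / (2 * \<epsilon>)) * indicator (window (\<xi> (snd x)) \<epsilon>) (B_path (fst x) (snd x))"
  let ?C = "1 / (1 - \<nu>) + 1" and ?\<theta> = "real n / \<delta>"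
  let ?K = "ennreal (2 * g * (?C * ?\<theta> powr (h - 1)))"
  let ?e = "\<lambda>s r. ennreal (exp (- ?\<theta> * (r - s)))" and ?p = "\<lambda>s r. (r - s) powr (- h)"
  have \<theta>: "0 < ?\<theta>" using n \<delta> by simp
  have C: "0 < ?C" using H_less_1 by (intro add_pos_pos) auto
  have path: "AE \<omega> in M. B_path r \<omega> = B r \<omega>" if "0 \<le> r" for r
    using cont by eventually_elim (rule B_path_eq[OF _ that])
  have "(\<integral>\<^sup>+\<omega>. 1 * time_integral t (t + \<delta>) (\<lambda>r. ?\<phi> (r, \<omega>)) ^ n \<partial>M)
    \<le> fact n * ?K ^ n * ennreal (exp (?\<theta> * (t + \<delta> - t))) * (\<integral>\<^sup>+\<omega>. 1 \<partial>M)"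
  proof (rule occupation_moment_bound[where F = "\<lambda>r. increments {..r}" and t = t
        and \<kappa> = "\<lambda>s r. ennreal (2 * g * ?p s r)"])
    show "sigma_finite_measure M" by unfold_locales
    show "0 \<le> ?\<theta>" using \<theta> by simp
    show "?\<phi> \<in> borel_measurable (borel \<Otimes>\<^sub>M M)" by (rule window_measurable[OF \<xi>M])
    show "\<exists>\<phi>'\<in>borel_measurable (increments {..r}). AE \<omega> in M. ?\<phi> (r, \<omega>) = \<phi>' \<omega>"
      if r: "t < r" "r \<le> t + \<delta>" for r
    proof -
      have r0: "0 \<le> r" using r t by simp
      obtain X where [measurable]: "X \<in> borel_measurable (increments {..r})" and X: "AE \<omega> in M. B r \<omega> = X \<omega>"
        using B_adapted[OF r0] by blast
      have [measurable]: "\<xi> \<in> borel_measurable (increments {..r})"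
        using measurable_increments_mono[OF \<xi>] r by simp
      let ?\<phi>' = "\<lambda>\<omega>. if \<xi> \<omega> - \<epsilon> < X \<omega> \<and> X \<omega> < \<xi> \<omega> + \<epsilon> then ennreal (1 / (2 * \<epsilon>)) else 0"
      have "AE \<omega> in M. ?\<phi> (r, \<omega>) = ?\<phi>' \<omega>"
        using X path[OF r0] by eventually_elim (auto simp: indicator_def)
      moreover have "?\<phi>' \<in> borel_measurable (increments {..r})" by measurable
      ultimately show ?thesis by (intro bexI[of _ ?\<phi>'])
    qed
    show "(\<integral>\<^sup>+\<omega>. Z \<omega> * ?\<phi> (r, \<omega>) \<partial>M) \<le> ennreal (2 * g * ?p s r) * (\<integral>\<^sup>+\<omega>. Z \<omega> \<partial>M)"
      if s: "t \<le> s" "s < r" "r \<le> t + \<delta>" and Z: "Z \<in> borel_measurable (increments {..s})" for s r Z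
    proof -
      have sr: "0 \<le> s" "0 \<le> r" using s t by auto
      have \<xi>s: "\<xi> \<in> borel_measurable (increments {..s})"
        using measurable_increments_mono[OF \<xi>] s by simp
      have [measurable]: "Z \<in> borel_measurable M" using Z by (rule measurable_increments_events)
      note [measurable] = \<xi>M B_measurable[OF sr(2)]
      have ind: "(\<lambda>\<omega>. indicator (window (\<xi> \<omega>) \<epsilon>) (B r \<omega>) :: ennreal) \<in> borel_measurable M"
      proof -
        have eq: "(\<lambda>\<omega>. indicator (window (\<xi> \<omega>) \<epsilon>) (B r \<omega>) :: ennreal)
          = (\<lambda>\<omega>. if \<xi> \<omega> - \<epsilon> < B r \<omega> \<and> B r \<omega> < \<xi> \<omega> + \<epsilon> then 1 else 0)"
          by (auto simp: fun_eq_iff indicator_def)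
        show ?thesis unfolding eq by measurable
      qed
      have "(\<integral>\<^sup>+\<omega>. Z \<omega> * ?\<phi> (r, \<omega>) \<partial>M)
          = (\<integral>\<^sup>+\<omega>. ennreal (1 / (2 * \<epsilon>)) * (Z \<omega> * indicator (window (\<xi> \<omega>) \<epsilon>) (B r \<omega>)) \<partial>M)"
        by (rule nn_integral_cong_AE, use path[OF sr(2)] in eventually_elim) (simp add: mult_ac)
      also have "\<dots> = ennreal (1 / (2 * \<epsilon>)) * (\<integral>\<^sup>+\<omega>. Z \<omega> * indicator (window (\<xi> \<omega>) \<epsilon>) (B r \<omega>) \<partial>M)"
        by (rule nn_integral_cmult) (use ind in measurable)
      also have "\<dots> \<le> ennreal (1 / (2 * \<epsilon>)) * (ennreal (4 * g * \<epsilon> * (r - s) powr (- H r)) * (\<integral>\<^sup>+\<omega>. Z \<omega> \<partial>M))"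
        using B_window[OF g(2) sr(1) s(2) \<epsilon> Z \<xi>s] by (intro mult_left_mono) auto
      also have "\<dots> = ennreal (2 * g * (r - s) powr (- H r)) * (\<integral>\<^sup>+\<omega>. Z \<omega> \<partial>M)"
        using \<epsilon> g(1) by (simp add: mult.assoc[symmetric] flip: ennreal_mult)
      also have "\<dots> \<le> ennreal (2 * g * ?p s r) * (\<integral>\<^sup>+\<omega>. Z \<omega> \<partial>M)"
        using g(1) s \<delta> h(3)[of r] by (intro mult_right_mono ennreal_leI mult_left_mono powr_mono') auto
      finally show ?thesis .
    qed
    show "(\<lambda>r. ennreal (2 * g * ?p s r)) \<in> borel_measurable borel" for s by measurable
    show "time_integral s (t + \<delta>) (\<lambda>r. ennreal (2 * g * ?p s r) * ?e s r) \<le> ?K"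
      for s
    proof -
      have "time_integral s (t + \<delta>) (\<lambda>r. ennreal (2 * g * ?p s r) * ?e s r)
          = (\<integral>\<^sup>+r. ennreal (2 * g) * (if s < r \<and> r \<le> t + \<delta> then ennreal (?p s r) * ?e s r else 0) \<partial>lborel)"
        using g(1) by (intro nn_integral_cong) (auto simp: ennreal_mult mult.assoc)
      also have "\<dots> = ennreal (2 * g) * time_integral s (t + \<delta>) (\<lambda>r. ennreal (?p s r) * ?e s r)"
        by (rule nn_integral_cmult) measurable
      also have "\<dots> \<le> ennreal (2 * g) * ennreal ((1 / (1 - h) + 1) * ?\<theta> powr (h - 1))"
        using h H_less_1 \<theta> by (intro mult_left_mono exp_power_kernel_bound) auto
      also have "\<dots> \<le> ennreal (2 * g) * ennreal (?C * ?\<theta> powr (h - 1))"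
        using h H_less_1 by (intro mult_left_mono ennreal_leI mult_right_mono add_mono frac_le) auto
      also have "\<dots> = ?K" using g(1) C by (simp flip: ennreal_mult)
      finally show ?thesis .
    qed
    show "(\<lambda>\<omega>. 1 :: ennreal) \<in> borel_measurable (increments {..t})" by simp
    show "space (increments {..r}) = space M" for r by simp
    show "sets (increments {..r}) \<subseteq> sets M" for r by (rule sets_increments_events)
    show "sets (increments {..s}) \<subseteq> sets (increments {..r})" if "s \<le> r" for s r
      by (rule sets_increments_mono) (use that in auto)
  qed (use \<delta> in auto)
  also have "\<dots> = fact n * ?K ^ n * ennreal (exp 1 ^ n)"
    using \<delta> by (simp add: emeasure_space_1 exp_of_nat_mult[symmetric])
  also have "\<dots> \<le> of_nat (n ^ n) * ?K ^ n * ennreal (exp 1 ^ n)"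
  proof (intro mult_right_mono)
    have "(of_nat (fact n) :: ennreal) \<le> of_nat (n ^ n)" using fact_le_power[of n, where 'a = nat]
        by (simp only: of_nat_le_iff of_nat_id)
    then show "(fact n :: ennreal) \<le> of_nat (n ^ n)" by (simp only: of_nat_fact)
  qed auto
  also have "\<dots> = ennreal ((real n * (2 * g * (?C * ?\<theta> powr (h - 1))) * exp 1) ^ n)"
  proof -
    have "of_nat (n ^ n) * ennreal x ^ n * ennreal (exp 1 ^ n) = ennreal ((real n * x * exp 1) ^ n)"
      if "0 \<le> x" for x
    proof -
      have "(of_nat (n ^ n) :: ennreal) = ennreal (real n ^ n)" by (simp add: ennreal_of_nat_eq_real_of_nat)
      then show ?thesis
        using that by (simp only: ennreal_power power_mult_distrib)
          (simp flip: ennreal_mult)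
    qed
    from this[of "2 * g * (?C * ?\<theta> powr (h - 1))"] show ?thesis using g(1) C by simp
  qed
  also have "real n * (2 * g * (?C * ?\<theta> powr (h - 1))) * exp 1
      = exp 1 * (2 * g * ?C) * (real n powr h * \<delta> powr (1 - h))"
  proof -
    have quot: "?\<theta> powr x = real n powr x * \<delta> powr (- x)" for x
      using \<delta> by (simp add: powr_divide powr_minus_divide)
    have "real n * ?\<theta> powr (h - 1) = real n powr 1 * (real n powr (h - 1) * \<delta> powr (- (h - 1)))"
      unfolding quot using n by simp
    also have "\<dots> = real n powr h * \<delta> powr (1 - h)" 
      unfolding mult.assoc[symmetric] powr_add[symmetric] by simp
    finally have eq: "real n * ?\<theta> powr (h - 1) = real n powr h * \<delta> powr (1 - h)" .
    have "real n * (2 * g * (?C * ?\<theta> powr (h - 1))) * exp 1 = exp 1 * (2 * g * ?C) * (real n * ?\<theta> powr (h - 1))"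
      by (simp only: mult_ac)
    then show ?thesis unfolding eq .
  qed
  finally show ?thesis unfolding window_occupation_def fst_conv snd_conv mult_1 .
qed

text \<open>
The level \<open>\<xi>\<close> may be random as long as it is known at time \<open>t\<close>. The scales are \<open>\<delta> k = exp (- k)\<close>, the order of the
moment at scale \<open>k\<close> is \<open>n k\<close>, about \<open>ln (ln (1 / \<delta> k))\<close>, and \<open>m k ^ n k\<close> bounds that moment.
\<close>

lemma local_time_upper_bound:
  assumes sep: "separable_process M B" and bsf: "borel_sample_functions M B"
    and L: "jointly_continuous_local_time M B L" and t: "0 \<le> t"
    and \<xi>': "\<xi>' \<in> borel_measurable (increments {..t})" and \<xi>: "AE \<omega> in M. \<xi> \<omega> = \<xi>' \<omega>"
  shows "\<exists>C>0. AE \<omega> in M. Limsup (at_right 0)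
    (\<lambda>\<delta>. ereal ((local_time_upto L (t + \<delta>) (\<xi> \<omega>) \<omega> - local_time_upto L t (\<xi> \<omega>) \<omega>)
      / (\<delta> powr (1 - H t) * ln (ln (1 / \<delta>)) powr H t))) \<le> ereal C"
proof -
  obtain g where g: "1 \<le> g" "\<forall>t\<ge>0. gam t \<le> g" using gam_bounded by blast
  note cont = B_continuous[OF sep]
  define \<Lambda> where "\<Lambda> = exp 1 * (2 * g * (1 / (1 - \<nu>) + 1))"
  have \<Lambda>: "0 < \<Lambda>" unfolding \<Lambda>_def using g(1) H_less_1 by (intro mult_pos_pos add_pos_pos) auto
  define \<delta> where "\<delta> k = exp (- real k)" for k
  define n where "n k = nat \<lceil>ln (real k)\<rceil>" for k
  \<comment> \<open>An upper bound of \<open>H\<close> on \<open>[t, t + \<delta> k]\<close> that stays away from \<open>1\<close> and is close to \<open>H t\<close>.\<close>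
  define h where "h k = min \<nu> (H t + K * \<delta> k powr \<beta>)" for k
  define m where "m k = \<Lambda> * (real (n k) powr h k * \<delta> k powr (1 - h k))" for k
  define \<epsilon> where "\<epsilon> j = inverse (real (Suc j))" for j
  have \<epsilon>: "0 < \<epsilon> j" "\<epsilon> \<longlonglongrightarrow> 0" for j unfolding \<epsilon>_def using LIMSEQ_inverse_real_of_nat by auto
  have \<delta>: "0 < \<delta> k" "\<delta> k \<le> 1" for k by (auto simp: \<delta>_def)
  have \<xi>M [measurable]: "\<xi>' \<in> borel_measurable M" using \<xi>' by (rule measurable_increments_events)
  have h_ge: "H t \<le> h k" for k using H_le[OF t] K_nonneg by (simp add: h_def)
  have h0: "0 \<le> h k" for k using h_ge[of k] H_ge[OF t] H_pos by linarith
  have h_local: "H r \<le> h k" if "r \<in> {t..t + \<delta> k}" for r k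
  proof -
    have "\<bar>H r - H t\<bar> \<le> K * \<bar>r - t\<bar> powr \<beta>" using that t by (intro H_Hoelder) auto
    also have "\<dots> \<le> K * \<delta> k powr \<beta>" using that \<beta>_pos K_nonneg by (intro mult_left_mono powr_mono2) auto
    finally show ?thesis using H_le[of r] that t by (simp add: h_def)
  qed
  have order: "1 \<le> n k" "ln (real k) \<le> real (n k)"
    "m k \<le> \<Lambda> * (2 * exp (2 * K / \<beta>) * (\<delta> k powr (1 - H t) * ln (real k) powr H t))" if "3 \<le> k" for k
  proof -
    have h: "0 \<le> H t" "H t \<le> 1" using H_ge[OF t] H_le[OF t] H_pos H_less_1 by linarith+
    have "h k \<le> H t + K * exp (- real k) powr \<beta>" by (simp add: h_def \<delta>_def)
    from logarithmic_moment_order[OF that h h_ge this \<beta>_pos K_nonneg]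
    show "1 \<le> n k" "ln (real k) \<le> real (n k)"
      "m k \<le> \<Lambda> * (2 * exp (2 * K / \<beta>) * (\<delta> k powr (1 - H t) * ln (real k) powr H t))"
      unfolding n_def m_def \<delta>_def using \<Lambda> by (auto intro!: mult_left_mono)
  qed
  \<comment> \<open>Measurable stand-ins for the powers of the increments of the local time, with which they agree
    almost surely.\<close>
  define U where "U k \<omega> = liminf (\<lambda>j. window_occupation t (\<delta> k) (\<epsilon> j) \<xi>' \<omega> ^ n k)" for k \<omega>
  have U_meas [measurable]: "U k \<in> borel_measurable M" for k
  proof -
    have "(\<lambda>\<omega>. window_occupation t (\<delta> k) (\<epsilon> j) \<xi>' \<omega> ^ n k) \<in> borel_measurable M" for j
      using window_occupation_measurable[OF \<xi>M] by measurable
    then show ?thesis unfolding U_def[abs_def] by measurable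
  qed
  have U_mean: "(\<integral>\<^sup>+\<omega>. U k \<omega> \<partial>M) \<le> ennreal (m k ^ n k)" if k: "3 \<le> k" for k
  proof -
    have "(\<integral>\<^sup>+\<omega>. U k \<omega> \<partial>M) \<le> liminf (\<lambda>j. \<integral>\<^sup>+\<omega>. window_occupation t (\<delta> k) (\<epsilon> j) \<xi>' \<omega> ^ n k \<partial>M)"
      unfolding U_def by (rule nn_integral_liminf) (use window_occupation_measurable[OF \<xi>M] in measurable)
    also have "\<dots> \<le> ennreal (m k ^ n k)"
    proof (rule Liminf_le)
      show "eventually (\<lambda>j. (\<integral>\<^sup>+\<omega>. window_occupation t (\<delta> k) (\<epsilon> j) \<xi>' \<omega> ^ n k \<partial>M)
          \<le> ennreal (m k ^ n k)) sequentially"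
        unfolding m_def \<Lambda>_def
        by (intro always_eventually allI window_occupation_moment[OF cont g t \<delta> \<epsilon>(1) h0 _ h_local order(1)[OF k] \<xi>'])
           (simp add: h_def)
    qed simp
    finally show ?thesis .
  qed
  \<comment> \<open>The factor \<open>exp 2\<close> brings the exceptional probabilities below \<open>exp (- 2 * n k)\<close>, which is summable.\<close>
  let ?A = "\<lambda>k. {\<omega>\<in>space M. ennreal ((exp 2 * m k) ^ n k) \<le> U k \<omega>}"
  have m_pos: "0 < m k" if "3 \<le> k" for k
    unfolding m_def using \<Lambda> order(1)[OF that] \<delta>(1)[of k] by simp
  have A_prob: "emeasure M (?A k) \<le> ennreal (1 / (real k)\<^sup>2)" if k: "3 \<le> k" for k
  proof -
    let ?q = "1 / (exp 2 * m k) ^ n k"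
    have q: "0 < ?q" using m_pos[OF k] by simp
    have "?A k \<subseteq> {\<omega>\<in>space M. 1 \<le> ennreal ?q * U k \<omega>}"
    proof safe
      fix \<omega> assume "ennreal ((exp 2 * m k) ^ n k) \<le> U k \<omega>"
      then have "ennreal ?q * ennreal ((exp 2 * m k) ^ n k) \<le> ennreal ?q * U k \<omega>" by (rule mult_left_mono) simp
      moreover have "ennreal ?q * ennreal ((exp 2 * m k) ^ n k) = 1"
        using m_pos[OF k] by (simp flip: ennreal_mult)
      ultimately show "1 \<le> ennreal ?q * U k \<omega>" by simp
    qed
    then have "emeasure M (?A k) \<le> emeasure M {\<omega>\<in>space M. 1 \<le> ennreal ?q * U k \<omega>}"
      by (rule emeasure_mono) measurable
    also have "\<dots> \<le> ennreal ?q * (\<integral>\<^sup>+\<omega>. U k \<omega> * indicator (space M) \<omega> \<partial>M)"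
      by (rule nn_integral_Markov_inequality) auto
    also have "\<dots> = ennreal ?q * (\<integral>\<^sup>+\<omega>. U k \<omega> \<partial>M)"
      by (intro arg_cong2[where f = "(*)"] refl nn_integral_cong) simp
    also have "\<dots> \<le> ennreal ?q * ennreal (m k ^ n k)" by (intro mult_left_mono U_mean k) simp
    also have "\<dots> = ennreal (1 / exp 2 ^ n k)"
      using m_pos[OF k] by (simp add: power_mult_distrib flip: ennreal_mult)
    also have "\<dots> \<le> ennreal (1 / (real k)\<^sup>2)"
    proof (intro ennreal_leI divide_left_mono mult_pos_pos)
      have "real k = exp (ln (real k))" using k by simp
      also have "\<dots> \<le> exp (real (n k))" using order(2)[OF k] by simp
      finally have "(real k)\<^sup>2 \<le> (exp (real (n k)))\<^sup>2" by (intro power_mono) auto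
      also have "\<dots> = exp 2 ^ n k" by (simp add: power2_eq_square flip: exp_add exp_of_nat_mult)
      finally show "(real k)\<^sup>2 \<le> exp 2 ^ n k" .
    qed (use k in auto)
    finally show ?thesis .
  qed
  \<comment> \<open>The shift by \<open>3\<close> ensures \<open>ln k \<ge> 1\<close>.\<close>
  have "AE \<omega> in M. eventually (\<lambda>j. \<omega> \<in> space M - ?A (j + 3)) sequentially"
  proof (rule borel_cantelli_AE1)
    show "?A (j + 3) \<in> sets M" for j by measurable
    have le: "norm (measure M (?A (j + 3))) \<le> 1 / (real (j + 3))\<^sup>2" for j
      using A_prob[of "j + 3"] by (simp add: emeasure_eq_measure)
    have sq: "summable (\<lambda>j. 1 / (real (j + 3))\<^sup>2)"
      using summable_ignore_initial_segment[OF inverse_power_summable[of 2, where 'a = real], of 3]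
      by (simp only: inverse_eq_divide)
    show "summable (\<lambda>j. measure M (?A (j + 3)))"
      by (rule summable_comparison_test'[OF sq le])
    show "emeasure M (?A (j + 3)) < \<infinity>" for j
      by (simp only: emeasure_eq_measure infinity_ennreal_def ennreal_less_top)
  qed
  then have tail: "AE \<omega> in M. eventually (\<lambda>k. U k \<omega> < ennreal ((exp 2 * m k) ^ n k)) sequentially"
  proof eventually_elim
    case (elim \<omega>)
    then have "eventually (\<lambda>j. U (j + 3) \<omega> < ennreal ((exp 2 * m (j + 3)) ^ n (j + 3))) sequentially"
      by eventually_elim auto
    then show ?case by (rule eventually_sequentially_seg[THEN iffD1])
  qed
  let ?D = "exp 2 * (\<Lambda> * (2 * exp (2 * K / \<beta>)))"
  show ?thesis
  proof (intro exI[of _ "?D * exp 1"] conjI)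
    show "0 < ?D * exp 1" using \<Lambda> by simp
    show "AE \<omega> in M. Limsup (at_right 0)
      (\<lambda>\<delta>. ereal ((local_time_upto L (t + \<delta>) (\<xi> \<omega>) \<omega> - local_time_upto L t (\<xi> \<omega>) \<omega>)
      / (\<delta> powr (1 - H t) * ln (ln (1 / \<delta>)) powr H t))) \<le> ereal (?D * exp 1)"
      using tail cont \<xi> continuous_local_time_facts[OF bsf L]
    proof eventually_elim
      case (elim \<omega>)
      let ?l = "\<lambda>s z. local_time_upto L s z \<omega>" and ?y = "\<xi> \<omega>"
      have l: "(\<lambda>s. B s \<omega>) \<in> borel_measurable (restrict_space borel {0..})"
        "\<And>s. 0 \<le> s \<Longrightarrow> ?l s \<in> borel_measurable borel" "\<And>s z. 0 \<le> ?l s z"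
        "\<And>s. 0 \<le> s \<Longrightarrow> isCont (?l s) ?y"
        "\<And>s D. 0 \<le> s \<Longrightarrow> D \<in> sets borel \<Longrightarrow>
           emeasure lborel {r \<in> {0..s}. B r \<omega> \<in> D} = (\<integral>\<^sup>+z. ennreal (?l s z) * indicator D z \<partial>lborel)"
        using elim(4) by (auto simp: local_time_upto_def)
      have mono: "?l s ?y \<le> ?l s' ?y" if "0 \<le> s" "s \<le> s'" for s s'
        by (rule local_time_increment_tendsto(2)[OF l _ _ \<epsilon>]) (use that in simp_all)
      have lim: "(\<lambda>j. time_integral t b (\<lambda>r. ennreal (1 / (2 * \<epsilon> j)) * indicator (window ?y (\<epsilon> j)) (B r \<omega>)))
          \<longlonglongrightarrow> ennreal (?l b ?y - ?l t ?y)" if "t \<le> b" for b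
        by (rule local_time_increment_tendsto(1)[OF l _ _ \<epsilon>]) (use t that in simp_all)
      \<comment> \<open>\<open>B_path\<close> and \<open>\<xi>'\<close> are replaced by \<open>B\<close> and \<open>\<xi>\<close>, with which they agree at this sample point.\<close>
      have incr: "(\<lambda>j. window_occupation t d (\<epsilon> j) \<xi>' \<omega>) \<longlonglongrightarrow> ennreal (?l (t + d) ?y - ?l t ?y)"
        if d: "0 \<le> d" for d
      proof -
        have "window_occupation t d (\<epsilon> j) \<xi>' \<omega>
            = time_integral t (t + d) (\<lambda>r. ennreal (1 / (2 * \<epsilon> j)) * indicator (window ?y (\<epsilon> j)) (B r \<omega>))" for j
          unfolding window_occupation_def
          using B_path_eq[OF elim(2)] t elim(3) by (intro nn_integral_cong) auto
        moreover have "t \<le> t + d" using d by simp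
        ultimately show ?thesis using lim[of "t + d"] by simp
      qed
      have "eventually (\<lambda>k. U k \<omega> < ennreal ((exp 2 * m k) ^ n k) \<and> 3 \<le> k) sequentially"
        using elim(1) eventually_ge_at_top by (rule eventually_conj)
      then have "eventually (\<lambda>k. ?l (t + exp (- real k)) ?y - ?l t ?y
          \<le> ?D * exp (- real k) powr (1 - H t) * ln (real k) powr H t) sequentially"
      proof eventually_elim
        case (elim k)
        then have k: "3 \<le> k" and U: "U k \<omega> < ennreal ((exp 2 * m k) ^ n k)" by auto
        let ?i = "?l (t + \<delta> k) ?y - ?l t ?y"
        have i0: "0 \<le> ?i" using mono[OF t, of "t + \<delta> k"] \<delta>(1)[of k] by simp
        have "(\<lambda>j. window_occupation t (\<delta> k) (\<epsilon> j) \<xi>' \<omega> ^ n k) \<longlonglongrightarrow> ennreal (?i ^ n k)"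
          by (rule tendsto_ennreal_power[OF incr i0]) (use \<delta>(1)[of k] in simp)
        then have "U k \<omega> = ennreal (?i ^ n k)" unfolding U_def by (intro lim_imp_Liminf) auto
        then have "?i ^ n k < (exp 2 * m k) ^ n k" using U i0 by (simp add: ennreal_less_iff)
        then have "?i < exp 2 * m k"
          by (rule power_less_imp_less_base) (use m_pos[OF k] in simp)
        also have "\<dots> \<le> exp 2 * (\<Lambda> * (2 * exp (2 * K / \<beta>) * (\<delta> k powr (1 - H t) * ln (real k) powr H t)))"
          by (intro mult_left_mono order k) simp
        finally show ?case by (simp add: \<delta>_def mult_ac)
      qed
      then show ?case
        using H_ge[OF t] H_le[OF t] H_pos H_less_1 \<Lambda> t mono
        by (intro geometric_scale_interpolation[of "\<lambda>d. ?l (t + d) ?y - ?l t ?y"]) auto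
    qed
  qed
qed

end

theorem theorem3p2:
  fixes M :: "'a measure"
    and W B :: "real \<Rightarrow> 'a \<Rightarrow> real"
    and H :: "real \<Rightarrow> real"
    and \<mu> \<nu> \<beta> :: real
    and L :: "real set \<Rightarrow> real \<Rightarrow> 'a \<Rightarrow> ennreal"
  assumes "0 < \<mu>" and "\<nu> < 1"
    and "\<forall>s\<ge>0. H s \<in> {\<mu>..\<nu>}"
    and "\<exists>K. \<forall>s\<ge>0. \<forall>t\<ge>0. \<bar>H s - H t\<bar> \<le> K * \<bar>s - t\<bar> powr \<beta>"
    and "(SUP s\<in>{0..}. H s) < \<beta>"
    and "brownian_motion M W"
    and "multifractional_brownian_motion M W H B"
    and "separable_process M B" and "borel_sample_functions M B"
    and "jointly_continuous_local_time M B L"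
  shows "\<forall>t\<ge>0. \<forall>x. \<exists>C1>0. \<exists>C2>0.
    (AE \<omega> in M. Limsup (at_right 0)
       (\<lambda>\<delta>. ereal ((local_time_upto L (t + \<delta>) (B t \<omega>) \<omega> - local_time_upto L t (B t \<omega>) \<omega>)
                   / (\<delta> powr (1 - H t) * ln (ln (1 / \<delta>)) powr H t))) \<le> ereal C1) \<and>
    (AE \<omega> in M. Limsup (at_right 0)
       (\<lambda>\<delta>. ereal ((local_time_upto L (t + \<delta>) x \<omega> - local_time_upto L t x \<omega>)
                   / (\<delta> powr (1 - H t) * ln (ln (1 / \<delta>)) powr H t))) \<le> ereal C2)"
proof -
  let ?limsup = "\<lambda>t y \<omega>. Limsup (at_right 0)
    (\<lambda>\<delta>. ereal ((local_time_upto L (t + \<delta>) y \<omega> - local_time_upto L t y \<omega>)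
      / (\<delta> powr (1 - H t) * ln (ln (1 / \<delta>)) powr H t)))"
  from assms(4) obtain K where K: "\<And>s t. 0 \<le> s \<Longrightarrow> 0 \<le> t \<Longrightarrow> \<bar>H s - H t\<bar> \<le> K * \<bar>s - t\<bar> powr \<beta>" by blast
  have "\<mu> \<le> H 0" using assms(3) by simp
  also have "H 0 \<le> (SUP s\<in>{0..}. H s)"
    using assms(3) by (intro cSUP_upper bdd_aboveI2[where M = \<nu>]) auto
  finally have \<beta>: "0 < \<beta>" using assms(1,5) by linarith
  interpret moving_average_mbm M W H B \<mu> \<nu> \<beta> "max 0 K"
  proof unfold_locales
    show "\<bar>H s - H t\<bar> \<le> max 0 K * \<bar>s - t\<bar> powr \<beta>" if "0 \<le> s" "0 \<le> t" for s t
      using K[OF that] by (rule order_trans) (intro mult_right_mono; simp)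
  qed (use assms \<beta> in auto)
  note bound = local_time_upper_bound[OF assms(8-10)]
  show ?thesis
  proof (intro allI impI)
    fix t x :: real assume t: "0 \<le> t"
    obtain B' where B': "B' \<in> borel_measurable (increments {..t})" "AE \<omega> in M. B t \<omega> = B' \<omega>"
      using B_adapted[OF t] by blast
    obtain C1 where C1: "C1 > 0" "AE \<omega> in M. ?limsup t (B t \<omega>) \<omega> \<le> ereal C1"
      using bound[OF t B'] by blast
    obtain C2 where C2: "C2 > 0" "AE \<omega> in M. ?limsup t x \<omega> \<le> ereal C2"
    proof -
      have "(\<lambda>_. x) \<in> borel_measurable (increments {..t})" "AE \<omega> in M. x = x" by simp_all
      from bound[OF t this] show ?thesis using that by blast
    qed
    show "\<exists>C1>0. \<exists>C2>0.
    (AE \<omega> in M. ?limsup t (B t \<omega>) \<omega> \<le> ereal C1) \<and>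
    (AE \<omega> in M. ?limsup t x \<omega> \<le> ereal C2)"
      using C1 C2 by blast
  qed
qed

end
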